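(* Let $(\gamma,\eta)\in(1/2,1)\times(-\infty,+\infty)\ \cup\ \{1\}\times(-\infty,0]$, let $d_1>0$ and $$d_n=\frac{1}{n^{\gamma}\ln^{\eta}n}\qquad(n\ge 2),$$ and let $X=\{x_n\}_{n=0}^\infty$ with $x_0=0$, $x_n=x_{n-1}+d_n$ for $n\in\mathbb{N}$. Let $\alpha=\{\alpha_n\}_{n=1}^\infty$ be a real sequence. Then $\mathrm{H}_{X,\alpha}$ is self-adjoint provided that one of the following conditions holds: (sa1) $\displaystyle\sum_{n=2}^{\infty}|\alpha_n|\,n^{-3\gamma}\ln^{-3\eta}n=\infty$; (sa2) there exists a constant $C_1>0$ such that $$\alpha_n\le -2\bigl(n^{\gamma}\ln^{\eta}n+(n+1)^{\gamma}\ln^{\eta}(n+1)\bigr)+\frac{C_1}{n^{\gamma}\ln^{\eta}n}\qquad(n\ge 2);$$ (sa3) there exists a constant $C_2>0$ such that $$\alpha_n\ge -\frac{C_2}{n^{\gamma}\ln^{\eta}n}\qquad(n\ge 2).$$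
   Context: $\mathbb{N}=\{1,2,\dots\}$, $\mathbb{R}_+=(0,\infty)$, and $\ln^{\eta}n=(\ln n)^{\eta}$. Given a strictly increasing sequence $X=\{x_n\}_{n=0}^\infty$ with $x_0=0$, $x_n\to\infty$, and a real sequence $\alpha=\{\alpha_n\}_{n=1}^\infty$, let $\mathrm{H}^0_{X,\alpha}$ be the operator $f\mapsto -f''$ (derivatives taken on $\mathbb{R}_+\setminus X$) in $L^2(\mathbb{R}_+)$ with domain consisting of all $f\in W^{2,2}(\mathbb{R}_+\setminus X)$ with compact support in $[0,\infty)$ such that $f'(0+)=0$ and, for every $n\ge1$, $f(x_n+)=f(x_n-)=:f(x_n)$ and $f'(x_n+)-f'(x_n-)=\alpha_n f(x_n)$. The Hamiltonian $\mathrm{H}_{X,\alpha}$ is the closure of $\mathrm{H}^0_{X,\alpha}$ in $L^2(\mathbb{R}_+)$; it is the realization of $-\frac{d^2}{dx^2}+\sum_{n\ge1}\alpha_n\delta(x-x_n)$. *)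

theory Defs
  imports "HOL-Analysis.Analysis"
begin

text \<open>
  Elements of $L^2(S)$ are represented by square-integrable functions; equality in $L^2(S)$
  is equality almost everywhere. A (possibly unbounded) operator in $L^2(S)$ is represented by
  its graph, a set of pairs of such representatives.
\<close>

definition l2 :: "real set \<Rightarrow> (real \<Rightarrow> complex) set" where
  "l2 S = {f. f \<in> borel_measurable (lebesgue_on S) \<and>
              integrable (lebesgue_on S) (\<lambda>t. (cmod (f t))\<^sup>2)}"

definition l2_inner :: "real set \<Rightarrow> (real \<Rightarrow> complex) \<Rightarrow> (real \<Rightarrow> complex) \<Rightarrow> complex" where
  "l2_inner S f g = (LINT t|lebesgue_on S. f t * cnj (g t))"

definition l2_norm :: "real set \<Rightarrow> (real \<Rightarrow> complex) \<Rightarrow> real" where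
  "l2_norm S f = sqrt (LINT t|lebesgue_on S. (cmod (f t))\<^sup>2)"

definition l2_dense :: "real set \<Rightarrow> (real \<Rightarrow> complex) set \<Rightarrow> bool" where
  "l2_dense S D \<longleftrightarrow> D \<subseteq> l2 S \<and>
     (\<forall>f\<in>l2 S. \<forall>\<epsilon>>0. \<exists>g\<in>D. l2_norm S (\<lambda>t. f t - g t) < \<epsilon>)"

type_synonym l2_graph = "((real \<Rightarrow> complex) \<times> (real \<Rightarrow> complex)) set"

definition graph_closure :: "real set \<Rightarrow> l2_graph \<Rightarrow> l2_graph" where
  "graph_closure S G = {(f, g). f \<in> l2 S \<and> g \<in> l2 S \<and>
     (\<exists>F. (\<forall>k::nat. F k \<in> G) \<and>
        (\<lambda>k. l2_norm S (\<lambda>t. fst (F k) t - f t)) \<longlonglongrightarrow> 0 \<and>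
        (\<lambda>k. l2_norm S (\<lambda>t. snd (F k) t - g t)) \<longlonglongrightarrow> 0)}"

definition graph_adjoint :: "real set \<Rightarrow> l2_graph \<Rightarrow> l2_graph" where
  "graph_adjoint S G = {(u, v). u \<in> l2 S \<and> v \<in> l2 S \<and>
     (\<forall>(f, g)\<in>G. l2_inner S g u = l2_inner S f v)}"

text \<open>
  Linearity and single-valuedness (up to null sets) need not be required separately:
  an adjoint graph is linear, and it is single-valued because the domain is dense.
\<close>

definition self_adjoint :: "real set \<Rightarrow> l2_graph \<Rightarrow> bool" where
  "self_adjoint S G \<longleftrightarrow> l2_dense S (fst ` G) \<and> graph_adjoint S G = G"

definition test_fun :: "real set \<Rightarrow> (real \<Rightarrow> real) set" where
  "test_fun U = {\<phi>. (\<forall>k t. (deriv ^^ k) \<phi> field_differentiable (at t)) \<and>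
                     (\<exists>K. compact K \<and> K \<subseteq> U \<and> (\<forall>t. t \<notin> K \<longrightarrow> \<phi> t = 0))}"

text \<open>
  Below, the following notion is only used for functions that are continuous or square-integrable
  on the open set \<open>U\<close>, so all integrals exist. Real test functions suffice, by linearity.
\<close>

definition weak_derivative :: "real set \<Rightarrow> (real \<Rightarrow> complex) \<Rightarrow> (real \<Rightarrow> complex) \<Rightarrow> bool" where
  "weak_derivative U f g \<longleftrightarrow>
     (\<forall>\<phi>\<in>test_fun U. (LINT t|lebesgue_on U. of_real (deriv \<phi> t) * f t) =
                   - (LINT t|lebesgue_on U. of_real (\<phi> t) * g t))"

definition sobolev22 :: "real set \<Rightarrow> (real \<Rightarrow> complex) set" where
  "sobolev22 U = {f \<in> l2 U. \<exists>f1\<in>l2 U. \<exists>f2\<in>l2 U. weak_derivative U f f1 \<and> weak_derivative U f1 f2}"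

text \<open>
  In one dimension a function in $W^{2,2}$ and its weak derivative have representatives that are
  continuous off \<open>X\<close>. One-sided limits are those of these representatives, called \<open>u\<close>
  and \<open>u1\<close> in the definition of the operator. Points are indexed as \<open>x 0 = 0\<close>,
  \<open>x 1\<close>, ...; the value \<open>\<alpha> 0\<close> is not used.
\<close>

definition interface_conditions ::
    "(nat \<Rightarrow> real) \<Rightarrow> (nat \<Rightarrow> real) \<Rightarrow> (real \<Rightarrow> complex) \<Rightarrow> (real \<Rightarrow> complex) \<Rightarrow> bool" where
  "interface_conditions x \<alpha> u u1 \<longleftrightarrow>
     (u1 \<longlongrightarrow> 0) (at_right 0) \<and>
     (\<forall>n\<ge>1. \<exists>c a b.
        (u \<longlongrightarrow> c) (at_left (x n)) \<and> (u \<longlongrightarrow> c) (at_right (x n)) \<and>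
        (u1 \<longlongrightarrow> a) (at_left (x n)) \<and> (u1 \<longlongrightarrow> b) (at_right (x n)) \<and>
        b - a = of_real (\<alpha> n) * c)"

definition hamiltonian0 :: "(nat \<Rightarrow> real) \<Rightarrow> (nat \<Rightarrow> real) \<Rightarrow> l2_graph" where
  "hamiltonian0 x \<alpha> = (let U = {0<..} - range x in
     {(f, g). f \<in> l2 {0<..} \<and> g \<in> l2 {0<..} \<and> f \<in> sobolev22 U \<and>
        (\<exists>R. AE t in lebesgue_on {0<..}. t > R \<longrightarrow> f t = 0) \<and>
        (\<exists>u u1. continuous_on U u \<and> continuous_on U u1 \<and>
           (AE t in lebesgue_on {0<..}. f t = u t) \<and>
           weak_derivative U u u1 \<and> weak_derivative U u1 (\<lambda>t. - g t) \<and>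
           interface_conditions x \<alpha> u u1)})"

definition hamiltonian :: "(nat \<Rightarrow> real) \<Rightarrow> (nat \<Rightarrow> real) \<Rightarrow> l2_graph" where
  "hamiltonian x \<alpha> = graph_closure {0<..} (hamiltonian0 x \<alpha>)"

end

theory Submission
  imports Defs
begin

text \<open>
  Self-adjointness of the closure means that the adjoint of the minimal operator is contained in
  the closure. Everything reduces to one assertion about functions \<open>u\<close>, \<open>w\<close> that
  satisfy the interface conditions and are square-integrable together with their second
  derivatives off the nodes: the boundary form $u w' - u' w$ at $x_n$, if it converges at all,
  converges to zero (\<open>self_adjoint_if_brackets_vanish\<close>). Indeed, elements of the adjoint are
  such functions (\<open>adjoint_regular\<close>), Green's identity makes the boundary form converge to
  the defect of symmetry of the adjoint, and a symmetric adjoint is contained in the closure by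
  the projection theorem (\<open>adjoint_subset_closure\<close>).

  The assertion is discrete. On an interval of length $\delta_n = x_{n+1} - x_n$ such a function
  is linear up to an error controlled by the $L^2$ norm of its second derivative. Hence the node
  values $u_n = u(x_n)$ satisfy
  \[ \frac{u_{n+2}-u_{n+1}}{\delta_{n+1}} - \frac{u_{n+1}-u_n}{\delta_n} = \alpha_{n+1} u_{n+1} + e_n \]
  where $\sum \delta_n |u_{n+1}|^2$ and $\sum |e_n|^2 / \delta_n$ are finite
  (\<open>sol_admissible\<close>), and the boundary form may be replaced by the Wronskian
  $(u_n w_{n+1} - u_{n+1} w_n)/\delta_n$ (\<open>wronskian_approximates_bracket\<close>).
  Suppose this Wronskian tends to \<open>c\<close>.

  Under (sa1): $|\alpha_{n+1}| \delta_n^3$ times the Wronskian at $n+1$ is summable, because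
  $\delta_n^{3/2} \alpha_{n+1} u_{n+1}$ and $\delta_n^{3/2}$ times the difference quotient are
  square-summable; as $\sum |\alpha_{n+1}| \delta_n^3 = \infty$, \<open>c\<close> is zero
  (\<open>wronskian_limit_large\<close>).

  Under (sa3): if the energy $\sum \delta_n |(u_{n+1}-u_n)/\delta_n|^2$ were infinite, the
  difference equation would force $|u_n|$ to increase eventually, which is impossible since
  $\sum \delta_n |u_{n+1}|^2 < \infty = \sum \delta_n$ (\<open>energy_summable\<close>). With finite
  energy $\delta_n$ times the Wronskian is summable, and again \<open>c\<close> is zero
  (\<open>wronskian_limit_lower\<close>).

  Under (sa2): the substitution $u_n \mapsto (-1)^n u_n$ leads back to (sa3)
  (\<open>wronskian_limit_upper\<close>).

  The step sizes enter through four properties: they are positive and bounded, consecutive ones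
  are comparable, and their sum is infinite.
\<close>

section \<open>The space of square-integrable functions\<close>

lemma l2_I:
  assumes "f \<in> borel_measurable (lebesgue_on S)" "integrable (lebesgue_on S) (\<lambda>t. (cmod (f t))\<^sup>2)"
  shows "f \<in> l2 S"
  using assms by (simp add: l2_def)

lemma l2_meas: "f \<in> l2 S \<Longrightarrow> f \<in> borel_measurable (lebesgue_on S)"
  by (simp add: l2_def)

lemma l2_int: "f \<in> l2 S \<Longrightarrow> integrable (lebesgue_on S) (\<lambda>t. (cmod (f t))\<^sup>2)"
  by (simp add: l2_def)

lemma l2_dominated:
  assumes "f \<in> borel_measurable (lebesgue_on S)" "integrable (lebesgue_on S) w"
    "\<And>t. t \<in> S \<Longrightarrow> (cmod (f t))\<^sup>2 \<le> w t"
  shows "f \<in> l2 S"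
proof (rule l2_I)
  show "integrable (lebesgue_on S) (\<lambda>t. (cmod (f t))\<^sup>2)"
    apply (rule Bochner_Integration.integrable_bound [OF assms(2)])
    using assms(1) apply measurable
    apply (rule AE_I2)
    using assms(3) by fastforce
qed (fact assms(1))

lemma cmod_add_squared_le: "(cmod (a + b))\<^sup>2 \<le> 2 * (cmod a)\<^sup>2 + 2 * (cmod b)\<^sup>2"
proof -
  have "(cmod (a + b))\<^sup>2 \<le> (cmod a + cmod b)\<^sup>2"
    by (intro power_mono norm_triangle_ineq) simp
  also have "\<dots> \<le> 2 * (cmod a)\<^sup>2 + 2 * (cmod b)\<^sup>2"
    using zero_le_power2 [of "cmod a - cmod b"] by (simp add: power2_eq_square algebra_simps)
  finally show ?thesis .
qed

lemma l2_add: "f \<in> l2 S \<Longrightarrow> g \<in> l2 S \<Longrightarrow> (\<lambda>t. f t + g t) \<in> l2 S"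
  by (rule l2_dominated [where w = "\<lambda>t. 2 * (cmod (f t))\<^sup>2 + 2 * (cmod (g t))\<^sup>2"])
     (use l2_meas l2_int cmod_add_squared_le in \<open>auto\<close>)

lemma l2_cmult: "f \<in> l2 S \<Longrightarrow> (\<lambda>t. c * f t) \<in> l2 S"
  by (rule l2_dominated [where w = "\<lambda>t. (cmod c)\<^sup>2 * (cmod (f t))\<^sup>2"])
     (use l2_meas l2_int in \<open>auto simp: norm_mult power_mult_distrib\<close>)

lemma l2_zero: "(\<lambda>t. 0) \<in> l2 S"
  by (rule l2_I) auto

lemma l2_uminus: "f \<in> l2 S \<Longrightarrow> (\<lambda>t. - f t) \<in> l2 S"
  using l2_cmult [of f S "-1"] by simp

lemma l2_diff: "f \<in> l2 S \<Longrightarrow> g \<in> l2 S \<Longrightarrow> (\<lambda>t. f t - g t) \<in> l2 S"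
  using l2_add [of f S "\<lambda>t. - g t"] l2_uminus by simp

lemma l2_restrict:
  assumes "f \<in> l2 S" "T \<subseteq> S" "S \<in> sets lebesgue" "T \<in> sets lebesgue"
  shows "f \<in> l2 T"
proof (rule l2_I)
  show "f \<in> borel_measurable (lebesgue_on T)"
    by (rule measurable_restrict_mono [OF l2_meas [OF assms(1)] assms(2)])
  have "set_integrable lebesgue S (\<lambda>t. (cmod (f t))\<^sup>2)"
    using l2_int [OF assms(1)] assms(3) by (simp add: set_integrable_def integrable_restrict_space)
  then have "set_integrable lebesgue T (\<lambda>t. (cmod (f t))\<^sup>2)"
    by (rule set_integrable_subset) (use assms in auto)
  then show "integrable (lebesgue_on T) (\<lambda>t. (cmod (f t))\<^sup>2)"
    using assms(4) by (simp add: set_integrable_def integrable_restrict_space)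
qed

lemma measurable_cnj: "f \<in> borel_measurable M \<Longrightarrow> (\<lambda>t. cnj (f t)) \<in> borel_measurable M"
  by (rule borel_measurable_continuous_on) (auto intro: continuous_intros)

lemma l2_cnj: "f \<in> l2 S \<Longrightarrow> (\<lambda>t. cnj (f t)) \<in> l2 S"
  by (auto simp: l2_def intro: measurable_cnj)

lemma l2_mult_integrable:
  assumes "f \<in> l2 S" "g \<in> l2 S"
  shows "integrable (lebesgue_on S) (\<lambda>t. f t * g t)"
proof (rule Bochner_Integration.integrable_bound)
  show "integrable (lebesgue_on S) (\<lambda>t. (cmod (f t))\<^sup>2 + (cmod (g t))\<^sup>2)"
    using assms l2_int by auto
  show "(\<lambda>t. f t * g t) \<in> borel_measurable (lebesgue_on S)"
    using assms l2_meas by auto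
  have "cmod a * cmod b \<le> (cmod a)\<^sup>2 + (cmod b)\<^sup>2" for a b
  proof -
    have "0 \<le> cmod a * cmod b" by simp
    moreover have "2 * (cmod a * cmod b) \<le> (cmod a)\<^sup>2 + (cmod b)\<^sup>2"
      using zero_le_power2 [of "cmod a - cmod b"] by (simp add: power2_diff)
    ultimately show ?thesis by linarith
  qed
  then show "AE t in lebesgue_on S. norm (f t * g t) \<le> norm ((cmod (f t))\<^sup>2 + (cmod (g t))\<^sup>2)"
    by (auto simp: norm_mult)
qed

lemma l2_inner_integrable:
  "f \<in> l2 S \<Longrightarrow> g \<in> l2 S \<Longrightarrow> integrable (lebesgue_on S) (\<lambda>t. f t * cnj (g t))"
  by (intro l2_mult_integrable l2_cnj)

lemma l2_inner_diff_left:
  "f \<in> l2 S \<Longrightarrow> g \<in> l2 S \<Longrightarrow> h \<in> l2 S \<Longrightarrow>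
    l2_inner S (\<lambda>t. f t - g t) h = l2_inner S f h - l2_inner S g h"
  by (simp add: l2_inner_def left_diff_distrib l2_inner_integrable)

lemma l2_inner_cong_AE:
  assumes "f \<in> l2 S" "f' \<in> l2 S" "g \<in> l2 S" "AE t in lebesgue_on S. f t = f' t"
  shows "l2_inner S f g = l2_inner S f' g"
  unfolding l2_inner_def
proof (rule integral_cong_AE)
  show "AE t in lebesgue_on S. f t * cnj (g t) = f' t * cnj (g t)"
    using assms(4) by eventually_elim simp
qed (use l2_inner_integrable assms in auto)

lemma l2_inner_uminus_right:
  "l2_inner S f (\<lambda>t. - g t) = - l2_inner S f g"
  by (simp add: l2_inner_def)

lemma l2_inner_commute: "l2_inner S g f = cnj (l2_inner S f g)"
  unfolding l2_inner_def Bochner_Integration.integral_cnj [symmetric] by (simp add: mult.commute)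

lemma l2_inner_diff_right:
  "f \<in> l2 S \<Longrightarrow> g \<in> l2 S \<Longrightarrow> h \<in> l2 S \<Longrightarrow>
    l2_inner S h (\<lambda>t. f t - g t) = l2_inner S h f - l2_inner S h g"
  by (simp add: l2_inner_def right_diff_distrib l2_inner_integrable)

lemma l2_norm_nonneg: "0 \<le> l2_norm S f"
  by (simp add: l2_norm_def)

lemma l2_norm_squared: "(l2_norm S f)\<^sup>2 = (LINT t|lebesgue_on S. (cmod (f t))\<^sup>2)"
  by (simp add: l2_norm_def)

lemma l2_norm_commute: "l2_norm S (\<lambda>t. f t - g t) = l2_norm S (\<lambda>t. g t - f t)"
  by (simp add: l2_norm_def norm_minus_commute)

lemma l2_inner_self: "l2_inner S f f = of_real ((l2_norm S f)\<^sup>2)"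
  by (simp add: l2_inner_def l2_norm_squared complex_norm_square [symmetric] flip: of_real_power)

lemma l2_norm_eq_0_AE: "f \<in> l2 S \<Longrightarrow> l2_norm S f = 0 \<Longrightarrow> AE t in lebesgue_on S. f t = 0"
  using integral_nonneg_eq_0_iff_AE [OF l2_int, of f S] by (simp add: l2_norm_def)

lemma l2_norm_sub_scaled:
  assumes "f \<in> l2 S" "g \<in> l2 S"
  shows "(l2_norm S (\<lambda>t. f t - c * g t))\<^sup>2
    = (l2_norm S f)\<^sup>2 - 2 * Re (cnj c * l2_inner S f g) + (cmod c)\<^sup>2 * (l2_norm S g)\<^sup>2"
proof -
  have eq: "(cmod (a - c * b))\<^sup>2 = (cmod a)\<^sup>2 - 2 * Re (cnj c * (a * cnj b)) + (cmod c)\<^sup>2 * (cmod b)\<^sup>2"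
    for a b
    unfolding cmod_power2 by (simp add: algebra_simps power2_eq_square)
  have i: "integrable (lebesgue_on S) (\<lambda>t. cnj c * (f t * cnj (g t)))"
    using l2_inner_integrable [OF assms] by simp
  define h where "h t = Re (cnj c * (f t * cnj (g t)))" for t
  have "integrable (lebesgue_on S) h"
    unfolding h_def by (rule integrable_Re [OF i])
  moreover have "Re (cnj c * l2_inner S f g) = (LINT t|lebesgue_on S. h t)"
    using integral_Re [OF i] by (simp add: l2_inner_def h_def)
  ultimately show ?thesis
    unfolding l2_norm_squared eq h_def [symmetric]
    using l2_int [OF assms(1)] l2_int [OF assms(2)] by simp
qed

lemma l2_cauchy_schwarz:
  assumes "f \<in> l2 S" "g \<in> l2 S"
  shows "cmod (l2_inner S f g) \<le> l2_norm S f * l2_norm S g"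
proof -
  let ?z = "l2_inner S f g" and ?p = "(l2_norm S f)\<^sup>2" and ?q = "(l2_norm S g)\<^sup>2"
  have ineq: "2 * s * (cmod ?z)\<^sup>2 \<le> ?p + s\<^sup>2 * (cmod ?z)\<^sup>2 * ?q" for s
  proof -
    have "0 \<le> (l2_norm S (\<lambda>t. f t - (of_real s * ?z) * g t))\<^sup>2" by simp
    also have "\<dots> = ?p - 2 * (s * (cmod ?z)\<^sup>2) + (cmod (of_real s * ?z))\<^sup>2 * ?q"
    proof -
      have "Re (cnj (of_real s * ?z) * ?z) = s * (cmod ?z)\<^sup>2"
        by (simp add: cmod_power2) (simp add: power2_eq_square algebra_simps)
      then show ?thesis unfolding l2_norm_sub_scaled [OF assms] by simp
    qed
    finally show ?thesis by (simp add: norm_mult power_mult_distrib)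
  qed
  have "(cmod ?z)\<^sup>2 \<le> ?p * ?q"
  proof (cases "?q = 0")
    case True
    have "(cmod ?z)\<^sup>2 = 0"
    proof (rule ccontr)
      assume nz: "(cmod ?z)\<^sup>2 \<noteq> 0"
      show False using ineq [of "(?p + 1) / (2 * (cmod ?z)\<^sup>2)"] True nz by simp
    qed
    then show ?thesis by (simp add: True)
  next
    case False
    then have q: "?q > 0" by simp
    have "Z / q \<le> p" if "2 * (1/q) * Z \<le> p + (1/q)\<^sup>2 * Z * q" "q > 0" for Z q p :: real
      using that by (simp add: power2_eq_square field_simps)
    from this [OF ineq q] have "(cmod ?z)\<^sup>2 / ?q \<le> ?p" .
    then show ?thesis using q by (simp add: field_simps)
  qed
  then show ?thesis
    by (metis l2_norm_nonneg mult_nonneg_nonneg power2_le_imp_le power_mult_distrib)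
qed

lemma l2_inner_tendsto:
  assumes "\<And>k. F k \<in> l2 S" "f \<in> l2 S" "g \<in> l2 S"
    and "(\<lambda>k. l2_norm S (\<lambda>t. F k t - f t)) \<longlonglongrightarrow> 0"
  shows "(\<lambda>k. l2_inner S (F k) g) \<longlonglongrightarrow> l2_inner S f g"
proof -
  have "(\<lambda>k. l2_inner S (F k) g - l2_inner S f g) \<longlonglongrightarrow> 0"
  proof (rule Lim_null_comparison)
    show "\<forall>\<^sub>F k in sequentially. cmod (l2_inner S (F k) g - l2_inner S f g)
        \<le> l2_norm S (\<lambda>t. F k t - f t) * l2_norm S g"
      using l2_cauchy_schwarz [OF l2_diff [OF assms(1,2)] assms(3)] assms(1-3)
      by (simp add: l2_inner_diff_left)
    show "(\<lambda>k. l2_norm S (\<lambda>t. F k t - f t) * l2_norm S g) \<longlonglongrightarrow> 0"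
      using tendsto_mult_right [OF assms(4)] by simp
  qed
  then show ?thesis using LIM_zero_iff by blast
qed

lemma l2_parallelogram:
  assumes "f \<in> l2 S" "g \<in> l2 S"
  shows "(l2_norm S (\<lambda>t. f t - g t))\<^sup>2 =
    2 * (l2_norm S f)\<^sup>2 + 2 * (l2_norm S g)\<^sup>2 - 4 * (l2_norm S (\<lambda>t. (f t + g t) / 2))\<^sup>2"
proof -
  have eq: "(cmod (a - b))\<^sup>2 = 2 * (cmod a)\<^sup>2 + 2 * (cmod b)\<^sup>2 - 4 * (cmod ((a + b)/2))\<^sup>2" for a b
    unfolding cmod_power2 by (simp add: field_simps power2_eq_square)
  have "(\<lambda>t. (f t + g t) / 2) \<in> l2 S"
    using l2_cmult [OF l2_add [OF assms], of "1/2"] by simp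
  from l2_int [OF this] show ?thesis
    unfolding l2_norm_squared eq using l2_int [OF assms(1)] l2_int [OF assms(2)] by simp
qed

text \<open>
  Riesz--Fischer. Along a subsequence whose consecutive differences have squared norm at most
  $8^{-k}$, the series $\sum 2^k |F_{r(k+1)} - F_{r(k)}|^2$ has a finite integral, so almost
  everywhere the differences are dominated by a geometric series and the subsequence converges
  pointwise. Fatou's lemma turns pointwise into norm convergence.
\<close>

lemma l2_complete:
  assumes F: "\<And>k. F k \<in> l2 S"
    and cauchy: "\<And>e. e > 0 \<Longrightarrow> \<exists>N. \<forall>m\<ge>N. \<forall>n\<ge>N. (l2_norm S (\<lambda>t. F m t - F n t))\<^sup>2 < e"
  shows "\<exists>f\<in>l2 S. (\<lambda>k. l2_norm S (\<lambda>t. F k t - f t)) \<longlonglongrightarrow> 0"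
proof -
  let ?M = "lebesgue_on S"
  have nn: "(\<integral>\<^sup>+t. ennreal ((cmod (g t))\<^sup>2) \<partial>?M) = ennreal ((l2_norm S g)\<^sup>2)" if "g \<in> l2 S" for g
    unfolding l2_norm_squared by (rule nn_integral_eq_integral [OF l2_int [OF that]]) simp
  have "\<exists>r. \<forall>k. (\<forall>m\<ge>r k. \<forall>n\<ge>r k. (l2_norm S (\<lambda>t. F m t - F n t))\<^sup>2 < (1/8)^k) \<and> k \<le> r k \<and> r k \<le> r (Suc k)"
  proof -
    have "\<exists>r. \<forall>k. (\<forall>m\<ge>r k. \<forall>n\<ge>r k. (l2_norm S (\<lambda>t. F m t - F n t))\<^sup>2 < (1/8)^k)"
      by (rule choice, rule allI, rule cauchy) simp
    then obtain r where r: "\<And>k m n. m\<ge>r k \<Longrightarrow> n\<ge>r k \<Longrightarrow> (l2_norm S (\<lambda>t. F m t - F n t))\<^sup>2 < (1/8)^k"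
      by blast
    define R where "R k = (\<Sum>i\<le>k. r i) + k" for k
    have "R k \<ge> r k" for k unfolding R_def
      using member_le_sum [of k "{..k}" r] by simp
    moreover have "R k \<le> R (Suc k)" "k \<le> R k" for k by (auto simp: R_def)
    ultimately show ?thesis
      by (intro exI [of _ R] allI conjI impI r) (auto intro: order_trans)
  qed
  then obtain r where r: "\<And>k m n. m\<ge>r k \<Longrightarrow> n\<ge>r k \<Longrightarrow> (l2_norm S (\<lambda>t. F m t - F n t))\<^sup>2 < (1/8)^k"
    and rk: "\<And>k. k \<le> r k" and rS: "\<And>k. r k \<le> r (Suc k)" by blast
  have [measurable]: "F k \<in> borel_measurable ?M" for k by (rule l2_meas [OF F])
  define D where "D k t = F (r (Suc k)) t - F (r k) t" for k t
  have Dl2: "D k \<in> l2 S" for k unfolding D_def by (intro l2_diff F)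
  have [measurable]: "D k \<in> borel_measurable ?M" for k by (rule l2_meas [OF Dl2])
  have Dn: "(l2_norm S (D k))\<^sup>2 \<le> (1/8)^k" for k
    using r [of k "r (Suc k)" "r k"] rS [of k] by (simp add: D_def [abs_def] less_imp_le)
  have "(\<integral>\<^sup>+t. (\<Sum>k. ennreal (2^k * (cmod (D k t))\<^sup>2)) \<partial>?M)
      = (\<Sum>k. (\<integral>\<^sup>+t. ennreal (2^k * (cmod (D k t))\<^sup>2) \<partial>?M))"
    by (rule nn_integral_suminf) measurable
  also have "\<dots> \<le> (\<Sum>k. ennreal ((1/4)^k))"
  proof (rule suminf_le)
    fix k
    have "(\<integral>\<^sup>+t. ennreal (2^k * (cmod (D k t))\<^sup>2) \<partial>?M) = (\<integral>\<^sup>+t. ennreal (2^k) * ennreal ((cmod (D k t))\<^sup>2) \<partial>?M)"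
      by (simp add: ennreal_mult)
    also have "\<dots> = ennreal (2^k) * (\<integral>\<^sup>+t. ennreal ((cmod (D k t))\<^sup>2) \<partial>?M)"
      by (rule nn_integral_cmult) measurable
    also have "\<dots> = ennreal (2^k * (l2_norm S (D k))\<^sup>2)"
      using nn [OF Dl2] by (simp add: ennreal_mult)
    also have "\<dots> \<le> ennreal (2^k * (1/8)^k)"
      using Dn [of k] by (intro ennreal_leI mult_left_mono) auto
    also have "\<dots> = ennreal ((1/4)^k)" by (simp flip: power_mult_distrib)
    finally show "(\<integral>\<^sup>+t. ennreal (2^k * (cmod (D k t))\<^sup>2) \<partial>?M) \<le> ennreal ((1/4)^k)" .
  qed auto
  also have "\<dots> = ennreal (\<Sum>k. (1/4)^k)"
    by (rule suminf_ennreal2) auto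
  also have "\<dots> < \<infinity>" by simp
  finally have "AE t in ?M. (\<Sum>k. ennreal (2^k * (cmod (D k t))\<^sup>2)) \<noteq> \<infinity>"
    by (intro nn_integral_PInf_AE) (auto simp: less_top)
  then have conv: "AE t in ?M. convergent (\<lambda>k. F (r k) t)"
  proof eventually_elim
    case (elim t)
    then have "summable (\<lambda>k. 2^k * (cmod (D k t))\<^sup>2)"
      by (intro summable_suminf_not_top) (auto simp: top_unique)
    then have "(\<lambda>k. 2^k * (cmod (D k t))\<^sup>2) \<longlonglongrightarrow> 0" by (rule summable_LIMSEQ_zero)
    then have "Bseq (\<lambda>k. 2^k * (cmod (D k t))\<^sup>2)" by (meson convergent_def convergent_imp_Bseq)
    then obtain B where B: "B > 0" "\<And>k. 2^k * (cmod (D k t))\<^sup>2 \<le> B"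
      by (auto simp: Bseq_def)
    have le: "cmod (D k t) \<le> sqrt B * (1 / sqrt 2)^k" for k
    proof (rule power2_le_imp_le)
      have "(sqrt B * (1 / sqrt 2)^k)\<^sup>2 = B / 2^k"
      proof -
        have "(sqrt 2 ^ k)\<^sup>2 = (2::real)^k" by (simp add: power2_eq_square flip: power_mult_distrib)
        then show ?thesis using B(1) by (simp add: power_mult_distrib power_divide)
      qed
      moreover have "(cmod (D k t))\<^sup>2 \<le> B / 2^k"
        using B(2) [of k] by (simp add: field_simps)
      ultimately show "(cmod (D k t))\<^sup>2 \<le> (sqrt B * (1 / sqrt 2)^k)\<^sup>2" by simp
    qed (use B(1) in simp)
    have "summable (\<lambda>k. D k t)"
    proof (rule summable_comparison_test' [where N = 0])
      show "summable (\<lambda>k. sqrt B * (1 / sqrt 2)^k)"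
        by (intro summable_mult summable_geometric) simp
    qed (use le in auto)
    then have "convergent (\<lambda>n. (\<Sum>k<n. D k t))" by (simp add: summable_iff_convergent)
    moreover have "(\<Sum>k<n. D k t) = F (r n) t - F (r 0) t" for n
      unfolding D_def by (rule sum_lessThan_telescope)
    ultimately have "convergent (\<lambda>n. (F (r n) t - F (r 0) t) + F (r 0) t)"
      by (intro convergent_add) (auto simp: convergent_const)
    then show ?case by simp
  qed
  define f where "f t = lim (\<lambda>k. F (r k) t)" for t
  have fm [measurable]: "f \<in> borel_measurable ?M"
    unfolding f_def by (rule borel_measurable_lim_metric) measurable
  have lim: "AE t in ?M. (\<lambda>k. F (r k) t) \<longlonglongrightarrow> f t"
    using conv by eventually_elim (simp add: f_def convergent_LIMSEQ_iff)
  have bound: "(\<integral>\<^sup>+t. ennreal ((cmod (F m t - f t))\<^sup>2) \<partial>?M) \<le> ennreal ((1/8)^j)" if "m \<ge> r j" for m j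
  proof -
    have "(\<integral>\<^sup>+t. ennreal ((cmod (F m t - f t))\<^sup>2) \<partial>?M)
        = (\<integral>\<^sup>+t. liminf (\<lambda>k. ennreal ((cmod (F m t - F (r k) t))\<^sup>2)) \<partial>?M)"
    proof (rule nn_integral_cong_AE)
      show "AE t in ?M. ennreal ((cmod (F m t - f t))\<^sup>2) = liminf (\<lambda>k. ennreal ((cmod (F m t - F (r k) t))\<^sup>2))"
        using lim
      proof eventually_elim
        case (elim t)
        then have "(\<lambda>k. ennreal ((cmod (F m t - F (r k) t))\<^sup>2)) \<longlonglongrightarrow> ennreal ((cmod (F m t - f t))\<^sup>2)"
          by (intro tendsto_ennrealI tendsto_intros)
        from lim_imp_Liminf [OF _ this] show ?case by simp
      qed
    qed
    also have "\<dots> \<le> liminf (\<lambda>k. \<integral>\<^sup>+t. ennreal ((cmod (F m t - F (r k) t))\<^sup>2) \<partial>?M)"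
      by (rule nn_integral_liminf) measurable
    also have "\<dots> \<le> ennreal ((1/8)^j)"
    proof (rule Liminf_le)
      show "\<forall>\<^sub>F k in sequentially. (\<integral>\<^sup>+t. ennreal ((cmod (F m t - F (r k) t))\<^sup>2) \<partial>?M) \<le> ennreal ((1/8)^j)"
        using eventually_ge_at_top [of "r j"]
      proof eventually_elim
        case (elim k)
        have "(\<integral>\<^sup>+t. ennreal ((cmod (F m t - F (r k) t))\<^sup>2) \<partial>?M) = ennreal ((l2_norm S (\<lambda>t. F m t - F (r k) t))\<^sup>2)"
          by (rule nn) (intro l2_diff F)
        moreover have "(l2_norm S (\<lambda>t. F m t - F (r k) t))\<^sup>2 \<le> (1/8)^j"
          using r [OF that, of "r k"] elim rk [of k] by simp
        ultimately show ?case by (simp add: ennreal_leI)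
      qed
    qed simp
    finally show ?thesis .
  qed
  have dl2: "(\<lambda>t. F (r 0) t - f t) \<in> l2 S"
  proof (rule l2_I)
    show "integrable ?M (\<lambda>t. (cmod (F (r 0) t - f t))\<^sup>2)"
    proof (rule integrableI_bounded)
      show "(\<integral>\<^sup>+t. ennreal (norm ((cmod (F (r 0) t - f t))\<^sup>2)) \<partial>?M) < \<infinity>"
        using bound [of 0 "r 0"] by (auto intro: le_less_trans)
    qed measurable
  qed measurable
  have fl2: "f \<in> l2 S"
    using l2_diff [OF F [of "r 0"] dl2] by simp
  have bound': "(l2_norm S (\<lambda>t. F m t - f t))\<^sup>2 \<le> (1/8)^j" if "m \<ge> r j" for m j
    using bound [OF that] nn [OF l2_diff [OF F fl2], of m] by simp
  have "(\<lambda>k. (l2_norm S (\<lambda>t. F k t - f t))\<^sup>2) \<longlonglongrightarrow> 0"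
  proof (rule LIMSEQ_I)
    fix e :: real assume "e > 0"
    then obtain j where j: "(1/8::real)^j < e"
      using real_arch_pow_inv [of e "1/8"] by auto
    show "\<exists>no. \<forall>n\<ge>no. norm ((l2_norm S (\<lambda>t. F n t - f t))\<^sup>2 - 0) < e"
      using bound' [of j] j by (intro exI [of _ "r j"]) (auto intro: le_less_trans)
  qed
  then have "(\<lambda>k. sqrt ((l2_norm S (\<lambda>t. F k t - f t))\<^sup>2)) \<longlonglongrightarrow> sqrt 0"
    by (rule tendsto_real_sqrt)
  then show ?thesis using fl2 by (auto simp: l2_norm_nonneg)
qed

text \<open>
  The projection theorem in $L^2 \oplus L^2$, applied to the closure of a subspace of pairs.
  A minimizing sequence is Cauchy by the parallelogram law; comparing with the competitors
  \<open>F k + c (a, b)\<close> shows that the residuals are asymptotically orthogonal to the subspace.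
\<close>

lemma graph_projection:
  assumes sub: "G \<subseteq> l2 S \<times> l2 S"
    and zero: "((\<lambda>t. 0), (\<lambda>t. 0)) \<in> G"
    and lin: "\<And>f g f' g' c. (f, g) \<in> G \<Longrightarrow> (f', g') \<in> G \<Longrightarrow>
        ((\<lambda>t. f t + c * f' t), (\<lambda>t. g t + c * g' t)) \<in> G"
    and u: "u \<in> l2 S" and v: "v \<in> l2 S"
  obtains f g where "(f, g) \<in> graph_closure S G"
    and "\<And>a b. (a, b) \<in> G \<Longrightarrow> l2_inner S (\<lambda>t. u t - f t) a + l2_inner S (\<lambda>t. v t - g t) b = 0"
proof -
  define Q where "Q f g = (l2_norm S f)\<^sup>2 + (l2_norm S g)\<^sup>2" for f g
  define I where "I = Inf ((\<lambda>(f,g). Q (\<lambda>t. u t - f t) (\<lambda>t. v t - g t)) ` G)"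
  have bdd: "bdd_below ((\<lambda>(f,g). Q (\<lambda>t. u t - f t) (\<lambda>t. v t - g t)) ` G)"
    by (rule bdd_belowI [of _ 0]) (auto simp: Q_def)
  have I_le: "I \<le> Q (\<lambda>t. u t - f t) (\<lambda>t. v t - g t)" if "(f, g) \<in> G" for f g
    unfolding I_def by (rule cInf_lower2 [OF _ _ bdd, of "Q (\<lambda>t. u t - f t) (\<lambda>t. v t - g t)"])
      (use that in force)+
  have "\<exists>p\<in>G. Q (\<lambda>t. u t - fst p t) (\<lambda>t. v t - snd p t) < I + 1 / real (Suc k)" for k
  proof -
    have "\<exists>z\<in>(\<lambda>(f,g). Q (\<lambda>t. u t - f t) (\<lambda>t. v t - g t)) ` G. z < I + 1 / real (Suc k)"
      unfolding I_def by (rule cInf_lessD) (use zero in auto)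
    then obtain p where "p \<in> G" "(\<lambda>(f,g). Q (\<lambda>t. u t - f t) (\<lambda>t. v t - g t)) p < I + 1 / real (Suc k)"
      by blast
    then show ?thesis by (intro bexI [of _ p]) (auto simp: case_prod_unfold)
  qed
  then obtain P where P: "\<And>k. P k \<in> G"
    and Pmin: "\<And>k. Q (\<lambda>t. u t - fst (P k) t) (\<lambda>t. v t - snd (P k) t) < I + 1 / real (Suc k)"
    by metis
  define F where "F k = fst (P k)" for k
  define H where "H k = snd (P k)" for k
  have FG: "(F k, H k) \<in> G" for k using P by (simp add: F_def H_def)
  have Fl2: "F k \<in> l2 S" and Hl2: "H k \<in> l2 S" for k using FG [of k] sub by auto
  have min: "Q (\<lambda>t. u t - F k t) (\<lambda>t. v t - H k t) < I + 1 / real (Suc k)" for k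
    using Pmin by (simp add: F_def H_def)
  have Qcauchy: "Q (\<lambda>t. F m t - F n t) (\<lambda>t. H m t - H n t) \<le> 2 / real (Suc m) + 2 / real (Suc n)" for m n
  proof -
    have "((\<lambda>t. F m t + 1/2 * (F n t + (-1) * F m t)), (\<lambda>t. H m t + 1/2 * (H n t + (-1) * H m t))) \<in> G"
      by (intro lin FG)
    note 1 = this
    have mid: "I \<le> Q (\<lambda>t. ((u t - F n t) + (u t - F m t)) / 2) (\<lambda>t. ((v t - H n t) + (v t - H m t)) / 2)"
    proof -
      have "(\<lambda>t. u t - (F m t + 1/2 * (F n t + (-1) * F m t))) = (\<lambda>t. ((u t - F n t) + (u t - F m t)) / 2)"
        "(\<lambda>t. v t - (H m t + 1/2 * (H n t + (-1) * H m t))) = (\<lambda>t. ((v t - H n t) + (v t - H m t)) / 2)"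
        by (auto simp: fun_eq_iff field_simps)
      then show ?thesis using I_le [OF 1] by simp
    qed
    have "Q (\<lambda>t. F m t - F n t) (\<lambda>t. H m t - H n t)
        = Q (\<lambda>t. (u t - F n t) - (u t - F m t)) (\<lambda>t. (v t - H n t) - (v t - H m t))" by simp
    also have "\<dots> = 2 * Q (\<lambda>t. u t - F n t) (\<lambda>t. v t - H n t) + 2 * Q (\<lambda>t. u t - F m t) (\<lambda>t. v t - H m t)
        - 4 * Q (\<lambda>t. ((u t - F n t) + (u t - F m t)) / 2) (\<lambda>t. ((v t - H n t) + (v t - H m t)) / 2)"
      unfolding Q_def l2_parallelogram [OF l2_diff [OF u Fl2] l2_diff [OF u Fl2]]
        l2_parallelogram [OF l2_diff [OF v Hl2] l2_diff [OF v Hl2]] by simp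
    finally show ?thesis using mid min [of m] min [of n] by simp
  qed
  have cauchy: "\<exists>N. \<forall>m\<ge>N. \<forall>n\<ge>N. Q (\<lambda>t. F m t - F n t) (\<lambda>t. H m t - H n t) < e" if e: "e > 0" for e
  proof -
    obtain N where N: "1 / real (Suc N) < e / 4" using reals_Archimedean [of "e/4"] e by (auto simp: inverse_eq_divide)
    have "Q (\<lambda>t. F m t - F n t) (\<lambda>t. H m t - H n t) < e" if "m \<ge> N" "n \<ge> N" for m n
    proof -
      have "1 / real (Suc m) \<le> 1 / real (Suc N)" "1 / real (Suc n) \<le> 1 / real (Suc N)"
        using that by (auto intro!: divide_left_mono)
      then show ?thesis using N Qcauchy [of m n] by simp
    qed
    then show ?thesis by blast
  qed
  have "\<exists>f\<in>l2 S. (\<lambda>k. l2_norm S (\<lambda>t. F k t - f t)) \<longlonglongrightarrow> 0"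
  proof (rule l2_complete [OF Fl2])
    fix e :: real assume "e > 0"
    from cauchy [OF this] show "\<exists>N. \<forall>m\<ge>N. \<forall>n\<ge>N. (l2_norm S (\<lambda>t. F m t - F n t))\<^sup>2 < e"
      unfolding Q_def by (meson le_add_same_cancel1 le_less_trans zero_le_power2)
  qed
  then obtain f where f: "f \<in> l2 S" "(\<lambda>k. l2_norm S (\<lambda>t. F k t - f t)) \<longlonglongrightarrow> 0" by blast
  have "\<exists>g\<in>l2 S. (\<lambda>k. l2_norm S (\<lambda>t. H k t - g t)) \<longlonglongrightarrow> 0"
  proof (rule l2_complete [OF Hl2])
    fix e :: real assume "e > 0"
    from cauchy [OF this] show "\<exists>N. \<forall>m\<ge>N. \<forall>n\<ge>N. (l2_norm S (\<lambda>t. H m t - H n t))\<^sup>2 < e"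
      unfolding Q_def by (meson le_add_same_cancel2 le_less_trans zero_le_power2)
  qed
  then obtain g where g: "g \<in> l2 S" "(\<lambda>k. l2_norm S (\<lambda>t. H k t - g t)) \<longlonglongrightarrow> 0" by blast
  have "(f, g) \<in> graph_closure S G"
    unfolding graph_closure_def using f g P by (auto simp: F_def H_def)
  moreover have "l2_inner S (\<lambda>t. u t - f t) a + l2_inner S (\<lambda>t. v t - g t) b = 0" if ab: "(a, b) \<in> G" for a b
  proof -
    have al2: "a \<in> l2 S" and bl2: "b \<in> l2 S" using ab sub by auto
    define z where "z k = l2_inner S (\<lambda>t. u t - F k t) a + l2_inner S (\<lambda>t. v t - H k t) b" for k
    have zlim: "z \<longlonglongrightarrow> l2_inner S (\<lambda>t. u t - f t) a + l2_inner S (\<lambda>t. v t - g t) b"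
      unfolding z_def using f g u v al2 bl2 Fl2 Hl2
      by (intro tendsto_add l2_inner_tendsto l2_diff) (auto simp: l2_norm_commute)
    define q where "q = Q a b"
    \<comment> \<open>The optimal step would be $1/q$; this one also covers $q = 0$.\<close>
    define s where "s = 1 / (q + 1)"
    have q: "q \<ge> 0" by (simp add: q_def Q_def)
    have s: "s > 0" "s * q \<le> 1" using q by (auto simp: s_def field_simps)
    have zb: "(cmod (z k))\<^sup>2 \<le> (1 / real (Suc k)) / s" for k
    proof -
      let ?c = "of_real s * z k"
      have "I \<le> Q (\<lambda>t. (u t - F k t) - ?c * a t) (\<lambda>t. (v t - H k t) - ?c * b t)"
        using I_le [OF lin [OF FG ab, of k ?c]] by (simp add: algebra_simps)
      also have "\<dots> = Q (\<lambda>t. u t - F k t) (\<lambda>t. v t - H k t) - 2 * Re (cnj ?c * z k) + (cmod ?c)\<^sup>2 * q"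
        unfolding Q_def z_def q_def
          l2_norm_sub_scaled [OF l2_diff [OF u Fl2] al2] l2_norm_sub_scaled [OF l2_diff [OF v Hl2] bl2]
        by (simp add: algebra_simps)
      also have "\<dots> = Q (\<lambda>t. u t - F k t) (\<lambda>t. v t - H k t) - 2 * s * (cmod (z k))\<^sup>2 + s * (s * q) * (cmod (z k))\<^sup>2"
      proof -
        have "Re (cnj ?c * z k) = s * (cmod (z k))\<^sup>2"
          by (simp add: cmod_power2) (simp add: power2_eq_square algebra_simps)
        then show ?thesis by (simp add: norm_mult power_mult_distrib) (simp add: power2_eq_square)
      qed
      also have "\<dots> \<le> Q (\<lambda>t. u t - F k t) (\<lambda>t. v t - H k t) - 2 * s * (cmod (z k))\<^sup>2 + s * 1 * (cmod (z k))\<^sup>2"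
        using s by (intro add_left_mono mult_right_mono mult_left_mono) auto
      finally have "s * (cmod (z k))\<^sup>2 \<le> 1 / real (Suc k)" using min [of k] by simp
      then show ?thesis using s by (simp add: pos_le_divide_eq mult_ac)
    qed
    have "(\<lambda>k. (cmod (z k))\<^sup>2) \<longlonglongrightarrow> 0"
    proof (rule tendsto_sandwich [of "\<lambda>_. 0"])
      show "(\<lambda>k. 1 / real (Suc k) / s) \<longlonglongrightarrow> 0"
        using tendsto_mult_right [OF LIMSEQ_inverse_real_of_nat, of "1/s"]
        by (simp add: divide_inverse)
    qed (use zb in auto)
    then have "(\<lambda>k. sqrt ((cmod (z k))\<^sup>2)) \<longlonglongrightarrow> sqrt 0" by (rule tendsto_real_sqrt)
    then have "z \<longlonglongrightarrow> 0" by (simp add: tendsto_norm_zero_iff)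
    then show ?thesis using zlim LIMSEQ_unique by blast
  qed
  ultimately show ?thesis using that by blast
qed

section \<open>Integration by parts and weak derivatives\<close>

text \<open>
  Sum the estimate over an equidistant partition: the sum telescopes in \<open>G\<close> and a factor
  equal to the mesh size remains.
\<close>

lemma additive_increment_estimate_imp_constant:
  fixes F :: "real \<Rightarrow> 'a::real_normed_vector" and G :: "real \<Rightarrow> real"
  assumes ab: "a \<le> b"
    and est: "\<And>s t. a \<le> s \<Longrightarrow> s \<le> t \<Longrightarrow> t \<le> b \<Longrightarrow> norm (F t - F s) \<le> C * (t - s) * (G t - G s)"
  shows "F b = F a"
proof -
  let ?B = "C * (b - a) * (G b - G a)"
  have "norm (F b - F a) \<le> ?B * inverse (real (Suc n))" for n
  proof -
    define h where "h = (b - a) / real (Suc n)"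
    define p where "p i = a + real i * h" for i
    have h: "h \<ge> 0" using ab by (simp add: h_def)
    have p0: "p 0 = a" and pn: "p (Suc n) = b"
      by (simp_all add: p_def h_def)
    have le: "p i \<le> b" if "i \<le> Suc n" for i
    proof -
      have "real i * h \<le> real (Suc n) * h" using that h by (intro mult_right_mono) auto
      then show ?thesis using pn by (simp add: p_def)
    qed
    have "F b - F a = (\<Sum>i<Suc n. F (p (Suc i)) - F (p i))"
      using sum_lessThan_telescope [of "\<lambda>i. F (p i)" "Suc n"] by (simp only: p0 pn)
    also have "norm \<dots> \<le> (\<Sum>i<Suc n. C * h * (G (p (Suc i)) - G (p i)))"
    proof (rule sum_norm_le)
      fix i assume "i \<in> {..<Suc n}"
      then have "a \<le> p i" "p i \<le> p (Suc i)" "p (Suc i) \<le> b"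
        using h le [of "Suc i"] by (auto simp: p_def distrib_right)
      moreover have "p (Suc i) - p i = h" by (simp add: p_def distrib_right)
      ultimately show "norm (F (p (Suc i)) - F (p i)) \<le> C * h * (G (p (Suc i)) - G (p i))"
        using est by metis
    qed
    also have "\<dots> = C * h * (\<Sum>i<Suc n. G (p (Suc i)) - G (p i))"
      by (simp only: sum_distrib_left)
    also have "\<dots> = C * h * (G b - G a)"
      using sum_lessThan_telescope [of "\<lambda>i. G (p i)" "Suc n"] by (simp only: p0 pn)
    also have "\<dots> = ?B * inverse (real (Suc n))"
      by (simp add: h_def divide_inverse)
    finally show ?thesis .
  qed
  moreover have "(\<lambda>n. ?B * inverse (real (Suc n))) \<longlonglongrightarrow> ?B * 0"
    by (intro tendsto_intros LIMSEQ_inverse_real_of_nat)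
  ultimately have "norm (F b - F a) \<le> 0"
    by (intro LIMSEQ_le_const [of _ 0]) auto
  then show ?thesis by simp
qed

lemma abs_int_mult_continuous:
  fixes f g :: "real \<Rightarrow> complex"
  assumes "f absolutely_integrable_on {a..b}" "continuous_on {a..b} g"
  shows "(\<lambda>t. g t * f t) absolutely_integrable_on {a..b}"
proof (rule absolutely_integrable_bounded_measurable_product [OF bilinear_times _ _ _ assms(1)])
  show "g \<in> borel_measurable (lebesgue_on {a..b})"
    by (rule continuous_imp_measurable_on_sets_lebesgue [OF assms(2)]) simp
  show "bounded (g ` {a..b})"
    by (intro compact_imp_bounded compact_continuous_image assms(2)) simp
qed simp

lemma abs_int_integrable:
  fixes f :: "real \<Rightarrow> complex"
  shows "f absolutely_integrable_on S \<Longrightarrow> f integrable_on S"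
  by (simp add: absolutely_integrable_on_def)

lemma abs_int_norm_integrable:
  fixes f :: "real \<Rightarrow> complex"
  shows "f absolutely_integrable_on S \<Longrightarrow> (\<lambda>t. norm (f t)) integrable_on S"
  by (simp add: absolutely_integrable_on_def)

lemma continuous_on_indef_integral:
  fixes f :: "real \<Rightarrow> complex"
  shows "f absolutely_integrable_on {a..b} \<Longrightarrow> continuous_on {a..b} (\<lambda>t. integral {a..t} f)"
  by (intro indefinite_integral_continuous_1 abs_int_integrable)

text \<open>
  The primitive of an integrable function is differentiable only almost everywhere, so the
  product rule is not available pointwise. The difference of the two sides, as a function of the
  upper limit, has increments of size $O((t - s) \int_s^t |f|)$, which forces it to be constant.
\<close>

lemma integration_by_parts_L1:
  fixes f W W' :: "real \<Rightarrow> complex"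
  assumes ab: "a \<le> b" and f: "f absolutely_integrable_on {a..b}"
    and W: "\<And>t. t \<in> {a..b} \<Longrightarrow> (W has_vector_derivative W' t) (at t within {a..b})"
    and W': "continuous_on {a..b} W'"
    and F: "\<And>t. t \<in> {a..b} \<Longrightarrow> F t = c + integral {a..t} f"
  shows "integral {a..b} (\<lambda>t. f t * W t) + integral {a..b} (\<lambda>t. F t * W' t) = F b * W b - F a * W a"
proof -
  define G where "G t = integral {a..t} (\<lambda>r. norm (f r))" for t
  obtain M where M: "M > 0" "\<And>t. t \<in> {a..b} \<Longrightarrow> norm (W' t) \<le> M"
  proof -
    have "bounded (W' ` {a..b})" by (intro compact_imp_bounded compact_continuous_image W') simp
    then show ?thesis using that by (auto simp: bounded_pos)
  qed
  have Wc: "continuous_on {a..b} W"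
    using W has_vector_derivative_continuous by (fastforce simp: continuous_on_eq_continuous_within)
  have Fc: "continuous_on {a..b} F"
    by (rule continuous_on_eq [OF continuous_on_add [OF continuous_on_const continuous_on_indef_integral [OF f]]])
       (simp add: F)
  have fW: "(\<lambda>t. f t * W t) integrable_on {a..b}"
    using abs_int_integrable [OF abs_int_mult_continuous [OF f Wc]] by (simp add: mult.commute)
  have FW': "(\<lambda>t. F t * W' t) integrable_on {a..b}"
    by (intro integrable_continuous_interval continuous_on_mult Fc W')
  define \<Phi> where "\<Phi> t = integral {a..t} (\<lambda>t. f t * W t) + integral {a..t} (\<lambda>t. F t * W' t) - F t * W t" for t
  have "\<Phi> b = \<Phi> a"
  proof (rule additive_increment_estimate_imp_constant [OF ab, where C = "2 * M" and G = G])
    fix s t assume st: "a \<le> s" "s \<le> t" "t \<le> b"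
    then have sub: "{s..t} \<subseteq> {a..b}" by auto
    have split: "integral {a..t} g - integral {a..s} g = integral {s..t} g"
      if "g integrable_on {a..b}" for g :: "real \<Rightarrow> complex"
    proof -
      have "g integrable_on {a..t}" by (rule integrable_on_subinterval [OF that]) (use st in auto)
      from Henstock_Kurzweil_Integration.integral_combine [OF st(1,2) this] show ?thesis
        by (simp add: algebra_simps)
    qed
    have f': "f absolutely_integrable_on {s..t}"
      by (rule absolutely_integrable_on_subinterval [OF f sub])
    have fi: "f integrable_on {s..t}" and nfi: "(\<lambda>r. norm (f r)) integrable_on {s..t}"
      using abs_int_integrable [OF f'] abs_int_norm_integrable [OF f'] by auto
    have Fdiff: "F r - F s = integral {s..r} f" if "s \<le> r" "r \<le> t" for r
    proof -
      have "f integrable_on {a..r}"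
        by (rule integrable_on_subinterval [OF abs_int_integrable [OF f]]) (use st that in auto)
      from Henstock_Kurzweil_Integration.integral_combine [OF st(1) that(1) this] show ?thesis
        using st that by (simp add: F algebra_simps)
    qed
    have Gdiff: "G t - G s = integral {s..t} (\<lambda>r. norm (f r))"
    proof -
      have "(\<lambda>r. norm (f r)) integrable_on {a..t}"
        by (rule integrable_on_subinterval [OF abs_int_norm_integrable [OF f]]) (use st in auto)
      from Henstock_Kurzweil_Integration.integral_combine [OF st(1,2) this] show ?thesis
        by (simp add: G_def algebra_simps)
    qed
    have W'int: "(W' has_integral (W t - W r)) {r..t}" if "s \<le> r" "r \<le> t" for r
    proof (rule fundamental_theorem_of_calculus [OF that(2)])
      fix x assume "x \<in> {r..t}"
      then show "(W has_vector_derivative W' x) (at x within {r..t})"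
        using st that by (intro has_vector_derivative_within_subset [OF W]) auto
    qed
    have Wlip: "norm (W t - W r) \<le> M * (t - s)" if "s \<le> r" "r \<le> t" for r
    proof -
      have "norm (W t - W r) \<le> integral {r..t} (\<lambda>_. M)"
        unfolding integral_unique [OF W'int [OF that], symmetric]
        by (rule integral_norm_bound_integral) (use W'int [OF that] M(2) st that in \<open>auto simp: integrable_on_def\<close>)
      also have "\<dots> = M * (t - r)" using that by simp
      also have "\<dots> \<le> M * (t - s)" using that M(1) by (intro mult_left_mono) auto
      finally show ?thesis .
    qed
    have Flip: "norm (F r - F s) \<le> G t - G s" if "s \<le> r" "r \<le> t" for r
    proof -
      have "f integrable_on {s..r}" by (rule integrable_on_subinterval [OF fi]) (use that in auto)
      moreover have n: "(\<lambda>r. norm (f r)) integrable_on {s..r}" by (rule integrable_on_subinterval [OF nfi]) (use that in auto)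
      ultimately have "norm (integral {s..r} f) \<le> integral {s..r} (\<lambda>r. norm (f r))"
        by (intro integral_norm_bound_integral) auto
      also have "\<dots> \<le> integral {s..t} (\<lambda>r. norm (f r))"
        by (rule integral_subset_le) (use that n nfi in auto)
      finally show ?thesis using Fdiff [OF that] Gdiff by simp
    qed
    have i1: "(\<lambda>r. f r * W r) integrable_on {s..t}" and i2: "(\<lambda>r. F r * W' r) integrable_on {s..t}"
      and i3: "W' integrable_on {s..t}"
      using integrable_on_subinterval [OF fW sub] integrable_on_subinterval [OF FW' sub] W'int [of s] st
      by auto
    have e1: "integral {s..t} (\<lambda>r. f r * (W r - W t)) = integral {s..t} (\<lambda>r. f r * W r) - (F t - F s) * W t"
      using Fdiff [of t] st i1 fi by (simp add: right_diff_distrib integral_diff integrable_on_mult_left)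
    have e2: "integral {s..t} (\<lambda>r. (F r - F s) * W' r) = integral {s..t} (\<lambda>r. F r * W' r) - F s * (W t - W s)"
      using integral_unique [OF W'int [of s]] st i2 i3
      by (simp add: left_diff_distrib integral_diff integrable_on_mult_right)
    have "\<Phi> t - \<Phi> s = integral {s..t} (\<lambda>r. f r * (W r - W t)) + integral {s..t} (\<lambda>r. (F r - F s) * W' r)"
      unfolding \<Phi>_def e1 e2 split [OF fW, symmetric] split [OF FW', symmetric] by (simp add: algebra_simps)
    also have "norm \<dots> \<le> M * (t - s) * (G t - G s) + M * (t - s) * (G t - G s)"
    proof (rule norm_triangle_le, rule add_mono)
      have "norm (integral {s..t} (\<lambda>r. f r * (W r - W t))) \<le> integral {s..t} (\<lambda>r. M * (t - s) * norm (f r))"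
      proof (rule integral_norm_bound_integral)
        show "(\<lambda>r. f r * (W r - W t)) integrable_on {s..t}"
          using i1 fi by (simp add: right_diff_distrib integrable_diff integrable_on_mult_left)
        show "(\<lambda>r. M * (t - s) * norm (f r)) integrable_on {s..t}"
          using nfi by (rule integrable_on_mult_right)
        fix r assume "r \<in> {s..t}"
        then have "norm (W r - W t) \<le> M * (t - s)" using Wlip [of r] by (simp add: norm_minus_commute)
        then show "norm (f r * (W r - W t)) \<le> M * (t - s) * norm (f r)"
          by (simp add: norm_mult mult.commute mult_left_mono)
      qed
      then show "norm (integral {s..t} (\<lambda>r. f r * (W r - W t))) \<le> M * (t - s) * (G t - G s)"
        by (simp add: Gdiff)
      have "norm (integral {s..t} (\<lambda>r. (F r - F s) * W' r)) \<le> integral {s..t} (\<lambda>r. (G t - G s) * M)"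
      proof (rule integral_norm_bound_integral)
        show "(\<lambda>r. (F r - F s) * W' r) integrable_on {s..t}"
          using i2 i3 by (simp add: left_diff_distrib integrable_diff integrable_on_mult_right)
        fix r assume r: "r \<in> {s..t}"
        show "norm ((F r - F s) * W' r) \<le> (G t - G s) * M"
          unfolding norm_mult
        proof (rule mult_mono)
          show "norm (F r - F s) \<le> G t - G s" using Flip r by simp
          then show "0 \<le> G t - G s" using norm_ge_zero order_trans by blast
          show "norm (W' r) \<le> M" using M(2) r sub by auto
        qed simp
      qed (rule integrable_const_ivl)
      then show "norm (integral {s..t} (\<lambda>r. (F r - F s) * W' r)) \<le> M * (t - s) * (G t - G s)"
        using st by (simp add: mult_ac)
    qed
    finally show "norm (\<Phi> t - \<Phi> s) \<le> 2 * M * (t - s) * (G t - G s)" by simp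
  qed
  then show ?thesis by (simp add: \<Phi>_def algebra_simps)
qed

text \<open>
  By Henstock's lemma the Riemann sums of $|f|$ are as small as those of \<open>f\<close> minus the (vanishing)
  integrals over the pieces, so $|f|$ has integral zero.
\<close>

lemma AE_zero_if_integrals_zero:
  fixes f :: "real \<Rightarrow> complex"
  assumes f: "f absolutely_integrable_on {a..b}"
    and zero: "\<And>c d. a \<le> c \<Longrightarrow> c \<le> d \<Longrightarrow> d \<le> b \<Longrightarrow> integral {c..d} f = 0"
  shows "AE t in lebesgue. t \<in> {a..b} \<longrightarrow> f t = 0"
proof -
  have "((\<lambda>t. norm (f t)) has_integral 0) (cbox a b)"
    unfolding has_integral
  proof (intro allI impI)
    fix e :: real assume "e > 0"
    have "f integrable_on cbox a b" using abs_int_integrable [OF f] by simp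
    from Henstock_lemma [OF this \<open>e > 0\<close>]
    obtain \<gamma> where \<gamma>: "gauge \<gamma>" "\<And>p. p tagged_partial_division_of (cbox a b) \<Longrightarrow> \<gamma> fine p \<Longrightarrow>
        (\<Sum>(x,k)\<in>p. norm (measure lborel k *\<^sub>R f x - integral k f)) < e" by blast
    show "\<exists>\<gamma>. gauge \<gamma> \<and> (\<forall>\<D>. \<D> tagged_division_of cbox a b \<and> \<gamma> fine \<D> \<longrightarrow>
        norm ((\<Sum>(x, k)\<in>\<D>. measure lborel k *\<^sub>R norm (f x)) - 0) < e)"
    proof (intro exI [of _ \<gamma>] conjI \<gamma>(1) allI impI, elim conjE)
      fix \<D> assume D: "\<D> tagged_division_of cbox a b" "\<gamma> fine \<D>"
      have "(\<Sum>(x, k)\<in>\<D>. measure lborel k *\<^sub>R norm (f x)) = (\<Sum>(x,k)\<in>\<D>. norm (measure lborel k *\<^sub>R f x - integral k f))"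
      proof (rule sum.cong, simp, clarify)
        fix t k assume "(t, k) \<in> \<D>"
        then obtain c d where k: "k = cbox c d" "k \<subseteq> cbox a b" "t \<in> k"
          using tagged_division_ofD [OF D(1)] by metis
        then have "integral k f = 0" using zero [of c d] by auto
        then show "measure lborel k *\<^sub>R norm (f t) = norm (measure lborel k *\<^sub>R f t - integral k f)" by simp
      qed
      moreover have "0 \<le> (\<Sum>(x, k)\<in>\<D>. measure lborel k *\<^sub>R norm (f x))"
        by (intro sum_nonneg) auto
      ultimately show "norm ((\<Sum>(x, k)\<in>\<D>. measure lborel k *\<^sub>R norm (f x)) - 0) < e"
        using \<gamma>(2) [OF _ D(2)] D(1) by (auto simp: tagged_division_of_def)
    qed
  qed
  then have i0: "integral {a..b} (\<lambda>t. norm (f t)) = 0" by (simp add: integral_unique)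
  have i: "integrable (lebesgue_on {a..b}) (\<lambda>t. norm (f t))"
    by (intro absolutely_integrable_imp_integrable set_integrable_norm f) simp
  then have "(LINT t|lebesgue_on {a..b}. norm (f t)) = 0"
    using lebesgue_integral_eq_integral [OF i] i0 by simp
  then have "AE t in lebesgue_on {a..b}. norm (f t) = 0"
    using integral_nonneg_eq_0_iff_AE [OF i] by simp
  then show ?thesis by (subst (asm) AE_restrict_space_iff) auto
qed

definition smooth :: "(real \<Rightarrow> real) \<Rightarrow> bool" where
  "smooth \<phi> \<longleftrightarrow> (\<forall>k t. (deriv ^^ k) \<phi> field_differentiable (at t))"

lemma smooth_DERIV: "smooth \<phi> \<Longrightarrow> (\<phi> has_real_derivative deriv \<phi> t) (at t)"
  unfolding smooth_def using field_differentiable_derivI [of \<phi> t] by (metis funpow_0)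

lemma smooth_deriv: "smooth \<phi> \<Longrightarrow> smooth (deriv \<phi>)"
  unfolding smooth_def by (metis comp_apply funpow_Suc_right)

lemma smooth_antiderivative:
  assumes "\<And>t. (\<phi> has_real_derivative \<xi> t) (at t)" "smooth \<xi>"
  shows "smooth \<phi>"
proof -
  have d: "deriv \<phi> = \<xi>" using assms(1) DERIV_imp_deriv by blast
  show ?thesis unfolding smooth_def
  proof (intro allI)
    fix k t
    show "(deriv ^^ k) \<phi> field_differentiable at t"
    proof (cases k)
      case 0
      then show ?thesis using assms(1) by (auto simp: field_differentiable_def)
    next
      case (Suc j)
      then have "(deriv ^^ k) \<phi> = (deriv ^^ j) \<xi>" by (simp add: funpow_swap1 d)
      then show ?thesis using assms(2) by (simp add: smooth_def)
    qed
  qed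
qed

lemma smooth_coinduct:
  assumes "\<And>f. f \<in> \<F> \<Longrightarrow> \<exists>f'\<in>\<F>. \<forall>t. (f has_real_derivative f' t) (at t)" "f \<in> \<F>"
  shows "smooth f"
proof -
  have "(deriv ^^ k) f \<in> \<F>" if "f \<in> \<F>" for k f
    using that
  proof (induction k arbitrary: f)
    case (Suc k)
    obtain f' where "f' \<in> \<F>" "\<forall>t. (f has_real_derivative f' t) (at t)" using assms(1) Suc.prems by blast
    then have "deriv f = f'" using DERIV_imp_deriv by blast
    then show ?case using Suc.IH \<open>f' \<in> \<F>\<close> by (simp add: funpow_swap1)
  qed simp
  then show ?thesis
    unfolding smooth_def field_differentiable_def using assms by metis
qed

definition flat :: "nat \<Rightarrow> real \<Rightarrow> real" where
  "flat n x = (if x > 0 then exp (- 1 / x) / x ^ n else 0)"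

text \<open>
  The factor $x^2$ makes the derivative at the origin vanish. It comes from
  $e^{y} \geq (y/m)^m$ with $y = 1/x$ and $m = n + 2$.
\<close>

lemma flat_le: "0 \<le> flat n x \<and> flat n x \<le> real (n + 2) ^ (n + 2) * x\<^sup>2"
proof (cases "x > 0")
  case True
  define m where "m = n + 2"
  have m: "real m > 0" by (simp add: m_def)
  have "(1 / (x * real m)) ^ m \<le> exp (1 / (x * real m)) ^ m"
  proof (rule power_mono)
    show "1 / (x * real m) \<le> exp (1 / (x * real m))"
      using exp_ge_add_one_self [of "1 / (x * real m)"] by linarith
  qed (use True m in simp)
  also have "\<dots> = exp (1 / x)"
    using m True by (simp flip: exp_of_nat_mult)
  finally have "exp (- (1 / x)) \<le> (x * real m) ^ m"
    using True m by (simp add: exp_minus power_divide power_one_over field_simps)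
  also have "\<dots> = real m ^ m * x\<^sup>2 * x ^ n"
    by (simp add: m_def power_mult_distrib power_add power2_eq_square)
  finally show ?thesis using True by (simp add: flat_def m_def field_simps)
qed (simp add: flat_def)

lemma flat_DERIV: "(flat n has_real_derivative flat (n + 2) x - real n * flat (n + 1) x) (at x)"
proof -
  consider "x > 0" | "x < 0" | "x = 0" by linarith
  then show ?thesis
  proof cases
    case 1
    have "((\<lambda>x. exp (- 1 / x) / x ^ n) has_real_derivative flat (n + 2) x - real n * flat (n + 1) x) (at x)"
    proof -
      define y where "y = inverse x"
      define E where "E = exp (- inverse x)"
      have fl: "flat k x = E * y ^ k" for k
        using 1 by (simp add: flat_def E_def y_def power_inverse divide_inverse)
      have "((\<lambda>x. inverse x) has_real_derivative - (y * y)) (at x)"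
        using 1 by (auto intro!: derivative_eq_intros simp: y_def)
      note d = this DERIV_power [OF this, of n]
      have "((\<lambda>x. exp (- inverse x)) has_real_derivative E * (y * y)) (at x)"
        using DERIV_fun_exp [OF DERIV_minus [OF d(1)]] by (simp add: E_def)
      from DERIV_mult' [OF this d(2)] show ?thesis
        unfolding fl by (cases n) (simp_all add: divide_inverse power_inverse E_def y_def [symmetric] algebra_simps)
    qed
    then show ?thesis
      by (rule has_field_derivative_transform_within_open [where S = "{0<..}"])
         (use 1 in \<open>auto simp: flat_def\<close>)
  next
    case 2
    have "((\<lambda>x. 0) has_real_derivative flat (n + 2) x - real n * flat (n + 1) x) (at x)"
      using 2 by (simp add: flat_def)
    then show ?thesis
      by (rule has_field_derivative_transform_within_open [where S = "{..<0}"])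
         (use 2 in \<open>auto simp: flat_def\<close>)
  next
    case 3
    let ?C = "real (n + 2) ^ (n + 2)"
    have "(\<lambda>h. flat n h / h) \<midarrow>0\<rightarrow> 0"
    proof (rule Lim_null_comparison)
      show "\<forall>\<^sub>F h in at 0. norm (flat n h / h) \<le> ?C * \<bar>h\<bar>"
      proof (rule always_eventually, rule allI)
        fix h :: real
        have "\<bar>flat n h\<bar> \<le> ?C * \<bar>h\<bar> * \<bar>h\<bar>" using flat_le [of n h] by (simp add: power2_eq_square mult.assoc)
        then show "norm (flat n h / h) \<le> ?C * \<bar>h\<bar>"
          by (cases "h = 0") (auto simp: divide_le_eq)
      qed
      have "((\<lambda>h. ?C * \<bar>h\<bar>) \<longlongrightarrow> ?C * \<bar>0\<bar>) (at 0)" by (intro tendsto_intros)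
      then show "((\<lambda>h. ?C * \<bar>h\<bar>) \<longlongrightarrow> 0) (at 0)" by simp
    qed
    then show ?thesis by (simp add: DERIV_def 3 flat_def)
  qed
qed

text \<open>
  The algebra generated by the functions \<open>flat n\<close> composed with affine maps is closed under
  differentiation, hence consists of smooth functions.
\<close>

inductive_set flat_algebra :: "(real \<Rightarrow> real) set" where
  flat: "(\<lambda>x. flat n (m * x + c)) \<in> flat_algebra"
| const: "(\<lambda>x. c) \<in> flat_algebra"
| add: "f \<in> flat_algebra \<Longrightarrow> g \<in> flat_algebra \<Longrightarrow> (\<lambda>x. f x + g x) \<in> flat_algebra"
| mult: "f \<in> flat_algebra \<Longrightarrow> g \<in> flat_algebra \<Longrightarrow> (\<lambda>x. f x * g x) \<in> flat_algebra"

lemma flat_algebra_smooth: "f \<in> flat_algebra \<Longrightarrow> smooth f"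
proof (rule smooth_coinduct [of flat_algebra])
  fix f assume "f \<in> flat_algebra"
  then show "\<exists>f'\<in>flat_algebra. \<forall>t. (f has_real_derivative f' t) (at t)"
  proof induction
    case (flat n m c)
    let ?f' = "\<lambda>x. m * (flat (n + 2) (m * x + c) + (- real n) * flat (n + 1) (m * x + c))"
    have "?f' \<in> flat_algebra"
      by (intro flat_algebra.intros)
    moreover have "((\<lambda>x. flat n (m * x + c)) has_real_derivative ?f' t) (at t)" for t
    proof -
      have "((\<lambda>x. m * x + c) has_real_derivative m) (at t)" by (auto intro!: derivative_eq_intros)
      from DERIV_chain2 [OF flat_DERIV this, of n] show ?thesis by (simp add: mult.commute)
    qed
    ultimately show ?case by (intro bexI [of _ ?f'] allI)
  next
    case (const c)
    then show ?case by (intro bexI [of _ "\<lambda>x. 0"]) (auto intro: flat_algebra.intros)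
  next
    case (add f g)
    then obtain f' g' where "f' \<in> flat_algebra" "g' \<in> flat_algebra"
      "\<forall>t. (f has_real_derivative f' t) (at t)" "\<forall>t. (g has_real_derivative g' t) (at t)" by blast
    then show ?case
      by (intro bexI [of _ "\<lambda>x. f' x + g' x"]) (auto intro!: flat_algebra.add DERIV_add)
  next
    case (mult f g)
    then obtain f' g' where "f' \<in> flat_algebra" "g' \<in> flat_algebra"
      "\<forall>t. (f has_real_derivative f' t) (at t)" "\<forall>t. (g has_real_derivative g' t) (at t)" by blast
    with mult.hyps show ?case
      by (intro bexI [of _ "\<lambda>x. f x * g' x + f' x * g x"])
         (auto intro!: flat_algebra.intros DERIV_mult')
  qed
qed

lemma bump_exists:
  assumes "\<delta> > 0"
  shows "\<exists>\<psi>. smooth \<psi> \<and> (\<forall>t. \<psi> t \<ge> 0) \<and> (\<forall>t. t \<notin> {s - \<delta><..<s + \<delta>} \<longrightarrow> \<psi> t = 0) \<and>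
    integral {s - \<delta>..s + \<delta>} \<psi> = 1"
proof -
  define \<psi>0 where "\<psi>0 t = flat 0 (1 * t + (\<delta> - s)) * flat 0 ((-1) * t + (s + \<delta>))" for t
  have a0: "\<psi>0 \<in> flat_algebra" unfolding \<psi>0_def by (intro flat_algebra.intros)
  have nn: "\<psi>0 t \<ge> 0" for t by (simp add: \<psi>0_def flat_def)
  have zero: "\<psi>0 t = 0" if "t \<notin> {s - \<delta><..<s + \<delta>}" for t using that by (auto simp: \<psi>0_def flat_def)
  have "\<psi>0 s > 0" using assms by (simp add: \<psi>0_def flat_def)
  have cont: "continuous_on {s - \<delta>..s + \<delta>} \<psi>0"
    using smooth_DERIV [OF flat_algebra_smooth [OF a0]] DERIV_isCont continuous_at_imp_continuous_on by blast
  define I where "I = integral {s - \<delta>..s + \<delta>} \<psi>0"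
  have "I \<noteq> 0"
  proof
    assume "I = 0"
    then have "\<psi>0 s = 0"
      using integral_eq_0_iff [OF cont _ , of] nn assms by (auto simp: I_def)
    then show False using \<open>\<psi>0 s > 0\<close> by simp
  qed
  moreover have "I \<ge> 0" unfolding I_def
    by (rule Henstock_Kurzweil_Integration.integral_nonneg) (auto intro: nn integrable_continuous_interval cont)
  ultimately have I: "I > 0" by simp
  show ?thesis
  proof (intro exI [of _ "\<lambda>t. (1 / I) * \<psi>0 t"] conjI allI impI)
    show "smooth (\<lambda>t. 1 / I * \<psi>0 t)"
      by (rule flat_algebra_smooth) (intro flat_algebra.intros a0)
    show "integral {s - \<delta>..s + \<delta>} (\<lambda>t. 1 / I * \<psi>0 t) = 1"
      using I by (simp add: I_def)
  qed (use nn zero I in auto)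
qed

text \<open>
  The antiderivative of the difference of two normalized bumps around \<open>s\<close> and \<open>t\<close> is
  a test function, so the averages of \<open>h\<close> against the two bumps agree; by continuity these
  averages are close to \<open>h s\<close> and \<open>h t\<close>.
\<close>

lemma du_bois_reymond:
  fixes h :: "real \<Rightarrow> complex"
  assumes h: "continuous_on {a<..<b} h"
    and test: "\<And>\<phi> c d. a < c \<Longrightarrow> c < d \<Longrightarrow> d < b \<Longrightarrow> smooth \<phi> \<Longrightarrow> (\<And>t. t \<notin> {c..d} \<Longrightarrow> \<phi> t = 0) \<Longrightarrow>
      integral {c..d} (\<lambda>t. of_real (deriv \<phi> t) * h t) = 0"
    and st: "a < s" "s < t" "t < b"
  shows "h s = h t"
proof (rule ccontr)
  assume "h s \<noteq> h t"
  define e where "e = norm (h s - h t) / 3"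
  have e: "e > 0" using \<open>h s \<noteq> h t\<close> by (simp add: e_def)
  have *: "\<exists>\<delta>>0. \<forall>r. \<bar>r - p\<bar> \<le> \<delta> \<longrightarrow> a < r \<and> r < b \<and> norm (h r - h p) \<le> e" if "a < p" "p < b" for p
  proof -
    have "isCont h p" using h that by (simp add: continuous_on_eq_continuous_at)
    then obtain d where d: "d > 0" "\<And>r. dist r p < d \<Longrightarrow> dist (h r) (h p) < e"
      using e by (auto simp: continuous_at_eps_delta)
    show ?thesis
      by (rule exI [of _ "min (d/2) (min ((p - a)/2) ((b - p)/2))"])
         (use d that in \<open>auto simp: dist_norm min_def abs_if field_simps split: if_splits intro!: less_imp_le\<close>)
  qed
  obtain \<delta>1 where d1: "\<delta>1 > 0" "\<And>r. \<bar>r - s\<bar> \<le> \<delta>1 \<Longrightarrow> a < r \<and> r < b \<and> norm (h r - h s) \<le> e"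
    using * [of s] st by auto
  obtain \<delta>2 where d2: "\<delta>2 > 0" "\<And>r. \<bar>r - t\<bar> \<le> \<delta>2 \<Longrightarrow> a < r \<and> r < b \<and> norm (h r - h t) \<le> e"
    using * [of t] st by auto
  define c where "c = min (s - \<delta>1) (t - \<delta>2)"
  define d where "d = max (s + \<delta>1) (t + \<delta>2)"
  have cd: "a < c" "c < d" "d < b"
    using d1(1) d2(1) d1(2) [of "s - \<delta>1"] d1(2) [of "s + \<delta>1"] d2(2) [of "t - \<delta>2"] d2(2) [of "t + \<delta>2"]
    by (auto simp: c_def d_def min_def max_def)
  have hc: "continuous_on {c..d} h" by (rule continuous_on_subset [OF h]) (use cd in auto)
  have avg: "\<exists>\<psi>. smooth \<psi> \<and> (\<forall>r. r \<notin> {c..d} \<longrightarrow> \<psi> r = 0) \<and> integral {c..d} \<psi> = 1 \<and>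
      norm (integral {c..d} (\<lambda>r. of_real (\<psi> r) * h r) - h p) \<le> e"
    if \<delta>: "\<delta> > 0" "\<And>r. \<bar>r - p\<bar> \<le> \<delta> \<Longrightarrow> norm (h r - h p) \<le> e" "c \<le> p - \<delta>" "p + \<delta> \<le> d" for p \<delta>
  proof -
    obtain \<psi> where \<psi>: "smooth \<psi>" "\<And>t. \<psi> t \<ge> 0" "\<And>t. t \<notin> {p - \<delta><..<p + \<delta>} \<Longrightarrow> \<psi> t = 0"
      "integral {p - \<delta>..p + \<delta>} \<psi> = 1" using bump_exists [OF \<delta>(1), of p] by auto
    have \<psi>c: "continuous_on A \<psi>" for A
      using smooth_DERIV [OF \<psi>(1)] DERIV_isCont continuous_at_imp_continuous_on by blast
    have "(\<psi> has_integral 1) {p - \<delta>..p + \<delta>}"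
      using \<psi>(4) integrable_continuous_interval [OF \<psi>c] by (metis integrable_integral)
    then have "(\<psi> has_integral 1) {c..d}"
      by (rule has_integral_on_superset) (use \<delta> \<psi>(3) in auto)
    then have I1: "integral {c..d} \<psi> = 1" by (rule integral_unique)
    have i\<psi>: "\<psi> integrable_on {c..d}" by (intro integrable_continuous_interval \<psi>c)
    have i1: "(\<lambda>r. of_real (\<psi> r) * h r) integrable_on {c..d}"
      by (intro integrable_continuous_interval continuous_intros \<psi>c hc)
    have i2: "((\<lambda>r. of_real (\<psi> r) * h p) has_integral of_real 1 * h p) {c..d}"
      using i\<psi> I1 by (intro has_integral_mult_left has_integral_of_real) (auto simp: has_integral_iff)
    have "norm (integral {c..d} (\<lambda>r. of_real (\<psi> r) * h r - of_real (\<psi> r) * h p)) \<le> integral {c..d} (\<lambda>r. \<psi> r * e)"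
    proof (rule integral_norm_bound_integral)
      show "(\<lambda>r. of_real (\<psi> r) * h r - of_real (\<psi> r) * h p) integrable_on {c..d}"
        using i1 i2 by (intro integrable_diff) (auto simp: has_integral_iff)
      show "(\<lambda>r. \<psi> r * e) integrable_on {c..d}" using i\<psi> by (rule integrable_on_mult_left)
      fix r assume "r \<in> {c..d}"
      show "norm (of_real (\<psi> r) * h r - of_real (\<psi> r) * h p) \<le> \<psi> r * e"
      proof (cases "r \<in> {p - \<delta><..<p + \<delta>}")
        case True
        then have "norm (h r - h p) \<le> e" by (intro \<delta>(2)) auto
        then show ?thesis using \<psi>(2) [of r]
          by (simp add: right_diff_distrib [symmetric] norm_mult mult_left_mono)
      qed (use \<psi>(3) in auto)
    qed
    also have "\<dots> = e" using I1 by simp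
    finally have "norm (integral {c..d} (\<lambda>r. of_real (\<psi> r) * h r) - h p) \<le> e"
      using integral_diff [OF i1 has_integral_integrable [OF i2]] integral_unique [OF i2]
      by (metis mult_1 of_real_1)
    then show ?thesis using \<psi> I1 \<delta> by (intro exI [of _ \<psi>]) auto
  qed
  obtain \<psi>1 where p1: "smooth \<psi>1" "\<And>r. r \<notin> {c..d} \<Longrightarrow> \<psi>1 r = 0" "integral {c..d} \<psi>1 = 1"
      "norm (integral {c..d} (\<lambda>r. of_real (\<psi>1 r) * h r) - h s) \<le> e"
    using avg [of \<delta>1 s] d1 by (auto simp: c_def d_def)
  obtain \<psi>2 where p2: "smooth \<psi>2" "\<And>r. r \<notin> {c..d} \<Longrightarrow> \<psi>2 r = 0" "integral {c..d} \<psi>2 = 1"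
      "norm (integral {c..d} (\<lambda>r. of_real (\<psi>2 r) * h r) - h t) \<le> e"
    using avg [of \<delta>2 t] d2 by (auto simp: c_def d_def)
  define \<xi> where "\<xi> r = \<psi>1 r - \<psi>2 r" for r
  have c1: "continuous_on A \<psi>1" and c2: "continuous_on A \<psi>2" for A
    using smooth_DERIV [OF p1(1)] smooth_DERIV [OF p2(1)] DERIV_isCont continuous_at_imp_continuous_on by blast+
  have cx: "continuous_on A \<xi>" for A unfolding \<xi>_def by (intro continuous_intros c1 c2)
  have ix: "\<xi> integrable_on {p..q}" for p q by (intro integrable_continuous_interval cx)
  have zx: "\<xi> r = 0" if "r \<notin> {c..d}" for r using p1(2) p2(2) that by (simp add: \<xi>_def)
  define \<phi> where "\<phi> r = integral {c - 1..r} \<xi>" for r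
  have \<phi>0: "\<phi> r = 0" if "r \<le> c" for r
  proof -
    have "integral {c - 1..r} \<xi> = integral {c - 1..r} (\<lambda>_. 0)"
    proof (rule integral_spike [of "{c}"])
      show "\<And>x. x \<in> {c - 1..r} - {c} \<Longrightarrow> 0 = \<xi> x" using zx that by auto
    qed simp
    then show ?thesis by (simp add: \<phi>_def)
  qed
  have \<phi>1: "\<phi> r = 0" if "r \<ge> d" for r
  proof -
    have "(\<xi> has_integral integral {c..d} \<xi>) {c - 1..r}"
      by (rule has_integral_on_superset [OF integrable_integral [OF ix]]) (use cd that zx in auto)
    then have "integral {c - 1..r} \<xi> = integral {c..d} \<xi>" by (rule integral_unique)
    also have "\<dots> = 0" unfolding \<xi>_def
      using p1(3) p2(3) by (simp add: integral_diff integrable_continuous_interval c1 c2)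
    finally show ?thesis by (simp add: \<phi>_def)
  qed
  have D: "(\<phi> has_real_derivative \<xi> r) (at r)" for r
  proof (cases "r < c")
    case True
    have "((\<lambda>_. 0) has_real_derivative \<xi> r) (at r)" using zx True by simp
    then show ?thesis
      by (rule has_field_derivative_transform_within_open [where S = "{..<c}"]) (use True \<phi>0 in auto)
  next
    case False
    have "(\<phi> has_real_derivative \<xi> r) (at r within {c - 1..r + 1})"
      unfolding \<phi>_def by (rule integral_has_real_derivative [OF cx]) (use False in auto)
    moreover have "at r within {c - 1..r + 1} = at r"
      by (rule at_within_interior) (use False in auto)
    ultimately show ?thesis by simp
  qed
  have "smooth \<phi>"
  proof (rule smooth_antiderivative [OF D])
    show "smooth \<xi>"
    proof -
      have "(deriv ^^ k) \<xi> = (\<lambda>r. (deriv ^^ k) \<psi>1 r - (deriv ^^ k) \<psi>2 r)" for k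
      proof (induction k)
        case (Suc k)
        have "deriv (\<lambda>r. (deriv ^^ k) \<psi>1 r - (deriv ^^ k) \<psi>2 r) = (\<lambda>r. deriv ((deriv ^^ k) \<psi>1) r - deriv ((deriv ^^ k) \<psi>2) r)"
          using p1(1) p2(1) unfolding smooth_def by (intro ext deriv_diff) auto
        then show ?case using Suc by simp
      qed (simp add: \<xi>_def fun_eq_iff)
      then show ?thesis using p1(1) p2(1) unfolding smooth_def by (auto intro: field_differentiable_diff)
    qed
  qed
  moreover have "\<phi> r = 0" if "r \<notin> {c..d}" for r using that \<phi>0 \<phi>1 by force
  moreover have "deriv \<phi> = \<xi>" using D DERIV_imp_deriv by blast
  ultimately have "integral {c..d} (\<lambda>r. of_real (\<xi> r) * h r) = 0"
    using test [OF cd, of \<phi>] by simp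
  moreover have "integral {c..d} (\<lambda>r. of_real (\<xi> r) * h r)
      = integral {c..d} (\<lambda>r. of_real (\<psi>1 r) * h r) - integral {c..d} (\<lambda>r. of_real (\<psi>2 r) * h r)"
    unfolding \<xi>_def of_real_diff left_diff_distrib
    by (intro integral_diff integrable_continuous_interval continuous_intros c1 c2 hc)
  ultimately have "norm (h s - h t) \<le> e + e"
    using p1(4) p2(4) norm_triangle_sub norm_diff_triangle_le [of "h s" "integral {c..d} (\<lambda>r. of_real (\<psi>1 r) * h r)" e "h t" e]
    by (simp add: norm_minus_commute)
  then show False using e by (simp add: e_def)
qed

lemma lebesgue_on_eq_integral:
  fixes f :: "real \<Rightarrow> complex"
  assumes U: "U \<in> sets lebesgue" and f: "f absolutely_integrable_on {c..d}"
    and zero: "\<And>t. t \<notin> {c..d} \<or> t \<notin> U \<Longrightarrow> f t = 0"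
  shows "(LINT t|lebesgue_on U. f t) = integral {c..d} f"
proof -
  have "(LINT t|lebesgue_on U. f t) = (LINT t|lebesgue. indicator U t *\<^sub>R f t)"
    by (rule integral_restrict_space) (use U in simp)
  also have "\<dots> = (LINT t|lebesgue. indicator {c..d} t *\<^sub>R f t)"
    by (rule Bochner_Integration.integral_cong) (use zero in \<open>auto simp: indicator_def\<close>)
  also have "\<dots> = integral {c..d} f"
    using set_lebesgue_integral_eq_integral(2) [OF f] by (simp add: set_lebesgue_integral_def)
  finally show ?thesis .
qed

lemma test_fun_smooth: "\<phi> \<in> test_fun U \<Longrightarrow> smooth \<phi>"
  by (simp add: test_fun_def smooth_def)

lemma continuous_on_of_real_smooth:
  assumes "smooth \<phi>"
  shows "continuous_on A (\<lambda>t. complex_of_real (\<phi> t))"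
  using smooth_DERIV [OF assms] DERIV_isCont continuous_at_imp_continuous_on
  by (intro continuous_intros) blast

lemma vector_derivative_of_real_smooth:
  assumes "smooth \<phi>"
  shows "((\<lambda>t. complex_of_real (\<phi> t)) has_vector_derivative of_real (deriv \<phi> t)) (at t within A)"
  using has_vector_derivative_of_real [OF has_field_derivative_at_within [OF smooth_DERIV [OF assms]]] .

lemma smooth_deriv_outside_support:
  assumes "closed K" "\<And>t. t \<notin> K \<Longrightarrow> \<phi> t = 0" "t \<notin> K"
  shows "deriv \<phi> t = (0::real)"
proof (rule DERIV_imp_deriv)
  show "(\<phi> has_real_derivative 0) (at t)"
    by (rule has_field_derivative_transform_within_open [where S = "- K" and f = "\<lambda>_. 0"])
       (use assms in auto)
qed

text \<open>
  A continuous function with a locally integrable weak derivative is its primitive: the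
  difference from the primitive has zero weak derivative.
\<close>

lemma weak_derivative_imp_primitive:
  fixes u g :: "real \<Rightarrow> complex"
  assumes wd: "weak_derivative U u g" and U: "{a<..<b} \<subseteq> U" "U \<in> sets lebesgue"
    and u: "continuous_on {a<..<b} u"
    and g: "\<And>c d. a < c \<Longrightarrow> d < b \<Longrightarrow> g absolutely_integrable_on {c..d}"
    and st: "a < s" "s \<le> t" "t < b"
  shows "u t - u s = integral {s..t} g"
proof (cases "s = t")
  case False
  define A where "A = (a + s) / 2"
  define B where "B = (t + b) / 2"
  have AB: "a < A" "A < s" "t < B" "B < b" using st by (auto simp: A_def B_def)
  have gAB: "g absolutely_integrable_on {A..B}" by (rule g) (use AB in auto)
  define V where "V r = integral {A..r} g" for r
  have Vc: "continuous_on {A..B} V" unfolding V_def by (rule continuous_on_indef_integral [OF gAB])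
  have "u s - V s = u t - V t"
  proof (rule du_bois_reymond [where a = A and b = B and h = "\<lambda>r. u r - V r"])
    show "continuous_on {A<..<B} (\<lambda>r. u r - V r)"
      by (intro continuous_intros continuous_on_subset [OF u] continuous_on_subset [OF Vc]) (use AB in auto)
    fix \<phi> c d assume cd: "A < c" "c < d" "d < B" and \<phi>: "smooth \<phi>" "\<And>t. t \<notin> {c..d} \<Longrightarrow> \<phi> t = 0"
    have uc: "continuous_on {c..d} u" by (rule continuous_on_subset [OF u]) (use cd AB in auto)
    have Vc': "continuous_on {c..d} V" by (rule continuous_on_subset [OF Vc]) (use cd AB in auto)
    have gcd: "g absolutely_integrable_on {c..d}" by (rule g) (use cd AB in auto)
    have sub: "{c..d} \<subseteq> U" using cd AB by (intro subset_trans [OF _ U(1)]) auto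
    have "\<phi> \<in> test_fun U" using \<phi> sub by (auto simp: test_fun_def smooth_def intro!: exI [of _ "{c..d}"])
    then have "(LINT t|lebesgue_on U. of_real (deriv \<phi> t) * u t) = - (LINT t|lebesgue_on U. of_real (\<phi> t) * g t)"
      using wd by (simp add: weak_derivative_def)
    moreover have "(LINT t|lebesgue_on U. of_real (deriv \<phi> t) * u t) = integral {c..d} (\<lambda>t. of_real (deriv \<phi> t) * u t)"
    proof (rule lebesgue_on_eq_integral [OF U(2)])
      show "(\<lambda>t. of_real (deriv \<phi> t) * u t) absolutely_integrable_on {c..d}"
        by (intro absolutely_integrable_continuous_real continuous_on_mult uc
            continuous_on_of_real_smooth smooth_deriv \<phi>)
      fix t assume "t \<notin> {c..d} \<or> t \<notin> U"
      then have "t \<notin> {c..d}" using sub by blast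
      then show "of_real (deriv \<phi> t) * u t = 0"
        using smooth_deriv_outside_support [OF closed_atLeastAtMost \<phi>(2)] by simp
    qed
    moreover have "(LINT t|lebesgue_on U. of_real (\<phi> t) * g t) = integral {c..d} (\<lambda>t. of_real (\<phi> t) * g t)"
    proof (rule lebesgue_on_eq_integral [OF U(2)])
      show "(\<lambda>t. of_real (\<phi> t) * g t) absolutely_integrable_on {c..d}"
        by (intro abs_int_mult_continuous gcd continuous_on_of_real_smooth \<phi>)
      fix t assume "t \<notin> {c..d} \<or> t \<notin> U"
      then have "t \<notin> {c..d}" using sub by blast
      then show "of_real (\<phi> t) * g t = 0" using \<phi>(2) by simp
    qed
    ultimately have 1: "integral {c..d} (\<lambda>t. of_real (deriv \<phi> t) * u t) = - integral {c..d} (\<lambda>t. of_real (\<phi> t) * g t)"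
      by simp
    have pz: "\<phi> c = 0" "\<phi> d = 0"
    proof -
      have isc: "isCont \<phi> r" for r using smooth_DERIV [OF \<phi>(1)] DERIV_isCont by blast
      have "(\<phi> \<longlongrightarrow> 0) (at_left c)"
        by (rule tendsto_eventually) (use \<phi>(2) in \<open>auto simp: eventually_at_filter\<close>)
      moreover have "(\<phi> \<longlongrightarrow> \<phi> c) (at_left c)" using isc [of c] by (simp add: isCont_def filterlim_at_split)
      ultimately show "\<phi> c = 0" using tendsto_unique trivial_limit_at_left_real by blast
      have "(\<phi> \<longlongrightarrow> 0) (at_right d)"
        by (rule tendsto_eventually) (use \<phi>(2) in \<open>auto simp: eventually_at_filter\<close>)
      moreover have "(\<phi> \<longlongrightarrow> \<phi> d) (at_right d)" using isc [of d] by (simp add: isCont_def filterlim_at_split)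
      ultimately show "\<phi> d = 0" using tendsto_unique trivial_limit_at_right_real by blast
    qed
    have "integral {c..d} (\<lambda>t. g t * of_real (\<phi> t)) + integral {c..d} (\<lambda>t. V t * of_real (deriv \<phi> t))
        = V d * of_real (\<phi> d) - V c * of_real (\<phi> c)"
    proof (rule integration_by_parts_L1 [OF _ gcd])
      fix r assume r: "r \<in> {c..d}"
      have "g integrable_on {A..r}"
        by (rule integrable_on_subinterval [OF abs_int_integrable [OF gAB]]) (use r cd in auto)
      from Henstock_Kurzweil_Integration.integral_combine [OF _ _ this, of c]
      show "V r = V c + integral {c..r} g" using r cd by (simp add: V_def)
    next
      show "continuous_on {c..d} (\<lambda>t. complex_of_real (deriv \<phi> t))"
        by (intro continuous_on_of_real_smooth smooth_deriv \<phi>)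
    qed (use cd \<phi> in \<open>auto intro!: vector_derivative_of_real_smooth\<close>)
    then have 2: "integral {c..d} (\<lambda>t. of_real (deriv \<phi> t) * V t) = - integral {c..d} (\<lambda>t. of_real (\<phi> t) * g t)"
      by (simp add: pz mult.commute add_eq_0_iff)
    have "integral {c..d} (\<lambda>t. of_real (deriv \<phi> t) * (u t - V t)) =
        integral {c..d} (\<lambda>t. of_real (deriv \<phi> t) * u t) - integral {c..d} (\<lambda>t. of_real (deriv \<phi> t) * V t)"
      unfolding right_diff_distrib
      by (intro integral_diff integrable_continuous_interval continuous_on_mult uc Vc'
            continuous_on_of_real_smooth smooth_deriv \<phi>)
    then show "integral {c..d} (\<lambda>t. of_real (deriv \<phi> t) * (u t - V t)) = 0" using 1 2 by simp
  qed (use AB st False in auto)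
  then have "u t - u s = V t - V s" by (simp add: algebra_simps)
  also have "\<dots> = integral {s..t} g"
  proof -
    have "g integrable_on {A..t}"
      by (rule integrable_on_subinterval [OF abs_int_integrable [OF gAB]]) (use st AB in auto)
    from Henstock_Kurzweil_Integration.integral_combine [OF _ st(2) this] show ?thesis
      using AB by (simp add: V_def algebra_simps)
  qed
  finally show ?thesis .
qed simp

section \<open>Functions with interface conditions\<close>

locale grid =
  fixes x \<alpha> :: "nat \<Rightarrow> real"
  assumes x0: "x 0 = 0" and x_mono: "strict_mono x"
    and x_unbounded: "filterlim x at_top sequentially"
begin

lemma x_less: "x n < x (Suc n)"
  using x_mono by (simp add: strict_mono_def)

lemma x_nonneg: "0 \<le> x n"
  using x_mono x0 by (metis le0 strict_mono_less_eq)

lemma x_exceeds: "\<exists>N. R < x N"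
  using filterlim_at_top_dense [of x sequentially] x_unbounded eventually_happens' [OF sequentially_bot] by blast

lemma interval_exists:
  assumes "0 \<le> t"
  shows "\<exists>n. x n \<le> t \<and> t < x (Suc n)"
proof -
  let ?k = "LEAST k. t < x k"
  have k: "t < x ?k" using x_exceeds by (rule LeastI_ex)
  then have "?k \<noteq> 0" using assms x0 by (metis not_less)
  then obtain n where n: "?k = Suc n" using not0_implies_Suc by blast
  then have "\<not> t < x n" using not_less_Least by (metis lessI)
  then show ?thesis using k n by (intro exI [of _ n]) auto
qed

lemma interval_unique:
  assumes "x n \<le> t" "t < x (Suc n)" "x m \<le> t" "t < x (Suc m)"
  shows "m = n"
  using assms x_mono by (metis le_less_trans less_Suc_eq_le order_antisym strict_mono_less)

definition U :: "real set" where "U = {0<..} - range x"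

lemma interior_subset_U: "{x n<..<x (Suc n)} \<subseteq> U"
proof
  fix t assume t: "t \<in> {x n<..<x (Suc n)}"
  have "t \<notin> range x"
  proof
    assume "t \<in> range x"
    then obtain m where "t = x m" by blast
    then show False using t x_mono by (auto simp: strict_mono_less)
  qed
  then show "t \<in> U" using t x_nonneg [of n] by (simp add: U_def)
qed

lemma U_cases:
  assumes "t \<in> U"
  obtains n where "t \<in> {x n<..<x (Suc n)}"
proof -
  obtain n where "x n \<le> t" "t < x (Suc n)" using interval_exists [of t] assms by (auto simp: U_def)
  moreover have "t \<noteq> x n" using assms by (auto simp: U_def)
  ultimately show ?thesis using that [of n] by simp
qed

lemma U_Union: "U = (\<Union>n. {x n<..<x (Suc n)})"
proof
  show "U \<subseteq> (\<Union>n. {x n<..<x (Suc n)})" by (auto elim!: U_cases)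
  show "(\<Union>n. {x n<..<x (Suc n)}) \<subseteq> U" using interior_subset_U by (rule UN_least)
qed

lemma open_U: "open U"
  unfolding U_Union by auto

lemma sets_U: "U \<in> sets lebesgue"
  using open_U by (simp add: borel_open)

lemma null_nodes: "range x \<in> null_sets lebesgue"
  by (simp add: countable_imp_null_set_lborel null_sets_completionI)

lemma AE_not_node: "AE t in lebesgue. t \<notin> range x"
  using null_nodes by (rule AE_not_in)

definition loc_int :: "(real \<Rightarrow> complex) \<Rightarrow> bool" where
  "loc_int g \<longleftrightarrow> (\<forall>a b. 0 \<le> a \<longrightarrow> g absolutely_integrable_on {a..b})"

lemma loc_intD: "loc_int g \<Longrightarrow> 0 \<le> a \<Longrightarrow> g absolutely_integrable_on {a..b}"
  by (simp add: loc_int_def)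

lemma loc_int_zero: "loc_int (\<lambda>t. 0)"
  by (simp add: loc_int_def)

lemma l2_loc_int:
  assumes "g \<in> l2 {0<..}"
  shows "loc_int g"
  unfolding loc_int_def
proof (intro allI impI)
  fix a b :: real assume "0 \<le> a"
  have m: "g \<in> borel_measurable (lebesgue_on {0<..b})"
    by (rule measurable_restrict_mono [OF l2_meas [OF assms]]) auto
  have sq: "(\<lambda>t. (cmod (g t))\<^sup>2) absolutely_integrable_on {0<..}"
    using l2_int [OF assms] by (simp add: set_integrable_def integrable_restrict_space)
  have "(\<lambda>t. 1 + (cmod (g t))\<^sup>2) integrable_on {0<..b}"
  proof (rule integrable_add)
    show "(\<lambda>t. 1::real) integrable_on {0<..b}"
      by (intro integrable_on_const bounded_set_imp_lmeasurable) auto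
    have "(\<lambda>t. (cmod (g t))\<^sup>2) absolutely_integrable_on {0<..b}"
      by (rule set_integrable_subset [OF sq]) auto
    then show "(\<lambda>t. (cmod (g t))\<^sup>2) integrable_on {0<..b}" by (rule set_lebesgue_integral_eq_integral)
  qed
  note dom = this
  have "g absolutely_integrable_on {0<..b}"
  proof (rule measurable_bounded_by_integrable_imp_absolutely_integrable [OF m _ dom])
    fix t
    have "cmod (g t) \<le> 1 + (cmod (g t))\<^sup>2"
      using zero_le_power2 [of "cmod (g t) - 1"] by (simp add: power2_diff) (smt (verit) norm_ge_zero)
    then show "norm (g t) \<le> 1 + (cmod (g t))\<^sup>2" by simp
  qed simp
  then have "g absolutely_integrable_on {0..b}"
    by (rule absolutely_integrable_spike_set) (auto intro: negligible_subset [of "{0}"])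
  then show "g absolutely_integrable_on {a..b}"
    by (rule absolutely_integrable_on_subinterval) (use \<open>0 \<le> a\<close> in auto)
qed

text \<open>
  Between two nodes \<open>u\<close> is the second primitive of $-g$ and \<open>u1\<close> its derivative; at a node
  \<open>u1\<close> takes its right limit.
\<close>

definition sol :: "(real \<Rightarrow> complex) \<Rightarrow> (real \<Rightarrow> complex) \<Rightarrow> (real \<Rightarrow> complex) \<Rightarrow> bool" where
  "sol g u u1 \<longleftrightarrow> (\<forall>n.
    (\<forall>t\<in>{x n..x (Suc n)}. u t = u (x n) + integral {x n..t} (\<lambda>s. u1 (x n) - integral {x n..s} g)) \<and>
    (\<forall>t\<in>{x n..<x (Suc n)}. u1 t = u1 (x n) - integral {x n..t} g) \<and>
    u1 (x (Suc n)) = u1 (x n) - integral {x n..x (Suc n)} g + of_real (\<alpha> (Suc n)) * u (x (Suc n)))"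

lemma sol_u: "sol g u u1 \<Longrightarrow> t \<in> {x n..x (Suc n)} \<Longrightarrow>
    u t = u (x n) + integral {x n..t} (\<lambda>s. u1 (x n) - integral {x n..s} g)"
  by (simp add: sol_def)

lemma sol_u1: "sol g u u1 \<Longrightarrow> t \<in> {x n..<x (Suc n)} \<Longrightarrow> u1 t = u1 (x n) - integral {x n..t} g"
  by (simp add: sol_def)

lemma sol_jump: "sol g u u1 \<Longrightarrow>
    u1 (x (Suc n)) = u1 (x n) - integral {x n..x (Suc n)} g + of_real (\<alpha> (Suc n)) * u (x (Suc n))"
  by (simp add: sol_def)

lemma sol_exists:
  fixes g :: "real \<Rightarrow> complex"
  shows "\<exists>u u1. sol g u u1 \<and> u 0 = a \<and> u1 0 = b"
proof -
  define slope where "slope b n t = b - integral {x n..t} g" for b n t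
  define val where "val c b n t = c + integral {x n..t} (\<lambda>s. slope b n s)" for c b n t
  define step where "step n p = (let c' = val (fst p) (snd p) n (x (Suc n))
      in (c', slope (snd p) n (x (Suc n)) + of_real (\<alpha> (Suc n)) * c'))" for n p
  define P where "P = rec_nat (a, b) step"
  have P0: "P 0 = (a, b)" and PS: "P (Suc n) = step n (P n)" for n by (simp_all add: P_def)
  define idx where "idx t = (SOME n. x n \<le> t \<and> t < x (Suc n))" for t
  have idx: "idx t = n" if "x n \<le> t" "t < x (Suc n)" for n t
    unfolding idx_def by (rule some_equality) (use that interval_unique in auto)
  define u where "u t = val (fst (P (idx t))) (snd (P (idx t))) (idx t) t" for t
  define u1 where "u1 t = slope (snd (P (idx t))) (idx t) t" for t
  have ux: "u (x n) = fst (P n)" and u1x: "u1 (x n) = snd (P n)" for n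
    using idx [of n "x n"] x_less [of n] by (simp_all add: u_def u1_def val_def slope_def)
  have "sol g u u1"
    unfolding sol_def
  proof (intro allI conjI ballI)
    fix n
    show "u1 t = u1 (x n) - integral {x n..t} g" if "t \<in> {x n..<x (Suc n)}" for t
      using idx [of n t] that by (simp add: u1_def [of t] slope_def u1x)
    show "u1 (x (Suc n)) = u1 (x n) - integral {x n..x (Suc n)} g + of_real (\<alpha> (Suc n)) * u (x (Suc n))"
      unfolding u1x ux PS step_def by (simp add: Let_def slope_def)
    fix t assume t: "t \<in> {x n..x (Suc n)}"
    show "u t = u (x n) + integral {x n..t} (\<lambda>s. u1 (x n) - integral {x n..s} g)"
    proof (cases "t = x (Suc n)")
      case True
      show ?thesis unfolding True ux u1x PS step_def by (simp add: Let_def val_def slope_def)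
    next
      case False
      then show ?thesis using idx [of n t] t by (simp add: u_def [of t] val_def slope_def ux u1x)
    qed
  qed
  moreover have "u 0 = a" "u1 0 = b" using ux [of 0] u1x [of 0] by (simp_all add: x0 P0)
  ultimately show ?thesis by blast
qed

lemma slope_continuous:
  assumes "loc_int g"
  shows "continuous_on {x n..b} (\<lambda>t. c - integral {x n..t} g)"
  by (intro continuous_intros continuous_on_indef_integral loc_intD [OF assms] x_nonneg)

lemma sol_vector_derivative:
  assumes "sol g u u1" "loc_int g" "t \<in> {x n..x (Suc n)}"
  shows "(u has_vector_derivative u1 (x n) - integral {x n..t} g) (at t within {x n..x (Suc n)})"
proof -
  have "((\<lambda>t. u (x n) + integral {x n..t} (\<lambda>s. u1 (x n) - integral {x n..s} g)) has_vector_derivative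
      0 + (u1 (x n) - integral {x n..t} g)) (at t within {x n..x (Suc n)})"
    by (intro has_vector_derivative_add has_vector_derivative_const
        integral_has_vector_derivative slope_continuous assms)
  then show ?thesis
    using sol_u [OF assms(1)] assms(3)
    by (auto intro: has_vector_derivative_transform [rotated -1])
qed

lemma sol_continuous:
  assumes "sol g u u1" "loc_int g"
  shows "continuous_on {x n..x (Suc n)} u"
  using sol_vector_derivative [OF assms] has_vector_derivative_continuous
  unfolding continuous_on_eq_continuous_within by blast

lemma sol_zero_on_interval:
  assumes "sol g u u1" "loc_int g" and zero: "\<And>r. r \<in> {x n..x (Suc n)} \<Longrightarrow> u r = 0"
    and t: "t \<in> {x n..x (Suc n)}"
  shows "u1 (x n) - integral {x n..t} g = 0"
proof -
  have "((\<lambda>_. 0) has_vector_derivative u1 (x n) - integral {x n..t} g) (at t within {x n..x (Suc n)})"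
    using sol_vector_derivative [OF assms(1,2) t] zero t
    by (auto intro: has_vector_derivative_transform [rotated -1])
  moreover have "f' = 0" if "((\<lambda>_. 0) has_vector_derivative f') (at t within {x n..x (Suc n)})" for f' :: complex
    using vector_derivative_unique_within_closed_interval [OF x_less, of t n "\<lambda>_. 0" f' 0] t that
    by (simp add: has_vector_derivative_const)
  ultimately show ?thesis by blast
qed

lemma sol_add_scaled:
  assumes "sol g u u1" "sol h w w1" "loc_int g" "loc_int h"
  shows "sol (\<lambda>t. g t + c * h t) (\<lambda>t. u t + c * w t) (\<lambda>t. u1 t + c * w1 t)"
proof -
  have gi: "g integrable_on {x n..t}" and hi: "h integrable_on {x n..t}" for n t
    using loc_intD assms(3,4) x_nonneg abs_int_integrable by blast+
  have I: "integral {x n..t} (\<lambda>t. g t + c * h t) = integral {x n..t} g + c * integral {x n..t} h" for n t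
    using gi hi by (simp add: integral_add integrable_on_mult_right)
  have I2: "integral {x n..t} (\<lambda>s. u1 (x n) + c * w1 (x n) - integral {x n..s} (\<lambda>t. g t + c * h t))
      = integral {x n..t} (\<lambda>s. u1 (x n) - integral {x n..s} g)
      + c * integral {x n..t} (\<lambda>s. w1 (x n) - integral {x n..s} h)" for n t
  proof -
    have "integral {x n..t} (\<lambda>s. (u1 (x n) - integral {x n..s} g) + c * (w1 (x n) - integral {x n..s} h))
      = integral {x n..t} (\<lambda>s. u1 (x n) - integral {x n..s} g)
      + integral {x n..t} (\<lambda>s. c * (w1 (x n) - integral {x n..s} h))"
      by (intro integral_add integrable_on_mult_right integrable_continuous_interval slope_continuous assms)
    moreover have "(\<lambda>s. u1 (x n) + c * w1 (x n) - integral {x n..s} (\<lambda>t. g t + c * h t))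
      = (\<lambda>s. (u1 (x n) - integral {x n..s} g) + c * (w1 (x n) - integral {x n..s} h))"
      by (simp add: I fun_eq_iff algebra_simps)
    ultimately show ?thesis by (simp only: Henstock_Kurzweil_Integration.integral_mult_right)
  qed
  show ?thesis
    unfolding sol_def
  proof (intro allI conjI ballI)
    fix n
    show "u1 t + c * w1 t = u1 (x n) + c * w1 (x n) - integral {x n..t} (\<lambda>t. g t + c * h t)"
      if "t \<in> {x n..<x (Suc n)}" for t
      unfolding I sol_u1 [OF assms(1) that] sol_u1 [OF assms(2) that] by (simp add: algebra_simps)
    show "u1 (x (Suc n)) + c * w1 (x (Suc n)) = u1 (x n) + c * w1 (x n)
        - integral {x n..x (Suc n)} (\<lambda>t. g t + c * h t)
        + of_real (\<alpha> (Suc n)) * (u (x (Suc n)) + c * w (x (Suc n)))"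
      unfolding I sol_jump [OF assms(1)] sol_jump [OF assms(2)] by (simp add: algebra_simps)
    fix t assume t: "t \<in> {x n..x (Suc n)}"
    show "u t + c * w t = u (x n) + c * w (x n) + integral {x n..t}
        (\<lambda>s. u1 (x n) + c * w1 (x n) - integral {x n..s} (\<lambda>t. g t + c * h t))"
      unfolding I2 by (subst sol_u [OF assms(1) t], subst sol_u [OF assms(2) t]) (simp add: distrib_left)
  qed
qed

lemma loc_int_add_scaled: "loc_int g \<Longrightarrow> loc_int h \<Longrightarrow> loc_int (\<lambda>t. g t + c * h t)"
  unfolding loc_int_def by (auto intro!: set_integral_add)

lemma loc_int_cnj:
  assumes "loc_int g" shows "loc_int (\<lambda>t. cnj (g t))"
  unfolding loc_int_def
proof (intro allI impI)
  fix a b :: real assume "0 \<le> a"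
  from absolutely_integrable_linear [OF loc_intD [OF assms this] bounded_linear_cnj]
  show "(\<lambda>t. cnj (g t)) absolutely_integrable_on {a..b}" by (simp add: o_def)
qed

lemma sol_cnj:
  assumes "sol g u u1"
  shows "sol (\<lambda>t. cnj (g t)) (\<lambda>t. cnj (u t)) (\<lambda>t. cnj (u1 t))"
proof -
  have c: "integral A (\<lambda>t. cnj (f t)) = cnj (integral A f)" for A :: "real set" and f
    by (rule Henstock_Kurzweil_Integration.integral_cnj [symmetric])
  have "integral {x n..t} (\<lambda>s. cnj (u1 (x n)) - cnj (integral {x n..s} g))
      = cnj (integral {x n..t} (\<lambda>s. u1 (x n) - integral {x n..s} g))" for n t
    by (simp add: c [symmetric])
  then show ?thesis
    unfolding sol_def c
    using sol_u [OF assms] sol_u1 [OF assms] sol_jump [OF assms] by auto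
qed

text \<open>The jump terms cancel in the Wronskian because \<open>\<alpha>\<close> acts on both functions in the same way.\<close>

lemma green:
  assumes "sol g u u1" "sol h w w1" "loc_int g" "loc_int h"
  shows "((\<lambda>t. g t * w t - u t * h t) has_integral
    (u (x N) * w1 (x N) - u1 (x N) * w (x N)) - (u 0 * w1 0 - u1 0 * w 0)) {0..x N}"
proof (induction N)
  case 0
  then show ?case by (simp add: x0 has_integral_refl(2))
next
  case (Suc n)
  let ?a = "x n" and ?b = "x (Suc n)"
  have ab: "?a \<le> ?b" using x_less [of n] by simp
  have gi: "g absolutely_integrable_on {?a..?b}" and hi: "h absolutely_integrable_on {?a..?b}"
    using assms loc_intD x_nonneg by blast+
  have ibp: "integral {?a..?b} (\<lambda>t. - g t * w t) + integral {?a..?b} (\<lambda>t. (u1 ?a - integral {?a..t} g) * (w1 ?a - integral {?a..t} h))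
     = (u1 ?a - integral {?a..?b} g) * w ?b - u1 ?a * w ?a"
    if "sol g u u1" "sol h w w1" "loc_int g" "loc_int h" "g absolutely_integrable_on {?a..?b}" for g h u u1 w w1
  proof -
    have "integral {?a..?b} (\<lambda>t. - g t * w t) + integral {?a..?b} (\<lambda>t. (u1 ?a - integral {?a..t} g) * (w1 ?a - integral {?a..t} h))
     = (u1 ?a - integral {?a..?b} g) * w ?b - (u1 ?a - integral {?a..?a} g) * w ?a"
    proof (rule integration_by_parts_L1 [OF ab])
      show "(\<lambda>t. - g t) absolutely_integrable_on {?a..?b}"
        using absolutely_integrable_linear [OF that(5) bounded_linear_minus [OF bounded_linear_ident]]
        by (simp add: o_def)
    qed (use that sol_vector_derivative slope_continuous in auto)
    then show ?thesis by simp
  qed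
  have e1: "(\<lambda>t. w t * g t) integrable_on {?a..?b}" and e2: "(\<lambda>t. u t * h t) integrable_on {?a..?b}"
    using abs_int_integrable [OF abs_int_mult_continuous] gi hi sol_continuous [OF assms(1,3)] sol_continuous [OF assms(2,4)]
    by blast+
  have e1': "(\<lambda>t. g t * w t) integrable_on {?a..?b}" using e1 by (simp add: mult.commute)
  have "integral {?a..?b} (\<lambda>t. g t * w t - u t * h t) = integral {?a..?b} (\<lambda>t. g t * w t) - integral {?a..?b} (\<lambda>t. u t * h t)"
    by (rule integral_diff [OF e1' e2])
  also have "\<dots> = (u ?b * w1 ?b - u1 ?b * w ?b) - (u ?a * w1 ?a - u1 ?a * w ?a)"
  proof -
    define J where "J = integral {?a..?b} (\<lambda>t. (u1 ?a - integral {?a..t} g) * (w1 ?a - integral {?a..t} h))"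
    have J': "J = integral {?a..?b} (\<lambda>t. (w1 ?a - integral {?a..t} h) * (u1 ?a - integral {?a..t} g))"
      by (simp add: J_def mult.commute)
    have 1: "integral {?a..?b} (\<lambda>t. g t * w t) = J - ((u1 ?a - integral {?a..?b} g) * w ?b - u1 ?a * w ?a)"
      unfolding ibp [OF assms gi, folded J_def, symmetric] by simp
    have 2: "integral {?a..?b} (\<lambda>t. u t * h t) = J - ((w1 ?a - integral {?a..?b} h) * u ?b - w1 ?a * u ?a)"
      unfolding ibp [OF assms(2,1,4,3) hi, folded J', symmetric] by (simp add: mult.commute)
    show ?thesis
      unfolding 1 2 sol_jump [OF assms(1)] sol_jump [OF assms(2)] by (simp add: algebra_simps)
  qed
  finally have "((\<lambda>t. g t * w t - u t * h t) has_integral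
      (u ?b * w1 ?b - u1 ?b * w ?b) - (u ?a * w1 ?a - u1 ?a * w ?a)) {?a..?b}"
    using integrable_integral [OF integrable_diff [OF e1' e2]] by simp
  from has_integral_combine [OF x_nonneg ab Suc this] show ?case by (simp add: algebra_simps)
qed

lemma sol_limits:
  assumes "sol g u u1" "loc_int g"
  shows "(u \<longlongrightarrow> u (x n)) (at_right (x n))"
    and "(u1 \<longlongrightarrow> u1 (x n)) (at_right (x n))"
    and "(u \<longlongrightarrow> u (x (Suc n))) (at_left (x (Suc n)))"
    and "(u1 \<longlongrightarrow> u1 (x n) - integral {x n..x (Suc n)} g) (at_left (x (Suc n)))"
proof -
  have c: "continuous_on {x n..x (Suc n)} (\<lambda>t. u1 (x n) - integral {x n..t} g)"
    by (rule slope_continuous [OF assms(2)])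
  show "(u \<longlongrightarrow> u (x n)) (at_right (x n))"
    by (rule continuous_on_Icc_at_rightD [OF sol_continuous [OF assms] x_less])
  show "(u \<longlongrightarrow> u (x (Suc n))) (at_left (x (Suc n)))"
    by (rule continuous_on_Icc_at_leftD [OF sol_continuous [OF assms] x_less])
  have "((\<lambda>t. u1 (x n) - integral {x n..t} g) \<longlongrightarrow> u1 (x n) - integral {x n..x n} g) (at_right (x n))"
    by (rule continuous_on_Icc_at_rightD [OF c x_less])
  moreover have "\<forall>\<^sub>F t in at_right (x n). u1 (x n) - integral {x n..t} g = u1 t"
    using eventually_at_right_real [OF x_less [of n]]
    by eventually_elim (rule sol_u1 [OF assms(1), symmetric], auto)
  ultimately have "(u1 \<longlongrightarrow> u1 (x n) - integral {x n..x n} g) (at_right (x n))"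
    by (rule Lim_transform_eventually)
  then show "(u1 \<longlongrightarrow> u1 (x n)) (at_right (x n))" by simp
  have "((\<lambda>t. u1 (x n) - integral {x n..t} g) \<longlongrightarrow> u1 (x n) - integral {x n..x (Suc n)} g) (at_left (x (Suc n)))"
    by (rule continuous_on_Icc_at_leftD [OF c x_less])
  moreover have "\<forall>\<^sub>F t in at_left (x (Suc n)). u1 (x n) - integral {x n..t} g = u1 t"
    using eventually_at_left_real [OF x_less [of n]]
    by eventually_elim (rule sol_u1 [OF assms(1), symmetric], auto)
  ultimately show "(u1 \<longlongrightarrow> u1 (x n) - integral {x n..x (Suc n)} g) (at_left (x (Suc n)))"
    by (rule Lim_transform_eventually)
qed

lemma sol_continuous_U:
  assumes "sol g u u1" "loc_int g"
  shows "continuous_on U u" "continuous_on U u1"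
proof -
  have "continuous_on {x n<..<x (Suc n)} u" for n
    by (rule continuous_on_subset [OF sol_continuous [OF assms, of n]]) auto
  then show "continuous_on U u" unfolding U_Union by (intro continuous_on_open_UN) auto
  have "continuous_on {x n<..<x (Suc n)} u1" for n
  proof (rule continuous_on_eq)
    show "continuous_on {x n<..<x (Suc n)} (\<lambda>t. u1 (x n) - integral {x n..t} g)"
      by (rule continuous_on_subset [OF slope_continuous [OF assms(2), of n "x (Suc n)"]]) auto
  qed (rule sol_u1 [OF assms(1), symmetric], auto)
  then show "continuous_on U u1" unfolding U_Union by (intro continuous_on_open_UN) auto
qed

lemma sol_bounded:
  assumes "sol g u u1" "loc_int g"
  shows "\<exists>M. \<forall>t\<in>{0..x N}. cmod (u t) \<le> M \<and> cmod (u1 t) \<le> M"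
proof (induction N)
  case 0
  then show ?case by (intro exI [of _ "max (cmod (u 0)) (cmod (u1 0))"]) (auto simp: x0)
next
  case (Suc n)
  then obtain M where M: "\<And>t. t \<in> {0..x n} \<Longrightarrow> cmod (u t) \<le> M \<and> cmod (u1 t) \<le> M" by blast
  have bd: "\<exists>B. \<forall>t\<in>{x n..x (Suc n)}. cmod (f t) \<le> B" if "continuous_on {x n..x (Suc n)} f" for f :: "real \<Rightarrow> complex"
    using compact_imp_bounded [OF compact_continuous_image [OF that]] by (auto simp: bounded_iff)
  obtain A where A: "\<And>t. t \<in> {x n..x (Suc n)} \<Longrightarrow> cmod (u t) \<le> A"
    using bd [OF sol_continuous [OF assms]] by blast
  obtain B where B: "\<And>t. t \<in> {x n..x (Suc n)} \<Longrightarrow> cmod (u1 (x n) - integral {x n..t} g) \<le> B"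
    using bd [OF slope_continuous [OF assms(2)]] by blast
  show ?case
  proof (intro exI ballI)
    fix t assume t: "t \<in> {0..x (Suc n)}"
    consider "t \<le> x n" | "t \<in> {x n..<x (Suc n)}" | "t = x (Suc n)" using t by force
    then show "cmod (u t) \<le> Max {M, A, B, cmod (u1 (x (Suc n)))} \<and> cmod (u1 t) \<le> Max {M, A, B, cmod (u1 (x (Suc n)))}"
    proof cases
      case 1
      then show ?thesis using M [of t] t by auto
    next
      case 2
      then show ?thesis using A [of t] B [of t] sol_u1 [OF assms(1), of t n] by auto
    next
      case 3
      then show ?thesis using A [of t] x_less [of n] by auto
    qed
  qed
qed

lemma measurable_if_continuous_U:
  fixes f :: "real \<Rightarrow> complex"
  assumes "continuous_on U f"
  shows "f \<in> borel_measurable (lebesgue_on {0<..})"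
proof -
  have "f \<in> borel_measurable (lebesgue_on U)"
    by (rule continuous_imp_measurable_on_sets_lebesgue [OF assms sets_U])
  then have "(\<lambda>t. if t \<in> U then f t else 0) \<in> borel_measurable lebesgue"
    by (rule borel_measurable_if_I) (rule sets_U)
  then have "(\<lambda>t. if t \<in> {0<..} then f t else 0) \<in> borel_measurable lebesgue"
    by (rule borel_measurable_AE) (use AE_not_node in \<open>eventually_elim, auto simp: U_def\<close>)
  then show ?thesis by (rule borel_measurable_if_D)
qed

lemma sets_P: "{0::real<..} \<in> sets lebesgue"
proof -
  have "open {0::real<..}" by simp
  then show ?thesis by (simp add: borel_open)
qed

lemma sets_P': "{0::real<..} \<inter> space lebesgue \<in> sets lebesgue"
  using sets_P by simp

lemma AE_P_iff:
  fixes Q :: "real \<Rightarrow> bool"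
  shows "(AE t in lebesgue_on {0<..}. Q t) \<longleftrightarrow> (AE t in lebesgue. 0 < t \<longrightarrow> Q t)"
  unfolding AE_restrict_space_iff [OF sets_P'] by simp

lemma AE_P_iff_U: "(AE t in lebesgue_on {0<..}. Q t) \<longleftrightarrow> (AE t in lebesgue_on U. Q t)"
proof -
  have "(AE t in lebesgue. 0 < t \<longrightarrow> Q t) \<longleftrightarrow> (AE t in lebesgue. t \<in> U \<longrightarrow> Q t)"
  proof
    show "AE t in lebesgue. t \<in> U \<longrightarrow> Q t" if "AE t in lebesgue. 0 < t \<longrightarrow> Q t"
      using that by eventually_elim (auto simp: U_def)
    show "AE t in lebesgue. 0 < t \<longrightarrow> Q t" if "AE t in lebesgue. t \<in> U \<longrightarrow> Q t"
      using that AE_not_node by eventually_elim (auto simp: U_def)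
  qed
  then show ?thesis unfolding AE_P_iff using sets_U by (subst AE_restrict_space_iff) auto
qed

lemma l2_AE_cong:
  assumes "f \<in> l2 {0<..}" "u \<in> borel_measurable (lebesgue_on {0<..})"
    "AE t in lebesgue_on {0<..}. f t = u t"
  shows "u \<in> l2 {0<..}"
proof (rule l2_I [OF assms(2)])
  have m: "(\<lambda>t. (cmod (f t))\<^sup>2) \<in> borel_measurable (lebesgue_on {0<..})"
    "(\<lambda>t. (cmod (u t))\<^sup>2) \<in> borel_measurable (lebesgue_on {0<..})"
    using l2_meas [OF assms(1)] assms(2) by measurable
  have "AE t in lebesgue_on {0<..}. (cmod (f t))\<^sup>2 = (cmod (u t))\<^sup>2"
    using assms(3) by eventually_elim simp
  from integrable_cong_AE [OF m this] show "integrable (lebesgue_on {0<..}) (\<lambda>t. (cmod (u t))\<^sup>2)"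
    using l2_int [OF assms(1)] by simp
qed

lemma l2_compact_support:
  assumes m: "f \<in> borel_measurable (lebesgue_on {0<..})"
    and b: "\<And>t. t \<in> {0..T} \<Longrightarrow> cmod (f t) \<le> M" and z: "\<And>t. t > T \<Longrightarrow> f t = 0"
  shows "f \<in> l2 {0<..}"
proof (rule l2_dominated [OF m])
  have "{0<..T} \<in> lmeasurable" by (rule bounded_set_imp_lmeasurable) auto
  then have "integrable lebesgue (indicat_real {0<..T})"
    by (intro integrable_real_indicator) (auto simp: fmeasurable_def)
  then have "integrable lebesgue (\<lambda>t. M\<^sup>2 * indicat_real {0<..T} t)" by simp
  moreover have "(\<lambda>t. indicat_real {0<..} t *\<^sub>R (M\<^sup>2 * indicat_real {0<..T} t)) = (\<lambda>t. M\<^sup>2 * indicat_real {0<..T} t)"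
    by (auto simp: indicator_def fun_eq_iff)
  ultimately show "integrable (lebesgue_on {0<..}) (\<lambda>t. M\<^sup>2 * indicat_real {0<..T} t)"
    unfolding integrable_restrict_space [OF sets_P'] by (simp only:)
  fix t :: real assume "t \<in> {0<..}"
  then show "(cmod (f t))\<^sup>2 \<le> M\<^sup>2 * indicat_real {0<..T} t"
    using b [of t] z [of t] by (cases "t \<le> T") (auto simp: indicator_def intro: power_mono)
qed

lemma integral_compact_support:
  fixes F :: "real \<Rightarrow> complex"
  assumes "integrable (lebesgue_on {0<..}) F" "\<And>t. t > T \<Longrightarrow> F t = 0"
  shows "(LINT t|lebesgue_on {0<..}. F t) = integral {0..T} F"
proof -
  have "(F has_integral (LINT t|lebesgue_on {0<..}. F t)) {0<..}"
    by (rule has_integral_integral_lebesgue_on [OF assms(1)]) simp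
  then have "((\<lambda>t. if t \<in> {0<..} then F t else 0) has_integral (LINT t|lebesgue_on {0<..}. F t)) UNIV"
    by (simp only: has_integral_restrict_UNIV)
  then have "((\<lambda>t. if t \<in> {0..T} then F t else 0) has_integral (LINT t|lebesgue_on {0<..}. F t)) UNIV"
    by (rule has_integral_spike [OF negligible_sing [of 0], rotated]) (use assms(2) in auto)
  then have "(F has_integral (LINT t|lebesgue_on {0<..}. F t)) {0..T}"
    by (simp only: has_integral_restrict_UNIV)
  then show ?thesis by (simp add: integral_unique)
qed

lemma integral_exhaustion:
  fixes F :: "real \<Rightarrow> complex"
  assumes F: "integrable (lebesgue_on {0<..}) F"
  shows "(\<lambda>n. integral {0..x n} F) \<longlonglongrightarrow> (LINT t|lebesgue_on {0<..}. F t)"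
proof -
  let ?F = "\<lambda>n t. if t \<le> x n then F t else 0"
  have [measurable]: "F \<in> borel_measurable (lebesgue_on {0<..})" using F by simp
  have m: "?F n \<in> borel_measurable (lebesgue_on {0<..})" for n
  proof -
    have "indicat_real {..x n} \<in> borel_measurable (lebesgue_on {0<..})"
    proof (rule measurable_restrict_space1)
      have "closed {..x n}" by simp
      then have "{..x n} \<in> sets lebesgue" by (simp add: borel_closed)
      then show "indicat_real {..x n} \<in> borel_measurable lebesgue" by (rule borel_measurable_indicator)
    qed
    then have "(\<lambda>t. indicator {..x n} t *\<^sub>R F t) \<in> borel_measurable (lebesgue_on {0<..})"
      by measurable
    moreover have "(\<lambda>t. indicator {..x n} t *\<^sub>R F t) = ?F n" by (auto simp: indicator_def)
    ultimately show ?thesis by simp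
  qed
  have "(\<lambda>n. LINT t|lebesgue_on {0<..}. ?F n t) \<longlonglongrightarrow> (LINT t|lebesgue_on {0<..}. F t)"
  proof (rule integral_dominated_convergence [where w = "\<lambda>t. norm (F t)"])
    show "AE t in lebesgue_on {0<..}. (\<lambda>n. ?F n t) \<longlonglongrightarrow> F t"
    proof (rule AE_I2)
      fix t
      have "\<forall>\<^sub>F n in sequentially. t \<le> x n" using x_unbounded by (simp add: filterlim_at_top)
      then have "\<forall>\<^sub>F n in sequentially. ?F n t = F t" by eventually_elim simp
      then show "(\<lambda>n. ?F n t) \<longlonglongrightarrow> F t" by (rule tendsto_eventually)
    qed
  qed (use F m in auto)
  moreover have "(LINT t|lebesgue_on {0<..}. ?F n t) = integral {0..x n} F" for n
  proof -
    have "integrable (lebesgue_on {0<..}) (?F n)"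
      by (rule Bochner_Integration.integrable_bound [OF F m]) auto
    from integral_compact_support [OF this, of "x n"]
    have "(LINT t|lebesgue_on {0<..}. ?F n t) = integral {0..x n} (?F n)" by simp
    also have "\<dots> = integral {0..x n} F"
      by (rule Henstock_Kurzweil_Integration.integral_cong) auto
    finally show ?thesis .
  qed
  ultimately show ?thesis by simp
qed

lemma continuous_AE_zero:
  fixes f :: "real \<Rightarrow> complex"
  assumes ab: "a < b" and c: "continuous_on {a..b} f"
    and z: "AE t in lebesgue. t \<in> {a<..<b} \<longrightarrow> f t = 0" and t: "t \<in> {a..b}"
  shows "f t = 0"
proof -
  let ?g = "\<lambda>t. norm (f t)"
  have gc: "continuous_on {a..b} ?g" by (intro continuous_intros c)
  have "AE t in lebesgue. t \<notin> {a, b}"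
    by (rule AE_not_in) (simp add: negligible_iff_null_sets [symmetric])
  with z have ae: "AE t in lebesgue. t \<in> {a..b} \<longrightarrow> ?g t = 0"
    by eventually_elim auto
  obtain N where N: "N \<in> null_sets lebesgue" "\<And>t. t \<in> space lebesgue - N \<Longrightarrow> t \<in> {a..b} \<longrightarrow> ?g t = 0"
    using AE_E3 [OF ae] by blast
  have "integral {a..b} ?g = integral {a..b} (\<lambda>_. 0)"
    by (rule integral_spike [of N]) (use N in \<open>auto simp: negligible_iff_null_sets\<close>)
  then have "integral {a..b} ?g = 0" by simp
  then have "\<forall>t\<in>{a..b}. ?g t = 0"
    using integral_eq_0_iff [OF gc ab] by auto
  then show ?thesis using t by simp
qed

section \<open>The minimal operator and its adjoint\<close>

lemma piecewise_primitive_abs_int: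
  fixes f F :: "real \<Rightarrow> complex"
  assumes f: "loc_int f"
    and F: "\<And>n t. t \<in> {x n..<x (Suc n)} \<Longrightarrow> F t = c n + integral {x n..t} f"
  shows "F absolutely_integrable_on {0..x N}"
proof (induction N)
  case 0
  have "F absolutely_integrable_on cbox 0 0" by (rule absolutely_integrable_on_null) simp
  then show ?case by (simp add: x0)
next
  case (Suc n)
  have "(\<lambda>t. c n + integral {x n..t} f) absolutely_integrable_on {x n..x (Suc n)}"
    by (intro absolutely_integrable_continuous_real continuous_intros continuous_on_indef_integral
        loc_intD [OF f] x_nonneg)
  then have "F absolutely_integrable_on {x n..x (Suc n)}"
    by (rule absolutely_integrable_spike [of _ _ "{x (Suc n)}"]) (use F [of _ n] in auto)
  from absolutely_integrable_on_combine [OF Suc this x_nonneg] show ?case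
    using x_less [of n] by simp
qed

lemma piecewise_primitive_loc_int:
  fixes f F :: "real \<Rightarrow> complex"
  assumes "loc_int f"
    and "\<And>n t. t \<in> {x n..<x (Suc n)} \<Longrightarrow> F t = c n + integral {x n..t} f"
  shows "loc_int F"
  unfolding loc_int_def
proof (intro allI impI)
  fix a b :: real assume "0 \<le> a"
  obtain N where "b < x N" using x_exceeds by blast
  then show "F absolutely_integrable_on {a..b}"
    using \<open>0 \<le> a\<close> by (intro absolutely_integrable_on_subinterval [OF piecewise_primitive_abs_int [OF assms, of N]]) auto
qed

text \<open>
  A test function vanishes at every node, so integrating by parts over the intervals separately
  leaves no boundary terms, whatever the jumps of \<open>F\<close> are.
\<close>

lemma piecewise_primitive_weak_derivative:
  fixes f F :: "real \<Rightarrow> complex"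
  assumes f: "loc_int f"
    and F: "\<And>n t. t \<in> {x n..<x (Suc n)} \<Longrightarrow> F t = c n + integral {x n..t} f"
  shows "weak_derivative U F f"
  unfolding weak_derivative_def
proof
  fix \<phi> assume \<phi>: "\<phi> \<in> test_fun U"
  note sm = test_fun_smooth [OF \<phi>]
  from \<phi> obtain K where K: "compact K" "K \<subseteq> U" "\<And>t. t \<notin> K \<Longrightarrow> \<phi> t = 0"
    by (auto simp: test_fun_def)
  have dz: "deriv \<phi> t = 0" if "t \<notin> K" for t
    by (rule smooth_deriv_outside_support [OF compact_imp_closed [OF K(1)] K(3) that])
  obtain R where R: "\<And>t. t \<in> K \<Longrightarrow> t \<le> R"
    using compact_imp_bounded [OF K(1)] by (auto simp: bounded_iff dest: abs_le_D1)
  obtain N where N: "R < x N" using x_exceeds by blast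
  have out: "t \<notin> K" if "t \<notin> {0..x N} \<or> t \<notin> U" for t
  proof
    assume "t \<in> K"
    then have "t \<le> R" "t \<in> U" "0 < t" using R K(2) by (auto simp: U_def)
    then show False using that N by auto
  qed
  have \<phi>node: "\<phi> (x n) = 0" for n by (rule K(3)) (use K(2) in \<open>auto simp: U_def\<close>)
  have ci: "continuous_on A (\<lambda>t. complex_of_real (\<phi> t))" "continuous_on A (\<lambda>t. complex_of_real (deriv \<phi> t))" for A
    by (intro continuous_on_of_real_smooth smooth_deriv sm)+
  have "((\<lambda>t. f t * of_real (\<phi> t) + F t * of_real (deriv \<phi> t)) has_integral 0) {0..x M}" for M
  proof (induction M)
    case 0
    then show ?case by (simp add: x0 has_integral_refl(2))
  next
    case (Suc n)
    let ?a = "x n" and ?b = "x (Suc n)"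
    let ?G = "\<lambda>t. c n + integral {?a..t} f"
    have fab: "f absolutely_integrable_on {?a..?b}" by (rule loc_intD [OF f x_nonneg])
    have Gc: "continuous_on {?a..?b} ?G" by (intro continuous_intros continuous_on_indef_integral fab)
    have "integral {?a..?b} (\<lambda>t. f t * of_real (\<phi> t)) + integral {?a..?b} (\<lambda>t. ?G t * of_real (deriv \<phi> t))
       = ?G ?b * of_real (\<phi> ?b) - ?G ?a * of_real (\<phi> ?a)"
      by (rule integration_by_parts_L1 [OF less_imp_le [OF x_less] fab vector_derivative_of_real_smooth [OF sm] ci(2)]) simp
    then have z: "integral {?a..?b} (\<lambda>t. f t * of_real (\<phi> t)) + integral {?a..?b} (\<lambda>t. ?G t * of_real (deriv \<phi> t)) = 0"
      by (simp add: \<phi>node)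
    have "(\<lambda>t. of_real (\<phi> t) * f t) integrable_on {?a..?b}"
      by (intro abs_int_integrable abs_int_mult_continuous fab ci)
    then have i1: "(\<lambda>t. f t * of_real (\<phi> t)) integrable_on {?a..?b}" by (simp add: mult.commute)
    have i2: "(\<lambda>t. ?G t * of_real (deriv \<phi> t)) integrable_on {?a..?b}"
      by (intro integrable_continuous_interval continuous_on_mult Gc ci)
    have "((\<lambda>t. f t * of_real (\<phi> t) + ?G t * of_real (deriv \<phi> t)) has_integral 0) {?a..?b}"
      using has_integral_add [OF integrable_integral [OF i1] integrable_integral [OF i2]] z by simp
    then have "((\<lambda>t. f t * of_real (\<phi> t) + F t * of_real (deriv \<phi> t)) has_integral 0) {?a..?b}"
      by (rule has_integral_spike [OF negligible_sing [of ?b], rotated]) (use F [of _ n] in auto)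
    from has_integral_combine [OF x_nonneg less_imp_le [OF x_less] Suc this] show ?case by simp
  qed
  from this [of N] have tot: "((\<lambda>t. f t * of_real (\<phi> t) + F t * of_real (deriv \<phi> t)) has_integral 0) {0..x N}" .
  have a1: "(\<lambda>t. of_real (\<phi> t) * f t) absolutely_integrable_on {0..x N}"
    by (intro abs_int_mult_continuous loc_intD [OF f] ci) simp
  have a2: "(\<lambda>t. of_real (deriv \<phi> t) * F t) absolutely_integrable_on {0..x N}"
    by (intro abs_int_mult_continuous piecewise_primitive_abs_int [OF f F] ci)
  have "(LINT t|lebesgue_on U. of_real (deriv \<phi> t) * F t) = integral {0..x N} (\<lambda>t. of_real (deriv \<phi> t) * F t)"
    by (rule lebesgue_on_eq_integral [OF sets_U a2]) (use dz out in auto)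
  moreover have "(LINT t|lebesgue_on U. of_real (\<phi> t) * f t) = integral {0..x N} (\<lambda>t. of_real (\<phi> t) * f t)"
    by (rule lebesgue_on_eq_integral [OF sets_U a1]) (use K(3) out in auto)
  moreover have "integral {0..x N} (\<lambda>t. of_real (\<phi> t) * f t) + integral {0..x N} (\<lambda>t. of_real (deriv \<phi> t) * F t) = 0"
    using integral_unique [OF tot] integral_add [OF abs_int_integrable [OF a1] abs_int_integrable [OF a2]]
    by (simp add: mult.commute)
  ultimately show "(LINT t|lebesgue_on U. of_real (deriv \<phi> t) * F t) = - (LINT t|lebesgue_on U. of_real (\<phi> t) * f t)"
    by (simp add: add_eq_0_iff)
qed

lemma sol_weak_derivatives:
  assumes s: "sol g u u1" and g: "loc_int g"
  shows "weak_derivative U u u1" "weak_derivative U u1 (\<lambda>t. - g t)"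
proof -
  have mg: "loc_int (\<lambda>t. - g t)" using loc_int_add_scaled [OF loc_int_zero g, of "-1"] by simp
  have u1: "u1 t = u1 (x n) + integral {x n..t} (\<lambda>t. - g t)" if "t \<in> {x n..<x (Suc n)}" for n t
    using sol_u1 [OF s that] by simp
  show "weak_derivative U u1 (\<lambda>t. - g t)"
    by (rule piecewise_primitive_weak_derivative [OF mg u1])
  have "loc_int u1" by (rule piecewise_primitive_loc_int [OF mg u1])
  then show "weak_derivative U u u1"
  proof (rule piecewise_primitive_weak_derivative [where c = "\<lambda>n. u (x n)"])
    fix n t assume t: "t \<in> {x n..<x (Suc n)}"
    have "integral {x n..t} (\<lambda>s. u1 (x n) - integral {x n..s} g) = integral {x n..t} u1"
      by (rule Henstock_Kurzweil_Integration.integral_cong, rule sol_u1 [OF s, symmetric]) (use t in auto)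
    then show "u t = u (x n) + integral {x n..t} u1" using sol_u [OF s, of t n] t by simp
  qed
qed

text \<open>
  The minimal operator in terms of primitives. The definition by weak derivatives is equivalent,
  but only primitives can be integrated by parts on closed intervals.
\<close>

definition core :: l2_graph where
  "core = {(f, g). f \<in> l2 {0<..} \<and> g \<in> l2 {0<..} \<and>
    (\<exists>u u1 N. sol g u u1 \<and> u1 0 = 0 \<and> (\<forall>t\<ge>x N. u t = 0 \<and> u1 t = 0) \<and>
      (AE t in lebesgue_on {0<..}. f t = u t))}"

lemma weak_derivative_AE_cong:
  assumes wd: "weak_derivative U u v" and ae: "AE t in lebesgue_on U. f t = u t"
    and m: "f \<in> borel_measurable (lebesgue_on U)" "u \<in> borel_measurable (lebesgue_on U)"
  shows "weak_derivative U f v"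
  unfolding weak_derivative_def
proof
  fix \<phi> assume \<phi>: "\<phi> \<in> test_fun U"
  have [measurable]: "(\<lambda>t. complex_of_real (deriv \<phi> t)) \<in> borel_measurable (lebesgue_on U)"
    by (intro continuous_imp_measurable_on_sets_lebesgue continuous_on_of_real_smooth smooth_deriv
        test_fun_smooth [OF \<phi>] sets_U)
  note [measurable] = m
  have "(LINT t|lebesgue_on U. of_real (deriv \<phi> t) * f t) = (LINT t|lebesgue_on U. of_real (deriv \<phi> t) * u t)"
  proof (rule integral_cong_AE)
    show "AE t in lebesgue_on U. of_real (deriv \<phi> t) * f t = of_real (deriv \<phi> t) * u t"
      using ae by eventually_elim simp
  qed measurable
  then show "(LINT t|lebesgue_on U. of_real (deriv \<phi> t) * f t) = - (LINT t|lebesgue_on U. of_real (\<phi> t) * v t)"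
    using wd \<phi> by (simp add: weak_derivative_def)
qed

lemma core_subset_hamiltonian0: "core \<subseteq> hamiltonian0 x \<alpha>"
proof
  fix p assume "p \<in> core"
  then obtain f g u u1 N where p: "p = (f, g)" and f: "f \<in> l2 {0<..}" and g: "g \<in> l2 {0<..}"
    and s12: "sol g u u1" "u1 0 = 0" and s34: "\<forall>t\<ge>x N. u t = 0 \<and> u1 t = 0"
    and ae: "AE t in lebesgue_on {0<..}. f t = u t"
    unfolding core_def by blast
  have s: "sol g u u1" "u1 0 = 0" "\<And>t. t \<ge> x N \<Longrightarrow> u t = 0" "\<And>t. t \<ge> x N \<Longrightarrow> u1 t = 0"
    using s12 s34 by auto
  have lg: "loc_int g" by (rule l2_loc_int [OF g])
  note c = sol_continuous_U [OF s(1) lg]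
  have UP: "U \<subseteq> {0<..}" by (auto simp: U_def)
  have r: "h \<in> l2 U" if "h \<in> l2 {0<..}" for h
    by (rule l2_restrict [OF that UP]) (simp_all add: sets_U)
  obtain M where M: "\<And>t. t \<in> {0..x N} \<Longrightarrow> cmod (u t) \<le> M \<and> cmod (u1 t) \<le> M"
    using sol_bounded [OF s(1) lg] by blast
  have u1: "u1 \<in> l2 {0<..}"
    by (rule l2_compact_support [OF measurable_if_continuous_U [OF c(2)], of "x N" M]) (use M s(4) in auto)
  note wd = sol_weak_derivatives [OF s(1) lg]
  have um: "u \<in> borel_measurable (lebesgue_on U)"
    by (rule measurable_restrict_mono [OF measurable_if_continuous_U [OF c(1)] UP])
  have aeU: "AE t in lebesgue_on U. f t = u t" using ae by (simp add: AE_P_iff_U)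
  have "f \<in> sobolev22 U"
    unfolding sobolev22_def
    using weak_derivative_AE_cong [OF wd(1) aeU l2_meas [OF r [OF f]] um] wd(2) r [OF f] r [OF u1] l2_uminus [OF r [OF g]]
    by blast
  moreover have "AE t in lebesgue_on {0<..}. t > x N \<longrightarrow> f t = 0"
    using ae by eventually_elim (use s(3) in auto)
  moreover have "interface_conditions x \<alpha> u u1"
    unfolding interface_conditions_def
  proof (intro conjI allI impI)
    show "(u1 \<longlongrightarrow> 0) (at_right 0)" using sol_limits(2) [OF s(1) lg, of 0] s(2) by (simp add: x0)
    fix n :: nat assume "1 \<le> n"
    then obtain m where n: "n = Suc m" by (cases n) auto
    show "\<exists>c a b. (u \<longlongrightarrow> c) (at_left (x n)) \<and> (u \<longlongrightarrow> c) (at_right (x n)) \<and>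
      (u1 \<longlongrightarrow> a) (at_left (x n)) \<and> (u1 \<longlongrightarrow> b) (at_right (x n)) \<and> b - a = of_real (\<alpha> n) * c"
      unfolding n
      by (rule exI [of _ "u (x (Suc m))"], rule exI [of _ "u1 (x m) - integral {x m..x (Suc m)} g"],
          rule exI [of _ "u1 (x (Suc m))"], intro conjI sol_limits [OF s(1) lg])
         (simp add: sol_jump [OF s(1), of m])
  qed
  ultimately show "p \<in> hamiltonian0 x \<alpha>"
    unfolding hamiltonian0_def Let_def p U_def [symmetric]
    using f g ae c wd by blast
qed

text \<open>
  On each interval the continuous representatives are primitives, hence have limits at both ends.
  The interface conditions match these limits at the nodes. A representative that vanishes almost
  everywhere beyond some point vanishes there identically.
\<close>

lemma hamiltonian0_subset_core: "hamiltonian0 x \<alpha> \<subseteq> core"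
proof
  fix p assume "p \<in> hamiltonian0 x \<alpha>"
  then obtain f g u u1 R where p: "p = (f, g)" and f: "f \<in> l2 {0<..}" and g: "g \<in> l2 {0<..}"
    and R: "AE t in lebesgue_on {0<..}. t > R \<longrightarrow> f t = 0"
    and cu: "continuous_on U u" and cu1: "continuous_on U u1"
    and ae: "AE t in lebesgue_on {0<..}. f t = u t"
    and wd: "weak_derivative U u u1" "weak_derivative U u1 (\<lambda>t. - g t)"
    and ic: "interface_conditions x \<alpha> u u1"
    by (auto simp: hamiltonian0_def Let_def U_def [symmetric])
  have lg: "loc_int g" by (rule l2_loc_int [OF g])
  have mg: "loc_int (\<lambda>t. - g t)" using loc_int_add_scaled [OF loc_int_zero lg, of "-1"] by simp
  have ic0: "(u1 \<longlongrightarrow> 0) (at_right 0)" using ic by (simp add: interface_conditions_def)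
  have "\<forall>n\<in>{1..}. \<exists>c a b. (u \<longlongrightarrow> c) (at_left (x n)) \<and> (u \<longlongrightarrow> c) (at_right (x n)) \<and>
      (u1 \<longlongrightarrow> a) (at_left (x n)) \<and> (u1 \<longlongrightarrow> b) (at_right (x n)) \<and> b - a = of_real (\<alpha> n) * c"
    using ic by (auto simp: interface_conditions_def)
  then obtain cc aa bb where icn: "\<And>n. n \<ge> 1 \<Longrightarrow> (u \<longlongrightarrow> cc n) (at_left (x n))"
    "\<And>n. n \<ge> 1 \<Longrightarrow> (u \<longlongrightarrow> cc n) (at_right (x n))" "\<And>n. n \<ge> 1 \<Longrightarrow> (u1 \<longlongrightarrow> aa n) (at_left (x n))"
    "\<And>n. n \<ge> 1 \<Longrightarrow> (u1 \<longlongrightarrow> bb n) (at_right (x n))" "\<And>n. n \<ge> 1 \<Longrightarrow> bb n - aa n = of_real (\<alpha> n) * cc n"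
    unfolding bchoice_iff by (auto simp: Ball_def)
  define b where "b n = (if n = 0 then 0 else bb n)" for n
  have br: "(u1 \<longlongrightarrow> b n) (at_right (x n))" for n
    using ic0 icn(4) [of n] by (simp add: b_def x0)
  have piece: "\<exists>c. \<forall>t\<in>{x n<..<x (Suc n)}. u1 t = b n - integral {x n..t} g \<and>
      u t = c + integral {x n..t} (\<lambda>s. b n - integral {x n..s} g)" for n
  proof -
    let ?L = "\<lambda>t. b n - integral {x n..t} g"
    have cn: "continuous_on {x n<..<x (Suc n)} u" "continuous_on {x n<..<x (Suc n)} u1"
      using continuous_on_subset [OF cu interior_subset_U] continuous_on_subset [OF cu1 interior_subset_U] by auto
    have Lc: "continuous_on {x n..x (Suc n)} ?L" by (rule slope_continuous [OF lg])
    have split: "integral {x n..t} h = integral {x n..s} h + integral {s..t} h"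
      if "x n \<le> s" "s \<le> t" "h integrable_on {x n..t}" for s t and h :: "real \<Rightarrow> complex"
      using Henstock_Kurzweil_Integration.integral_combine [OF that] by simp
    have gi: "g integrable_on {x n..t}" for t by (rule abs_int_integrable [OF loc_intD [OF lg x_nonneg]])
    have e1: "u1 t + integral {x n..t} g = u1 s + integral {x n..s} g"
      if "x n < s" "s \<le> t" "t < x (Suc n)" for s t
    proof -
      have "u1 t - u1 s = integral {s..t} (\<lambda>t. - g t)"
        by (rule weak_derivative_imp_primitive [OF wd(2) interior_subset_U sets_U cn(2) _ that])
          (use loc_intD [OF mg] x_nonneg [of n] in auto)
      then show ?thesis using split [OF less_imp_le [OF that(1)] that(2) gi] by (simp add: algebra_simps)
    qed
    have u1eq: "u1 t = ?L t" if t: "t \<in> {x n<..<x (Suc n)}" for t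
    proof -
      have ev: "\<forall>\<^sub>F s in at_right (x n). u1 s + integral {x n..s} g = u1 t + integral {x n..t} g"
        using eventually_at_right_real [of "x n" t] t by (auto elim!: eventually_mono intro: e1 [symmetric])
      have "((\<lambda>s. integral {x n..s} g) \<longlongrightarrow> integral {x n..x n} g) (at_right (x n))"
        by (rule continuous_on_Icc_at_rightD [OF continuous_on_indef_integral [OF loc_intD [OF lg x_nonneg]] x_less])
      from tendsto_add [OF br this]
      have "((\<lambda>s. u1 s + integral {x n..s} g) \<longlongrightarrow> b n) (at_right (x n))" by simp
      from Lim_transform_eventually [OF this ev]
      have "((\<lambda>s. u1 t + integral {x n..t} g) \<longlongrightarrow> b n) (at_right (x n))" .
      then have "u1 t + integral {x n..t} g = b n" by (simp add: tendsto_const_iff)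
      then show ?thesis by (simp add: algebra_simps)
    qed
    have Li: "?L integrable_on {x n..t}" if "t \<le> x (Suc n)" for t
      by (rule integrable_continuous_interval, rule continuous_on_subset [OF Lc]) (use that in auto)
    have e2: "u t - integral {x n..t} ?L = u s - integral {x n..s} ?L"
      if "x n < s" "s \<le> t" "t < x (Suc n)" for s t
    proof -
      have "u t - u s = integral {s..t} u1"
      proof (rule weak_derivative_imp_primitive [OF wd(1) interior_subset_U sets_U cn(1) _ that])
        fix c d assume "x n < c" "d < x (Suc n)"
        then show "u1 absolutely_integrable_on {c..d}"
          by (intro absolutely_integrable_continuous_real continuous_on_subset [OF cn(2)]) auto
      qed
      also have "\<dots> = integral {s..t} ?L"
        by (rule Henstock_Kurzweil_Integration.integral_cong) (use u1eq that in auto)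
      finally show ?thesis using split [OF less_imp_le [OF that(1)] that(2) Li] that by (simp add: algebra_simps)
    qed
    define m where "m = (x n + x (Suc n)) / 2"
    have m: "x n < m" "m < x (Suc n)" using x_less [of n] by (auto simp: m_def)
    have "u t - integral {x n..t} ?L = u m - integral {x n..m} ?L" if "t \<in> {x n<..<x (Suc n)}" for t
      using e2 [of m t] e2 [of t m] that m by (cases "m \<le> t") auto
    then have "u t = (u m - integral {x n..m} ?L) + integral {x n..t} ?L" if "t \<in> {x n<..<x (Suc n)}" for t
      using that by (metis diff_add_cancel)
    then show ?thesis using u1eq by blast
  qed
  then obtain C where C1: "\<And>n t. t \<in> {x n<..<x (Suc n)} \<Longrightarrow> u1 t = b n - integral {x n..t} g"
    and C2: "\<And>n t. t \<in> {x n<..<x (Suc n)} \<Longrightarrow> u t = C n + integral {x n..t} (\<lambda>s. b n - integral {x n..s} g)"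
    by metis
  let ?L = "\<lambda>n t. b n - integral {x n..t} g"
  have Lc: "continuous_on {x n..x (Suc n)} (?L n)" for n by (rule slope_continuous [OF lg])
  have ILc: "continuous_on {x n..x (Suc n)} (\<lambda>t. C n + integral {x n..t} (?L n))" for n
    by (intro continuous_intros indefinite_integral_continuous_1 integrable_continuous_interval Lc)
  have evr: "\<forall>\<^sub>F t in at_right (x n). t \<in> {x n<..<x (Suc n)}" for n
    using eventually_at_right_real [OF x_less [of n]] .
  have evl: "\<forall>\<^sub>F t in at_left (x (Suc n)). t \<in> {x n<..<x (Suc n)}" for n
    using eventually_at_left_real [OF x_less [of n]] .
  have ur: "(u \<longlongrightarrow> C n) (at_right (x n))" for n
  proof -
    have "((\<lambda>t. C n + integral {x n..t} (?L n)) \<longlongrightarrow> C n) (at_right (x n))"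
      using continuous_on_Icc_at_rightD [OF ILc x_less, of n] by simp
    moreover have "\<forall>\<^sub>F t in at_right (x n). C n + integral {x n..t} (?L n) = u t"
      using evr [of n] by (auto elim!: eventually_mono simp: C2)
    ultimately show ?thesis by (rule Lim_transform_eventually)
  qed
  have ul: "(u \<longlongrightarrow> C n + integral {x n..x (Suc n)} (?L n)) (at_left (x (Suc n)))" for n
  proof -
    have "\<forall>\<^sub>F t in at_left (x (Suc n)). C n + integral {x n..t} (?L n) = u t"
      using evl [of n] by (auto elim!: eventually_mono simp: C2)
    with continuous_on_Icc_at_leftD [OF ILc x_less] show ?thesis by (rule Lim_transform_eventually)
  qed
  have u1l: "(u1 \<longlongrightarrow> ?L n (x (Suc n))) (at_left (x (Suc n)))" for n
  proof -
    have "\<forall>\<^sub>F t in at_left (x (Suc n)). ?L n t = u1 t"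
      using evl [of n] by (auto elim!: eventually_mono simp: C1)
    with continuous_on_Icc_at_leftD [OF Lc x_less] show ?thesis by (rule Lim_transform_eventually)
  qed
  have Cc: "C (Suc n) = cc (Suc n)" for n
    by (rule tendsto_unique [OF _ ur icn(2)]) auto
  have CS: "C (Suc n) = C n + integral {x n..x (Suc n)} (?L n)" for n
    unfolding Cc by (rule tendsto_unique [OF _ icn(1) ul]) auto
  have aS: "aa (Suc n) = ?L n (x (Suc n))" for n
    by (rule tendsto_unique [OF _ icn(3) u1l]) auto
  have bS: "b (Suc n) = ?L n (x (Suc n)) + of_real (\<alpha> (Suc n)) * C (Suc n)" for n
    using icn(5) [of "Suc n"] by (simp add: b_def aS Cc algebra_simps)
  \<comment> \<open>The given representatives are arbitrary at the nodes, so they are redefined there.\<close>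
  define w where "w t = (if t \<in> range x then C (inv x t) else u t)" for t
  define w1 where "w1 t = (if t \<in> range x then b (inv x t) else u1 t)" for t
  have inj: "inj x" using x_mono by (rule strict_mono_imp_inj_on)
  have wx: "w (x n) = C n" "w1 (x n) = b n" for n by (simp_all add: w_def w1_def inj)
  have wi: "w t = u t" "w1 t = u1 t" if "t \<in> U" for t using that by (auto simp: w_def w1_def U_def)
  have s: "sol g w w1"
    unfolding sol_def wx
  proof (intro allI conjI ballI)
    fix n
    have int: "t = x n \<or> t = x (Suc n) \<or> (t \<in> {x n<..<x (Suc n)} \<and> t \<in> U)" if "t \<in> {x n..x (Suc n)}" for t
      using that interior_subset_U [of n] by force
    show "w1 t = b n - integral {x n..t} g" if "t \<in> {x n..<x (Suc n)}" for t
      using int [of t] that wi(2) [of t] C1 [of t n] by (auto simp: wx)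
    show "b (Suc n) = b n - integral {x n..x (Suc n)} g + of_real (\<alpha> (Suc n)) * C (Suc n)"
      by (rule bS)
    fix t assume t: "t \<in> {x n..x (Suc n)}"
    show "w t = C n + integral {x n..t} (?L n)"
      using int [OF t] wi(1) [of t] C2 [of t n] CS [of n] by (auto simp: wx)
  qed
  have aew: "AE t in lebesgue_on {0<..}. f t = w t"
    using ae unfolding AE_P_iff_U
    by (rule AE_mp) (use wi in \<open>auto intro!: AE_I2\<close>)
  obtain N where N: "max R 0 < x N" using x_exceeds by blast
  have zero: "w t = 0 \<and> w1 t = 0" if tN: "t \<ge> x N" for t
  proof -
    obtain n where n: "x n \<le> t" "t < x (Suc n)" using interval_exists [of t] tN N by auto
    have "N \<le> n"
    proof (rule ccontr)
      assume "\<not> N \<le> n"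
      then have "x (Suc n) \<le> x N" using x_mono by (simp add: strict_mono_less_eq)
      then show False using n tN by simp
    qed
    then have xn: "x N \<le> x n" using x_mono by (simp add: strict_mono_less_eq)
    have w0: "w r = 0" if "r \<in> {x n..x (Suc n)}" for r
    proof (rule continuous_AE_zero [OF x_less sol_continuous [OF s lg] _ that])
      have "AE t in lebesgue_on {0<..}. t > R \<longrightarrow> w t = 0"
        using R aew by eventually_elim auto
      then show "AE t in lebesgue. t \<in> {x n<..<x (Suc n)} \<longrightarrow> w t = 0"
        unfolding AE_P_iff by eventually_elim (use xn N in auto)
    qed
    have t': "t \<in> {x n..x (Suc n)}" using n by auto
    have "w1 t = 0"
      using sol_zero_on_interval [OF s lg w0 t'] sol_u1 [OF s, of t n] n by simp
    then show ?thesis using w0 t' by simp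
  qed
  have "w1 0 = 0" using wx(2) [of 0] by (simp add: x0 b_def)
  then show "p \<in> core"
    unfolding core_def p using f g s zero aew by blast
qed

lemma hamiltonian0_eq_core: "hamiltonian0 x \<alpha> = core"
  using core_subset_hamiltonian0 hamiltonian0_subset_core by (rule subset_antisym [rotated])

lemma core_subset_l2: "core \<subseteq> l2 {0<..} \<times> l2 {0<..}"
  by (auto simp: core_def)

lemma core_zero: "((\<lambda>t. 0), (\<lambda>t. 0)) \<in> core"
proof -
  have "sol (\<lambda>t. 0) (\<lambda>t. 0) (\<lambda>t. 0)" by (simp add: sol_def)
  then show ?thesis unfolding core_def using l2_zero by fastforce
qed

lemma core_linear:
  assumes "(f, g) \<in> core" "(f', g') \<in> core"
  shows "((\<lambda>t. f t + c * f' t), (\<lambda>t. g t + c * g' t)) \<in> core"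
proof -
  obtain u u1 N where u: "f \<in> l2 {0<..}" "g \<in> l2 {0<..}" "sol g u u1" "u1 0 = 0"
    "\<forall>t\<ge>x N. u t = 0 \<and> u1 t = 0" "AE t in lebesgue_on {0<..}. f t = u t"
    using assms(1) unfolding core_def by blast
  obtain w w1 M where w: "f' \<in> l2 {0<..}" "g' \<in> l2 {0<..}" "sol g' w w1" "w1 0 = 0"
    "\<forall>t\<ge>x M. w t = 0 \<and> w1 t = 0" "AE t in lebesgue_on {0<..}. f' t = w t"
    using assms(2) unfolding core_def by blast
  have "sol (\<lambda>t. g t + c * g' t) (\<lambda>t. u t + c * w t) (\<lambda>t. u1 t + c * w1 t)"
    using u w by (intro sol_add_scaled l2_loc_int)
  moreover have "\<forall>t\<ge>x (max N M). u t + c * w t = 0 \<and> u1 t + c * w1 t = 0"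
  proof (intro allI impI)
    fix t assume t: "t \<ge> x (max N M)"
    have "x N \<le> x (max N M)" "x M \<le> x (max N M)" using x_mono by (simp_all add: strict_mono_less_eq)
    then have "x N \<le> t" "x M \<le> t" using t by linarith+
    then show "u t + c * w t = 0 \<and> u1 t + c * w1 t = 0" using u(5) w(5) by simp
  qed
  moreover have "AE t in lebesgue_on {0<..}. f t + c * f' t = u t + c * w t"
    using u(6) w(6) by eventually_elim simp
  moreover have "(\<lambda>t. f t + c * f' t) \<in> l2 {0<..}" "(\<lambda>t. g t + c * g' t) \<in> l2 {0<..}"
    using u w by (intro l2_add l2_cmult; simp)+
  moreover have "u1 0 + c * w1 0 = 0" using u(4) w(4) by simp
  ultimately show ?thesis
    unfolding core_def mem_Collect_eq case_prod_conv by blast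
qed

lemma sol_measurable:
  assumes "sol g u u1" "loc_int g"
  shows "u \<in> borel_measurable (lebesgue_on {0<..})"
  by (rule measurable_if_continuous_U [OF sol_continuous_U(1) [OF assms]])

text \<open>
  Forward uniqueness: zero data at a node propagate from interval to interval.
\<close>

lemma sol_vanishes:
  assumes s: "sol g u u1" and z: "u (x N) = 0" "u1 (x N) = 0" and g: "\<And>t. t \<ge> x N \<Longrightarrow> g t = 0"
    and t: "t \<ge> x N"
  shows "u t = 0 \<and> u1 t = 0"
proof -
  have xm: "x N \<le> x n" if "N \<le> n" for n using that x_mono by (simp add: strict_mono_less_eq)
  have gi: "integral {x n..t} g = 0" if "N \<le> n" for n t
  proof -
    have "integral {x n..t} g = integral {x n..t} (\<lambda>_. 0)"
      by (rule Henstock_Kurzweil_Integration.integral_cong) (use g xm [OF that] in auto)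
    then show ?thesis by simp
  qed
  have piece: "u t = u (x n) + integral {x n..t} (\<lambda>s. u1 (x n))" if "N \<le> n" "t \<in> {x n..x (Suc n)}" for n t
    using sol_u [OF s that(2)] gi [OF that(1)] by simp
  have nodes: "u (x n) = 0 \<and> u1 (x n) = 0" if "N \<le> n" for n
    using that
  proof (induction n rule: dec_induct)
    case base
    then show ?case using z by simp
  next
    case (step n)
    have "u (x (Suc n)) = 0"
      using piece [OF step(1), of "x (Suc n)"] step x_less [of n] by simp
    then show ?case using sol_jump [OF s, of n] step gi by simp
  qed
  have "0 \<le> t" using t x_nonneg [of N] by linarith
  then obtain n where n: "x n \<le> t" "t < x (Suc n)" using interval_exists by blast
  have "N \<le> n"
  proof (rule ccontr)
    assume "\<not> N \<le> n"
    then have "x (Suc n) \<le> x N" using x_mono by (simp add: strict_mono_less_eq)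
    then show False using n t by simp
  qed
  then show ?thesis
    using piece [of n t] nodes [of n] n sol_u1 [OF s, of t n] gi [of n t] by simp
qed

lemma measurable_cut:
  fixes f :: "real \<Rightarrow> complex"
  assumes "f \<in> borel_measurable (lebesgue_on S)"
  shows "(\<lambda>t. if t < T then f t else 0) \<in> borel_measurable (lebesgue_on S)"
proof -
  have "open {..<T}" by simp
  then have "{..<T} \<in> sets lebesgue" by (simp add: borel_open)
  then have "indicat_real {..<T} \<in> borel_measurable (lebesgue_on S)"
    by (intro measurable_restrict_space1 borel_measurable_indicator)
  then have "(\<lambda>t. indicat_real {..<T} t *\<^sub>R f t) \<in> borel_measurable (lebesgue_on S)"
    using assms by measurable
  moreover have "(\<lambda>t. indicat_real {..<T} t *\<^sub>R f t) = (\<lambda>t. if t < T then f t else 0)"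
    by (auto simp: indicator_def)
  ultimately show ?thesis by simp
qed

lemma l2_cut:
  assumes "f \<in> borel_measurable (lebesgue_on {0<..})" "\<And>t. t \<in> {0..T} \<Longrightarrow> cmod (f t) \<le> M"
  shows "(\<lambda>t. if t < T then f t else 0) \<in> l2 {0<..}"
  by (rule l2_compact_support [where T = T and M = "max M 0", OF measurable_cut [OF assms(1)]])
     (use assms(2) in \<open>auto intro: le_max_iff_disj [THEN iffD2]\<close>)

lemma l2_cut_l2:
  assumes "f \<in> l2 {0<..}"
  shows "(\<lambda>t. if t < T then f t else 0) \<in> l2 {0<..}"
  by (rule l2_dominated [OF measurable_cut [OF l2_meas [OF assms]] l2_int [OF assms]]) auto

text \<open>
  Let \<open>\<phi>\<close> solve the homogeneous equation with $\phi(0)=1$, $\phi'(0)=0$. By the Wronskian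
  identity a square-integrable \<open>k\<close> supported in $[0,x_N]$ belongs to the range of the
  minimal operator as soon as $\int k \phi = 0$: the solution of $-F''=k$ starting with zero
  data arrives at $x_N$ with data proportional to those of \<open>\<phi>\<close>, and subtracting the right
  multiple of \<open>\<phi>\<close> makes it vanish from there on.
\<close>

lemma range_core:
  assumes k: "k \<in> l2 {0<..}" "\<And>t. t \<ge> x N \<Longrightarrow> k t = 0"
    and \<phi>: "sol (\<lambda>t. 0) \<phi> \<phi>1" "\<phi> 0 = 1" "\<phi>1 0 = 0"
    and orth: "integral {0..x N} (\<lambda>t. k t * \<phi> t) = 0"
  obtains f f1 where "sol k f f1" "f1 0 = 0" "\<And>t. t \<ge> x N \<Longrightarrow> f t = 0 \<and> f1 t = 0" "(f, k) \<in> core"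
proof -
  have lk: "loc_int k" by (rule l2_loc_int [OF k(1)])
  obtain F F1 where F: "sol k F F1" "F 0 = 0" "F1 0 = 0" using sol_exists by blast
  obtain \<psi> \<psi>1 where \<psi>: "sol (\<lambda>t. 0) \<psi> \<psi>1" "\<psi> 0 = 0" "\<psi>1 0 = 1" using sol_exists by blast
  have "((\<lambda>t. 0) has_integral (\<phi> (x N) * \<psi>1 (x N) - \<phi>1 (x N) * \<psi> (x N)) - 1) {0..x N}"
    using green [OF \<phi>(1) \<psi>(1) loc_int_zero loc_int_zero, of N] \<phi> \<psi> by simp
  then have wr: "\<phi> (x N) * \<psi>1 (x N) - \<phi>1 (x N) * \<psi> (x N) = 1"
    using has_integral_unique [OF _ has_integral_0] by fastforce
  have "((\<lambda>t. k t * \<phi> t) has_integral F (x N) * \<phi>1 (x N) - F1 (x N) * \<phi> (x N)) {0..x N}"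
    using green [OF F(1) \<phi>(1) lk loc_int_zero, of N] F by simp
  then have prp: "F (x N) * \<phi>1 (x N) = F1 (x N) * \<phi> (x N)"
    using orth by (simp add: integral_unique)
  have "\<exists>a. F (x N) = a * \<phi> (x N) \<and> F1 (x N) = a * \<phi>1 (x N)"
  proof (cases "\<phi> (x N) = 0")
    case True
    then have "\<phi>1 (x N) \<noteq> 0" using wr by auto
    then show ?thesis using True prp by (intro exI [of _ "F1 (x N) / \<phi>1 (x N)"]) auto
  next
    case False
    then show ?thesis using prp by (intro exI [of _ "F (x N) / \<phi> (x N)"]) (auto simp: field_simps)
  qed
  then obtain a where a: "F (x N) = a * \<phi> (x N)" "F1 (x N) = a * \<phi>1 (x N)" by blast
  define f where "f t = F t + (- a) * \<phi> t" for t
  define f1 where "f1 t = F1 t + (- a) * \<phi>1 t" for t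
  have s: "sol k f f1"
    using sol_add_scaled [OF F(1) \<phi>(1) lk loc_int_zero, of "- a"] by (simp add: f_def [abs_def] f1_def [abs_def])
  have f10: "f1 0 = 0" using F \<phi> by (simp add: f1_def)
  have z: "f t = 0 \<and> f1 t = 0" if "t \<ge> x N" for t
    by (rule sol_vanishes [OF s _ _ k(2) that]) (simp_all add: f_def f1_def a)
  obtain M where M: "\<And>t. t \<in> {0..x N} \<Longrightarrow> cmod (f t) \<le> M \<and> cmod (f1 t) \<le> M"
    using sol_bounded [OF s lk] by blast
  have "f \<in> l2 {0<..}"
    by (rule l2_compact_support [OF sol_measurable [OF s lk], of "x N" M]) (use M z in auto)
  then have "(f, k) \<in> core" unfolding core_def using k(1) s f10 z by blast
  then show ?thesis using that s f10 z by blast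
qed

text \<open>
  Let \<open>w\<close> solve $-w'' = q$ with zero data at the origin. By Green's identity $p - w$ is
  orthogonal on $[0,x_N]$ to everything that \<open>range_core\<close> puts into the range, hence to all
  \<open>k\<close> with $\int k \phi = 0$. So $p - w$ is a multiple of the conjugate of the homogeneous
  solution \<open>\<phi>\<close>, and regularity, interface conditions and the boundary condition at the
  origin are obtained at once.
\<close>

lemma adjoint_regular:
  assumes adj: "(p, q) \<in> graph_adjoint {0<..} core"
  obtains u u1 where "sol q u u1" "u1 0 = 0" "u \<in> l2 {0<..}" "AE t in lebesgue_on {0<..}. p t = u t"
proof -
  let ?P = "{0::real<..}"
  have p: "p \<in> l2 ?P" and q: "q \<in> l2 ?P"
    and pq: "\<And>f g. (f, g) \<in> core \<Longrightarrow> l2_inner ?P g p = l2_inner ?P f q"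
    using adj by (auto simp: graph_adjoint_def)
  have lq: "loc_int q" by (rule l2_loc_int [OF q])
  obtain w w1 where w: "sol q w w1" "w 0 = 0" "w1 0 = 0" using sol_exists by blast
  obtain \<phi> \<phi>1 where \<phi>: "sol (\<lambda>t. 0) \<phi> \<phi>1" "\<phi> 0 = 1" "\<phi>1 0 = 0" using sol_exists by blast
  have \<phi>c: "sol (\<lambda>t. 0) (\<lambda>t. cnj (\<phi> t)) (\<lambda>t. cnj (\<phi>1 t))" using sol_cnj [OF \<phi>(1)] by simp
  have \<phi>eq1: "\<phi> t = 1" if "t \<in> {0..x 1}" for t
    using sol_u [OF \<phi>(1), of t 0] that \<phi> by (simp add: x0)
  have mw: "w \<in> borel_measurable (lebesgue_on ?P)" by (rule sol_measurable [OF w(1) lq])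
  have m\<phi>: "(\<lambda>t. cnj (\<phi> t)) \<in> borel_measurable (lebesgue_on ?P)" by (rule sol_measurable [OF \<phi>c loc_int_zero])
  have "\<exists>c. AE t in lebesgue. 0 < t \<and> t < x N \<longrightarrow> p t = w t + c * cnj (\<phi> t)" if N: "N \<ge> 1" for N
  proof -
    define cut where "cut f t = (if t < x N then f t else 0)" for f :: "real \<Rightarrow> complex" and t
    have xN: "x 1 \<le> x N" using N x_mono by (simp add: strict_mono_less_eq)
    have x1: "0 < x 1" using x_less [of 0] by (simp add: x0)
    obtain Mw where Mw: "\<And>t. t \<in> {0..x N} \<Longrightarrow> cmod (w t) \<le> Mw"
      using sol_bounded [OF w(1) lq, of N] by blast
    obtain M\<phi> where M\<phi>: "\<And>t. t \<in> {0..x N} \<Longrightarrow> cmod (cnj (\<phi> t)) \<le> M\<phi>"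
      using sol_bounded [OF \<phi>c loc_int_zero, of N] by blast
    have cw: "cut w \<in> l2 ?P" unfolding cut_def [abs_def] by (rule l2_cut [OF mw Mw])
    have c\<phi>: "cut (\<lambda>t. cnj (\<phi> t)) \<in> l2 ?P" unfolding cut_def [abs_def] by (rule l2_cut [OF m\<phi> M\<phi>])
    have cp: "cut p \<in> l2 ?P" unfolding cut_def [abs_def] by (rule l2_cut_l2 [OF p])
    define h where "h t = cut p t - cut w t" for t
    have h: "h \<in> l2 ?P" unfolding h_def by (rule l2_diff [OF cp cw])
    let ?\<phi> = "cut (\<lambda>t. cnj (\<phi> t))"
    define c where "c = l2_inner ?P h ?\<phi> / l2_inner ?P ?\<phi> ?\<phi>"
    define k where "k t = h t - c * ?\<phi> t" for t
    have k: "k \<in> l2 ?P" unfolding k_def by (rule l2_diff [OF h l2_cmult [OF c\<phi>]])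
    have k0: "k t = 0" if "t \<ge> x N" for t using that by (simp add: k_def h_def cut_def)
    have nz: "l2_inner ?P ?\<phi> ?\<phi> \<noteq> 0"
    proof
      assume "l2_inner ?P ?\<phi> ?\<phi> = 0"
      then have "l2_norm ?P ?\<phi> = 0" by (simp add: l2_inner_self)
      from l2_norm_eq_0_AE [OF c\<phi> this] have "AE t in lebesgue. 0 < t \<longrightarrow> ?\<phi> t = 0" by (simp add: AE_P_iff)
      then have "AE t in lebesgue. t \<in> {0<..<x 1} \<longrightarrow> (1::complex) = 0"
      proof eventually_elim
        case (elim t)
        then show ?case using \<phi>eq1 [of t] xN by (auto simp: cut_def)
      qed
      from continuous_AE_zero [OF x1 continuous_on_const this, of 0] x1 show False by simp
    qed
    have orth: "l2_inner ?P k ?\<phi> = 0"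
    proof -
      have "l2_inner ?P k ?\<phi> = l2_inner ?P h ?\<phi> - l2_inner ?P (\<lambda>t. c * ?\<phi> t) ?\<phi>"
        unfolding k_def by (rule l2_inner_diff_left [OF h l2_cmult [OF c\<phi>] c\<phi>])
      also have "l2_inner ?P (\<lambda>t. c * ?\<phi> t) ?\<phi> = c * l2_inner ?P ?\<phi> ?\<phi>"
        by (simp add: l2_inner_def mult.assoc)
      finally show ?thesis using nz by (simp add: c_def)
    qed
    have cutint: "l2_inner ?P k (cut v) = integral {0..x N} (\<lambda>t. k t * cnj (v t))" if "cut v \<in> l2 ?P" for v
    proof -
      have "l2_inner ?P k (cut v) = integral {0..x N} (\<lambda>t. k t * cnj (cut v t))"
        unfolding l2_inner_def
        by (rule integral_compact_support [OF l2_inner_integrable [OF k that]]) (simp add: k0)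
      also have "\<dots> = integral {0..x N} (\<lambda>t. k t * cnj (v t))"
        by (rule Henstock_Kurzweil_Integration.integral_cong) (auto simp: cut_def k0)
      finally show ?thesis .
    qed
    have "integral {0..x N} (\<lambda>t. k t * \<phi> t) = 0"
      using cutint [OF c\<phi>] orth by simp
    then obtain f f1 where f: "sol k f f1" "f1 0 = 0" "\<And>t. t \<ge> x N \<Longrightarrow> f t = 0 \<and> f1 t = 0" "(f, k) \<in> core"
      using range_core [OF k k0 \<phi>] by blast
    have fl2: "f \<in> l2 ?P" using f(4) core_subset_l2 by blast
    have g0: "((\<lambda>t. k t * cnj (w t) - f t * cnj (q t)) has_integral 0) {0..x N}"
      using green [OF f(1) sol_cnj [OF w(1)] l2_loc_int [OF k] loc_int_cnj [OF lq], of N] f(3) [of "x N"] w f(2)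
      by simp
    have fi: "l2_inner ?P f q = integral {0..x N} (\<lambda>t. f t * cnj (q t))"
      unfolding l2_inner_def
      by (rule integral_compact_support [OF l2_inner_integrable [OF fl2 q]]) (simp add: f(3))
    have ki: "(\<lambda>t. k t * cnj (w t)) integrable_on {0..x N}" and fqi: "(\<lambda>t. f t * cnj (q t)) integrable_on {0..x N}"
    proof -
      have "(\<lambda>t. f t * cnj (q t)) absolutely_integrable_on {0<..}"
        using l2_inner_integrable [OF fl2 q] by (simp add: set_integrable_def integrable_restrict_space [OF sets_P'])
      then have "(\<lambda>t. f t * cnj (q t)) absolutely_integrable_on {0<..x N}"
        by (rule set_integrable_subset) auto
      then have "(\<lambda>t. f t * cnj (q t)) absolutely_integrable_on {0..x N}"
        by (rule absolutely_integrable_spike_set) (auto intro: negligible_subset [of "{0}"])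
      then show "(\<lambda>t. f t * cnj (q t)) integrable_on {0..x N}" by (rule abs_int_integrable)
      from integrable_add [OF has_integral_integrable [OF g0] this]
      show "(\<lambda>t. k t * cnj (w t)) integrable_on {0..x N}" by simp
    qed
    have "l2_inner ?P k (cut w) = l2_inner ?P f q"
      using cutint [OF cw] fi integral_unique [OF g0] integral_diff [OF ki fqi] by simp
    also have "\<dots> = l2_inner ?P k p" using pq [OF f(4)] by simp
    also have "\<dots> = l2_inner ?P k (cut p)"
      unfolding l2_inner_def
      by (rule Bochner_Integration.integral_cong) (auto simp: cut_def k0)
    finally have "l2_inner ?P k h = 0"
      unfolding h_def by (simp add: l2_inner_diff_right [OF cp cw k])
    then have "l2_inner ?P k k = 0"
    proof -
      have "l2_inner ?P k (\<lambda>t. h t - c * ?\<phi> t) = l2_inner ?P k h - l2_inner ?P k (\<lambda>t. c * ?\<phi> t)"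
        by (rule l2_inner_diff_right [OF h l2_cmult [OF c\<phi>] k])
      also have "l2_inner ?P k (\<lambda>t. c * ?\<phi> t) = cnj c * l2_inner ?P k ?\<phi>"
        by (simp add: l2_inner_def mult.left_commute)
      finally show ?thesis using \<open>l2_inner ?P k h = 0\<close> orth by (simp add: k_def [abs_def])
    qed
    then have "l2_norm ?P k = 0" by (simp add: l2_inner_self)
    from l2_norm_eq_0_AE [OF k this] have "AE t in lebesgue. 0 < t \<longrightarrow> k t = 0" by (simp add: AE_P_iff)
    then have "AE t in lebesgue. 0 < t \<and> t < x N \<longrightarrow> p t = w t + c * cnj (\<phi> t)"
      by eventually_elim (auto simp: k_def h_def cut_def algebra_simps)
    then show ?thesis by blast
  qed
  then obtain c where c: "\<And>N. N \<ge> 1 \<Longrightarrow> AE t in lebesgue. 0 < t \<and> t < x N \<longrightarrow> p t = w t + c N * cnj (\<phi> t)"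
    by metis
  have x1: "0 < x 1" using x_less [of 0] by (simp add: x0)
  have cN: "c N = c 1" if N: "N \<ge> 1" for N
  proof -
    have xN: "x 1 \<le> x N" using N x_mono by (simp add: strict_mono_less_eq)
    have "AE t in lebesgue. t \<in> {0<..<x 1} \<longrightarrow> c N - c 1 = 0"
      using c [OF N] c [OF order_refl]
    proof eventually_elim
      case (elim t)
      then show ?case using \<phi>eq1 [of t] xN by auto
    qed
    from continuous_AE_zero [OF x1 continuous_on_const this, of 0] x1 show ?thesis by simp
  qed
  have ae: "AE t in lebesgue. 0 < t \<longrightarrow> p t = w t + c 1 * cnj (\<phi> t)"
  proof -
    have "AE t in lebesgue. \<forall>N\<in>{1..}. 0 < t \<and> t < x N \<longrightarrow> p t = w t + c 1 * cnj (\<phi> t)"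
    proof (subst AE_ball_countable, simp, intro ballI)
      fix N :: nat assume "N \<in> {1..}"
      then show "AE t in lebesgue. 0 < t \<and> t < x N \<longrightarrow> p t = w t + c 1 * cnj (\<phi> t)"
        using c [of N] cN [of N] by simp
    qed
    then show ?thesis
    proof eventually_elim
      case (elim t)
      show ?case
      proof
        assume t: "0 < t"
        obtain N where N: "t < x N" using x_exceeds by blast
        then have "N \<noteq> 0" using t x0 by (metis less_asym)
        then show "p t = w t + c 1 * cnj (\<phi> t)" using elim t N by auto
      qed
    qed
  qed
  define u where "u t = w t + c 1 * cnj (\<phi> t)" for t
  define u1 where "u1 t = w1 t + c 1 * cnj (\<phi>1 t)" for t
  have s: "sol q u u1"
    using sol_add_scaled [OF w(1) \<phi>c lq loc_int_zero, of "c 1"] by (simp add: u_def [abs_def] u1_def [abs_def])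
  have ae': "AE t in lebesgue_on ?P. p t = u t" using ae by (simp add: AE_P_iff u_def)
  show ?thesis
    by (rule that [OF s _ l2_AE_cong [OF p sol_measurable [OF s lq] ae'] ae']) (simp add: u1_def w \<phi>)
qed

text \<open>
  Green's identity on $[0, x_n]$ has no contribution from the origin, by the Neumann condition.
\<close>

lemma bracket_limit:
  assumes s: "sol g u u1" "sol h w w1" and l2: "g \<in> l2 {0<..}" "h \<in> l2 {0<..}" "u \<in> l2 {0<..}" "w \<in> l2 {0<..}"
    and z: "u1 0 = 0" "w1 0 = 0"
  shows "(\<lambda>n. u (x n) * cnj (w1 (x n)) - u1 (x n) * cnj (w (x n)))
    \<longlonglongrightarrow> l2_inner {0<..} g w - l2_inner {0<..} u h"
proof -
  have i: "integrable (lebesgue_on {0<..}) (\<lambda>t. g t * cnj (w t) - u t * cnj (h t))"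
    using l2 by (intro Bochner_Integration.integrable_diff l2_inner_integrable)
  have "integral {0..x n} (\<lambda>t. g t * cnj (w t) - u t * cnj (h t))
      = u (x n) * cnj (w1 (x n)) - u1 (x n) * cnj (w (x n))" for n
    using integral_unique [OF green [OF s(1) sol_cnj [OF s(2)] l2_loc_int [OF l2(1)] loc_int_cnj [OF l2_loc_int [OF l2(2)]], of n]] z
    by simp
  moreover have "(LINT t|lebesgue_on {0<..}. g t * cnj (w t) - u t * cnj (h t)) = l2_inner {0<..} g w - l2_inner {0<..} u h"
    unfolding l2_inner_def using l2 by (intro Bochner_Integration.integral_diff l2_inner_integrable)
  ultimately show ?thesis using integral_exhaustion [OF i] by simp
qed

lemma core_symmetric: "core \<subseteq> graph_adjoint {0<..} core"
proof
  fix z assume "z \<in> core"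
  then obtain a b u u1 N where z: "z = (a, b)" and a: "a \<in> l2 {0<..}" "b \<in> l2 {0<..}" "sol b u u1" "u1 0 = 0"
    "\<forall>t\<ge>x N. u t = 0 \<and> u1 t = 0" "AE t in lebesgue_on {0<..}. a t = u t"
    unfolding core_def by blast
  have ul2: "u \<in> l2 {0<..}" by (rule l2_AE_cong [OF a(1) sol_measurable [OF a(3) l2_loc_int [OF a(2)]] a(6)])
  have "l2_inner {0<..} g a = l2_inner {0<..} f b" if fg: "(f, g) \<in> core" for f g
  proof -
    obtain w w1 M where f: "f \<in> l2 {0<..}" "g \<in> l2 {0<..}" "sol g w w1" "w1 0 = 0"
      "AE t in lebesgue_on {0<..}. f t = w t" "\<forall>t\<ge>x M. w t = 0 \<and> w1 t = 0"
      using fg unfolding core_def by blast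
    have wl2: "w \<in> l2 {0<..}" by (rule l2_AE_cong [OF f(1) sol_measurable [OF f(3) l2_loc_int [OF f(2)]] f(5)])
    have "(\<lambda>n. w (x n) * cnj (u1 (x n)) - w1 (x n) * cnj (u (x n))) \<longlonglongrightarrow> 0"
    proof (rule tendsto_eventually)
      have "\<forall>\<^sub>F n in sequentially. N \<le> n" by (rule eventually_ge_at_top)
      then show "\<forall>\<^sub>F n in sequentially. w (x n) * cnj (u1 (x n)) - w1 (x n) * cnj (u (x n)) = 0"
      proof eventually_elim
        case (elim n)
        then have "x N \<le> x n" using x_mono by (simp add: strict_mono_less_eq)
        then show ?case using a(5) by simp
      qed
    qed
    with bracket_limit [OF f(3) a(3) f(2) a(2) wl2 ul2 f(4) a(4)]
    have "l2_inner {0<..} g u - l2_inner {0<..} w b = 0" by (rule LIMSEQ_unique)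
    moreover have "l2_inner {0<..} a g = l2_inner {0<..} u g"
      by (rule l2_inner_cong_AE [OF a(1) ul2 f(2) a(6)])
    moreover have "l2_inner {0<..} f b = l2_inner {0<..} w b"
      by (rule l2_inner_cong_AE [OF f(1) wl2 a(2) f(5)])
    ultimately show ?thesis by (simp add: l2_inner_commute [of _ g])
  qed
  then show "z \<in> graph_adjoint {0<..} core" unfolding graph_adjoint_def z using a by auto
qed

end

section \<open>Self-adjointness from vanishing boundary forms at infinity\<close>

lemma subset_graph_closure:
  assumes "G \<subseteq> l2 S \<times> l2 S"
  shows "G \<subseteq> graph_closure S G"
proof
  fix z assume z: "z \<in> G"
  obtain f g where fg: "z = (f, g)" by (cases z)
  have "l2_norm S (\<lambda>t. 0) = 0" by (simp add: l2_norm_def)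
  then show "z \<in> graph_closure S G"
    unfolding graph_closure_def using z assms fg by (auto intro!: exI [of _ "\<lambda>_. (f, g)"])
qed

lemma graph_adjoint_closure:
  assumes G: "G \<subseteq> l2 S \<times> l2 S"
  shows "graph_adjoint S (graph_closure S G) = graph_adjoint S G"
proof
  show "graph_adjoint S (graph_closure S G) \<subseteq> graph_adjoint S G"
    using subset_graph_closure [OF G] by (fastforce simp: graph_adjoint_def)
  show "graph_adjoint S G \<subseteq> graph_adjoint S (graph_closure S G)"
  proof
    fix z assume z: "z \<in> graph_adjoint S G"
    obtain u v where uv: "z = (u, v)" by (cases z)
    have u: "u \<in> l2 S" and v: "v \<in> l2 S" and eq: "\<And>f g. (f, g) \<in> G \<Longrightarrow> l2_inner S g u = l2_inner S f v"
      using z uv by (auto simp: graph_adjoint_def)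
    have "l2_inner S g u = l2_inner S f v" if fg: "(f, g) \<in> graph_closure S G" for f g
    proof -
      obtain F where f: "f \<in> l2 S" "g \<in> l2 S" and F: "\<And>k. F k \<in> G"
        "(\<lambda>k. l2_norm S (\<lambda>t. fst (F k) t - f t)) \<longlonglongrightarrow> 0" "(\<lambda>k. l2_norm S (\<lambda>t. snd (F k) t - g t)) \<longlonglongrightarrow> 0"
        using fg unfolding graph_closure_def by blast
      have Fl: "fst (F k) \<in> l2 S" "snd (F k) \<in> l2 S" for k using F(1) [of k] G by auto
      have "(\<lambda>k. l2_inner S (snd (F k)) u) \<longlonglongrightarrow> l2_inner S g u"
        by (rule l2_inner_tendsto [OF Fl(2) f(2) u F(3)])
      moreover have "(\<lambda>k. l2_inner S (fst (F k)) v) \<longlonglongrightarrow> l2_inner S f v"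
        by (rule l2_inner_tendsto [OF Fl(1) f(1) v F(2)])
      moreover have "l2_inner S (snd (F k)) u = l2_inner S (fst (F k)) v" for k
        by (rule eq) (simp add: F(1))
      ultimately show ?thesis using LIMSEQ_unique by simp
    qed
    then show "z \<in> graph_adjoint S (graph_closure S G)" using u v uv by (auto simp: graph_adjoint_def)
  qed
qed

lemma graph_closure_subset_adjoint:
  assumes G: "G \<subseteq> l2 S \<times> l2 S" and sym: "G \<subseteq> graph_adjoint S G"
  shows "graph_closure S G \<subseteq> graph_adjoint S G"
proof
  fix z assume z: "z \<in> graph_closure S G"
  obtain f g where fg: "z = (f, g)" by (cases z)
  obtain F where f: "f \<in> l2 S" "g \<in> l2 S" and F: "\<And>k. F k \<in> G"
    "(\<lambda>k. l2_norm S (\<lambda>t. fst (F k) t - f t)) \<longlonglongrightarrow> 0" "(\<lambda>k. l2_norm S (\<lambda>t. snd (F k) t - g t)) \<longlonglongrightarrow> 0"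
    using z unfolding graph_closure_def fg by blast
  have Fl: "fst (F k) \<in> l2 S" "snd (F k) \<in> l2 S" for k using F(1) [of k] G by auto
  have "l2_inner S b f = l2_inner S a g" if ab: "(a, b) \<in> G" for a b
  proof -
    have a: "a \<in> l2 S" "b \<in> l2 S" using ab G by auto
    have "(\<lambda>k. l2_inner S (fst (F k)) b) \<longlonglongrightarrow> l2_inner S f b"
      by (rule l2_inner_tendsto [OF Fl(1) f(1) a(2) F(2)])
    moreover have "(\<lambda>k. l2_inner S (snd (F k)) a) \<longlonglongrightarrow> l2_inner S g a"
      by (rule l2_inner_tendsto [OF Fl(2) f(2) a(1) F(3)])
    moreover have "l2_inner S (fst (F k)) b = l2_inner S (snd (F k)) a" for k
    proof -
      have "(fst (F k), snd (F k)) \<in> graph_adjoint S G" using F(1) [of k] sym by auto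
      then have "l2_inner S b (fst (F k)) = l2_inner S a (snd (F k))"
        using ab by (auto simp: graph_adjoint_def)
      then show ?thesis by (metis l2_inner_commute)
    qed
    ultimately have "l2_inner S f b = l2_inner S g a" using LIMSEQ_unique by simp
    then show ?thesis by (metis l2_inner_commute)
  qed
  then show "z \<in> graph_adjoint S G" using f fg by (auto simp: graph_adjoint_def)
qed

lemma l2_norm_diff_cong:
  assumes "f \<in> l2 S" "g \<in> l2 S" "h \<in> l2 S" "l2_norm S (\<lambda>t. f t - g t) = 0"
  shows "l2_norm S (\<lambda>t. h t - f t) = l2_norm S (\<lambda>t. h t - g t)"
proof -
  have "AE t in lebesgue_on S. f t - g t = 0" by (rule l2_norm_eq_0_AE [OF l2_diff [OF assms(1,2)] assms(4)])
  then have ae: "AE t in lebesgue_on S. (cmod (h t - f t))\<^sup>2 = (cmod (h t - g t))\<^sup>2"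
    by eventually_elim simp
  have "(LINT t|lebesgue_on S. (cmod (h t - f t))\<^sup>2) = (LINT t|lebesgue_on S. (cmod (h t - g t))\<^sup>2)"
    by (rule integral_cong_AE [OF _ _ ae])
       (use l2_int [OF l2_diff [OF assms(3,1)]] l2_int [OF l2_diff [OF assms(3,2)]] in auto)
  then show ?thesis by (simp add: l2_norm_def)
qed

text \<open>
  The residual of the projection of an element of the adjoint onto the closure, rotated by a
  quarter turn, lies in the adjoint again, and symmetry of the adjoint forces it to vanish.
\<close>

lemma adjoint_subset_closure:
  assumes G: "G \<subseteq> l2 S \<times> l2 S" and zero: "((\<lambda>t. 0), (\<lambda>t. 0)) \<in> G"
    and lin: "\<And>f g f' g' c. (f, g) \<in> G \<Longrightarrow> (f', g') \<in> G \<Longrightarrow>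
        ((\<lambda>t. f t + c * f' t), (\<lambda>t. g t + c * g' t)) \<in> G"
    and sym: "G \<subseteq> graph_adjoint S G"
    and adj_sym: "\<And>u v a b. (u, v) \<in> graph_adjoint S G \<Longrightarrow> (a, b) \<in> graph_adjoint S G \<Longrightarrow>
        l2_inner S v a = l2_inner S u b"
  shows "graph_adjoint S G \<subseteq> graph_closure S G"
proof
  fix z assume z: "z \<in> graph_adjoint S G"
  obtain u v where uv: "z = (u, v)" by (cases z)
  have u: "u \<in> l2 S" and v: "v \<in> l2 S" using z uv by (auto simp: graph_adjoint_def)
  obtain f g where cl: "(f, g) \<in> graph_closure S G"
    and orth: "\<And>a b. (a, b) \<in> G \<Longrightarrow> l2_inner S (\<lambda>t. u t - f t) a + l2_inner S (\<lambda>t. v t - g t) b = 0"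
    using graph_projection [OF G zero lin u v] by blast
  have f: "f \<in> l2 S" and g: "g \<in> l2 S" using cl by (auto simp: graph_closure_def)
  define r where "r t = u t - f t" for t
  define s where "s t = v t - g t" for t
  have r: "r \<in> l2 S" and s: "s \<in> l2 S" unfolding r_def s_def by (intro l2_diff u v f g)+
  have "l2_inner S b s = l2_inner S a (\<lambda>t. - r t)" if "(a, b) \<in> G" for a b
  proof -
    have "l2_inner S r a + l2_inner S s b = 0" using orth [OF that] by (simp add: r_def [abs_def] s_def [abs_def])
    then have "cnj (l2_inner S r a + l2_inner S s b) = 0" by simp
    then have "l2_inner S a r + l2_inner S b s = 0"
      by (simp add: l2_inner_commute [symmetric])
    then show ?thesis by (simp add: l2_inner_uminus_right add_eq_0_iff)
  qed
  then have sr: "(s, \<lambda>t. - r t) \<in> graph_adjoint S G"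
    using s l2_uminus [OF r] by (auto simp: graph_adjoint_def)
  have fg: "(f, g) \<in> graph_adjoint S G" using graph_closure_subset_adjoint [OF G sym] cl by blast
  have "l2_inner S v s = - l2_inner S u r"
    using adj_sym [OF _ sr, of u v] z uv by (simp add: l2_inner_uminus_right)
  moreover have "l2_inner S g s = - l2_inner S f r"
    using adj_sym [OF fg sr] by (simp add: l2_inner_uminus_right)
  ultimately have "l2_inner S s s = - l2_inner S r r"
    using l2_inner_diff_left [OF v g s] l2_inner_diff_left [OF u f r]
    by (simp add: r_def [abs_def] s_def [abs_def])
  then have "complex_of_real ((l2_norm S s)\<^sup>2 + (l2_norm S r)\<^sup>2) = 0"
    by (simp add: l2_inner_self)
  then have "(l2_norm S s)\<^sup>2 + (l2_norm S r)\<^sup>2 = 0" by (simp only: of_real_eq_0_iff)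
  then have "l2_norm S r = 0" "l2_norm S s = 0"
    by (simp_all add: sum_power2_eq_zero_iff)
  then have nz: "l2_norm S (\<lambda>t. u t - f t) = 0" "l2_norm S (\<lambda>t. v t - g t) = 0"
    by (simp_all add: r_def [abs_def] s_def [abs_def])
  obtain F where F: "\<And>k. F k \<in> G"
    "(\<lambda>k. l2_norm S (\<lambda>t. fst (F k) t - f t)) \<longlonglongrightarrow> 0" "(\<lambda>k. l2_norm S (\<lambda>t. snd (F k) t - g t)) \<longlonglongrightarrow> 0"
    using cl unfolding graph_closure_def by blast
  have Fl: "fst (F k) \<in> l2 S" "snd (F k) \<in> l2 S" for k using F(1) [of k] G by auto
  have "(\<lambda>k. l2_norm S (\<lambda>t. fst (F k) t - u t)) \<longlonglongrightarrow> 0" "(\<lambda>k. l2_norm S (\<lambda>t. snd (F k) t - v t)) \<longlonglongrightarrow> 0"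
    using F(2,3) l2_norm_diff_cong [OF u f Fl(1) nz(1)] l2_norm_diff_cong [OF v g Fl(2) nz(2)] by simp_all
  then show "z \<in> graph_closure S G"
    unfolding graph_closure_def uv using u v F(1) by blast
qed

context grid
begin

lemma sol_AE_zero_imp_AE_zero:
  assumes s: "sol g u u1" and lg: "loc_int g" and z: "AE t in lebesgue_on {0<..}. u t = 0"
  shows "AE t in lebesgue_on {0<..}. g t = 0"
proof -
  have "AE t in lebesgue. t \<in> {x n..x (Suc n)} \<longrightarrow> g t = 0" for n
  proof (rule AE_zero_if_integrals_zero [OF loc_intD [OF lg x_nonneg]])
    have u0: "u r = 0" if "r \<in> {x n..x (Suc n)}" for r
    proof (rule continuous_AE_zero [OF x_less sol_continuous [OF s lg] _ that])
      show "AE t in lebesgue. t \<in> {x n<..<x (Suc n)} \<longrightarrow> u t = 0"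
        using z unfolding AE_P_iff by eventually_elim (use x_nonneg [of n] in auto)
    qed
    have I: "integral {x n..t} g = u1 (x n)" if t: "t \<in> {x n..x (Suc n)}" for t
      using sol_zero_on_interval [OF s lg u0 t] by simp
    fix c d assume cd: "x n \<le> c" "c \<le> d" "d \<le> x (Suc n)"
    have "g integrable_on {x n..d}" by (rule abs_int_integrable [OF loc_intD [OF lg x_nonneg]])
    from Henstock_Kurzweil_Integration.integral_combine [OF cd(1,2) this]
    show "integral {c..d} g = 0" using I [of c] I [of d] cd by simp
  qed
  then have "AE t in lebesgue. \<forall>n. t \<in> {x n..x (Suc n)} \<longrightarrow> g t = 0"
    by (subst AE_all_countable) simp
  then show ?thesis
    unfolding AE_P_iff
  proof eventually_elim
    case (elim t)
    show ?case
    proof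
      assume "0 < t"
      then obtain n where "x n \<le> t" "t < x (Suc n)" using interval_exists [of t] by auto
      then show "g t = 0" using elim by auto
    qed
  qed
qed

text \<open>
  A function orthogonal to the domain of the minimal operator is the image of zero under the
  adjoint. By regularity of the adjoint it is minus the second derivative of the zero function,
  so it vanishes.
\<close>

lemma core_domain_dense: "l2_dense {0<..} (fst ` graph_closure {0<..} core)"
  unfolding l2_dense_def
proof (intro conjI ballI allI impI)
  let ?P = "{0::real<..}"
  show "fst ` graph_closure ?P core \<subseteq> l2 ?P" by (auto simp: graph_closure_def)
  fix u and \<epsilon> :: real assume u: "u \<in> l2 ?P" and \<epsilon>: "\<epsilon> > 0"
  define G0 where "G0 = {(a, b). a \<in> fst ` core \<and> b = (\<lambda>t::real. 0::complex)}"
  have sub: "G0 \<subseteq> l2 ?P \<times> l2 ?P" using core_subset_l2 by (auto simp: G0_def l2_zero)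
  have zero: "((\<lambda>t. 0), (\<lambda>t. 0)) \<in> G0" using core_zero by (force simp: G0_def)
  have lin: "((\<lambda>t. f t + c * f' t), (\<lambda>t. g t + c * g' t)) \<in> G0"
    if fg: "(f, g) \<in> G0" "(f', g') \<in> G0" for f g f' g' c
  proof -
    obtain h h' where "(f, h) \<in> core" "(f', h') \<in> core" using fg by (auto simp: G0_def)
    from core_linear [OF this] have "(\<lambda>t. f t + c * f' t) \<in> fst ` core" by (rule image_eqI [rotated]) simp
    then show ?thesis using fg by (auto simp: G0_def)
  qed
  obtain f g where cl: "(f, g) \<in> graph_closure ?P G0"
    and orth: "\<And>a b. (a, b) \<in> G0 \<Longrightarrow> l2_inner ?P (\<lambda>t. u t - f t) a + l2_inner ?P (\<lambda>t. 0 - g t) b = 0"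
    using graph_projection [OF sub zero lin u l2_zero] by blast
  obtain F where f: "f \<in> l2 ?P" and F: "\<And>k. F k \<in> G0" "(\<lambda>k. l2_norm ?P (\<lambda>t. fst (F k) t - f t)) \<longlonglongrightarrow> 0"
    using cl unfolding graph_closure_def by blast
  define r where "r t = u t - f t" for t
  have r: "r \<in> l2 ?P" unfolding r_def by (rule l2_diff [OF u f])
  have "l2_inner ?P b (\<lambda>t. 0) = l2_inner ?P a r" if ab: "(a, b) \<in> core" for a b
  proof -
    have "(a, \<lambda>t. 0) \<in> G0" using ab by (force simp: G0_def)
    from orth [OF this] have "l2_inner ?P r a = 0" by (simp add: r_def [abs_def] l2_inner_def)
    then have "l2_inner ?P a r = 0" by (subst l2_inner_commute) simp
    then show ?thesis by (simp add: l2_inner_def)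
  qed
  then have "((\<lambda>t. 0), r) \<in> graph_adjoint ?P core"
    using r l2_zero by (auto simp: graph_adjoint_def)
  then obtain w w1 where w: "sol r w w1" "AE t in lebesgue_on ?P. 0 = w t"
    using adjoint_regular by blast
  have "AE t in lebesgue_on ?P. w t = 0" using w(2) by eventually_elim simp
  from sol_AE_zero_imp_AE_zero [OF w(1) l2_loc_int [OF r] this]
  have "AE t in lebesgue_on ?P. (cmod (r t))\<^sup>2 = 0" by eventually_elim simp
  then have "(LINT t|lebesgue_on ?P. (cmod (r t))\<^sup>2) = 0"
    using integral_nonneg_eq_0_iff_AE [OF l2_int [OF r]] by simp
  then have nz: "l2_norm ?P (\<lambda>t. u t - f t) = 0" by (simp add: l2_norm_def r_def)
  obtain k where k: "l2_norm ?P (\<lambda>t. fst (F k) t - f t) < \<epsilon>"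
    using order_tendstoD(2) [OF F(2) \<epsilon>] by (auto simp: eventually_sequentially)
  have Fk: "fst (F k) \<in> fst ` core" using F(1) [of k] by (force simp: G0_def)
  then have Fl: "fst (F k) \<in> l2 ?P" using core_subset_l2 by auto
  show "\<exists>g\<in>fst ` graph_closure ?P core. l2_norm ?P (\<lambda>t. u t - g t) < \<epsilon>"
  proof (rule bexI)
    show "fst (F k) \<in> fst ` graph_closure ?P core"
      using Fk subset_graph_closure [OF core_subset_l2] by auto
    show "l2_norm ?P (\<lambda>t. u t - fst (F k) t) < \<epsilon>"
      using k l2_norm_diff_cong [OF u f Fl nz] by (simp add: l2_norm_commute)
  qed
qed

lemma self_adjoint_if_brackets_vanish:
  assumes br: "\<And>g u u1 h w w1 c. sol g u u1 \<Longrightarrow> sol h w w1 \<Longrightarrow> g \<in> l2 {0<..} \<Longrightarrow> h \<in> l2 {0<..} \<Longrightarrow>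
    u \<in> l2 {0<..} \<Longrightarrow> w \<in> l2 {0<..} \<Longrightarrow>
    (\<lambda>n. u (x n) * w1 (x n) - u1 (x n) * w (x n)) \<longlonglongrightarrow> c \<Longrightarrow> c = 0"
  shows "self_adjoint {0<..} (hamiltonian x \<alpha>)"
proof -
  let ?P = "{0::real<..}"
  have adj_sym: "l2_inner ?P v a = l2_inner ?P u b"
    if uv: "(u, v) \<in> graph_adjoint ?P core" and ab: "(a, b) \<in> graph_adjoint ?P core" for u v a b
  proof -
    have l2: "u \<in> l2 ?P" "v \<in> l2 ?P" "a \<in> l2 ?P" "b \<in> l2 ?P" using uv ab by (auto simp: graph_adjoint_def)
    obtain w w1 where w: "sol v w w1" "w1 0 = 0" "w \<in> l2 ?P" "AE t in lebesgue_on ?P. u t = w t"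
      using adjoint_regular [OF uv] by blast
    obtain z z1 where z: "sol b z z1" "z1 0 = 0" "z \<in> l2 ?P" "AE t in lebesgue_on ?P. a t = z t"
      using adjoint_regular [OF ab] by blast
    have "l2_inner ?P v z - l2_inner ?P w b = 0"
      by (rule br [OF w(1) sol_cnj [OF z(1)] l2(2) l2_cnj [OF l2(4)] w(3) l2_cnj [OF z(3)]
            bracket_limit [OF w(1) z(1) l2(2,4) w(3) z(3) w(2) z(2)]])
    moreover have "l2_inner ?P a v = l2_inner ?P z v"
      by (rule l2_inner_cong_AE [OF l2(3) z(3) l2(2) z(4)])
    moreover have "l2_inner ?P u b = l2_inner ?P w b"
      by (rule l2_inner_cong_AE [OF l2(1) w(3) l2(4) w(4)])
    ultimately show ?thesis by (simp add: l2_inner_commute [of _ v])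
  qed
  have "graph_adjoint ?P core = graph_closure ?P core"
  proof
    show "graph_adjoint ?P core \<subseteq> graph_closure ?P core"
      by (rule adjoint_subset_closure [OF core_subset_l2 core_zero core_linear core_symmetric adj_sym])
    show "graph_closure ?P core \<subseteq> graph_adjoint ?P core"
      by (rule graph_closure_subset_adjoint [OF core_subset_l2 core_symmetric])
  qed
  then show ?thesis
    unfolding self_adjoint_def hamiltonian_def hamiltonian0_eq_core
    using core_domain_dense graph_adjoint_closure [OF core_subset_l2] by simp
qed

end

section \<open>The discrete limit-point criterion\<close>

locale step_sizes =
  fixes \<delta> :: "nat \<Rightarrow> real" and K B :: real
  assumes \<delta>_pos: "\<delta> n > 0" and \<delta>_bound: "\<delta> n \<le> B"
    and \<delta>_left: "\<delta> n \<le> K * \<delta> (Suc n)" and \<delta>_right: "\<delta> (Suc n) \<le> K * \<delta> n"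
    and \<delta>_diverges: "\<not> summable \<delta>"
begin

definition slope :: "(nat \<Rightarrow> complex) \<Rightarrow> nat \<Rightarrow> complex" where
  "slope u n = (u (Suc n) - u n) / of_real (\<delta> n)"

definition defect :: "(nat \<Rightarrow> real) \<Rightarrow> (nat \<Rightarrow> complex) \<Rightarrow> nat \<Rightarrow> complex" where
  "defect \<alpha> u n = slope u (Suc n) - slope u n - of_real (\<alpha> (Suc n)) * u (Suc n)"

text \<open>
  This is what remains of square integrability of a function and of its second derivative when
  only the values at the nodes are kept.
\<close>

definition admissible :: "(nat \<Rightarrow> real) \<Rightarrow> (nat \<Rightarrow> complex) \<Rightarrow> bool" where
  "admissible \<alpha> u \<longleftrightarrow> summable (\<lambda>n. \<delta> n * (cmod (u (Suc n)))\<^sup>2) \<and>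
     summable (\<lambda>n. (cmod (defect \<alpha> u n))\<^sup>2 / \<delta> n)"

definition wronskian :: "(nat \<Rightarrow> complex) \<Rightarrow> (nat \<Rightarrow> complex) \<Rightarrow> nat \<Rightarrow> complex" where
  "wronskian u f n = u n * slope f n - slope u n * f n"

lemma slope_mult: "of_real (\<delta> n) * slope u n = u (Suc n) - u n"
  using \<delta>_pos [of n] by (simp add: slope_def)

lemma weighted_product_le:
  assumes "d > (0::real)" "a \<ge> 0" "b \<ge> 0"
  shows "a * b \<le> d * a\<^sup>2 + b\<^sup>2 / d"
proof -
  have "0 \<le> (sqrt d * a - b / sqrt d)\<^sup>2" by simp
  also have "\<dots> = d * a\<^sup>2 + b\<^sup>2 / d - 2 * (a * b)"
    using assms by (simp add: power2_diff power_mult_distrib power_divide field_simps) (simp add: power2_eq_square)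
  finally show ?thesis using mult_nonneg_nonneg [OF assms(2,3)] by linarith
qed

lemma admissible_summable:
  assumes "admissible \<alpha> u"
  shows "summable (\<lambda>n. \<delta> n * (cmod (u n))\<^sup>2)"
proof -
  have "summable (\<lambda>n. \<delta> (Suc n) * (cmod (u (Suc n)))\<^sup>2)"
  proof (rule summable_comparison_test' [where N = 0])
    show "summable (\<lambda>n. K * (\<delta> n * (cmod (u (Suc n)))\<^sup>2))"
      using assms by (intro summable_mult) (simp add: admissible_def)
    show "norm (\<delta> (Suc n) * (cmod (u (Suc n)))\<^sup>2) \<le> K * (\<delta> n * (cmod (u (Suc n)))\<^sup>2)" for n
      using mult_right_mono [OF \<delta>_right [of n], of "(cmod (u (Suc n)))\<^sup>2"] \<delta>_pos [of "Suc n"]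
      by (simp add: mult.assoc)
  qed
  then show ?thesis by (rule summable_Suc_iff [THEN iffD1])
qed

lemma limit_zero_if_weighted_summable:
  assumes lim: "W \<longlonglongrightarrow> (c::complex)" and s: "summable (\<lambda>n. p n * cmod (W n))"
    and p: "\<And>n. p n \<ge> 0" and div: "\<not> summable p"
  shows "c = 0"
proof (rule ccontr)
  assume "c \<noteq> 0"
  then have pos: "cmod c / 2 > 0" by simp
  have "(\<lambda>n. cmod (W n)) \<longlonglongrightarrow> cmod c" using lim by (rule tendsto_norm)
  then have "\<forall>\<^sub>F n in sequentially. cmod c / 2 < cmod (W n)"
    by (rule order_tendstoD) (use pos in simp)
  then obtain N where N: "\<And>n. n \<ge> N \<Longrightarrow> cmod c / 2 < cmod (W n)"
    by (auto simp: eventually_sequentially)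
  have "summable (\<lambda>n. (2 / cmod c) * (p n * cmod (W n)))"
    using s by (rule summable_mult)
  then have "summable p"
  proof (rule summable_comparison_test' [where N = N])
    fix n assume "n \<ge> N"
    then have "p n * (cmod c / 2) \<le> p n * cmod (W n)"
      using N [of n] p [of n] by (intro mult_left_mono) auto
    then show "norm (p n) \<le> (2 / cmod c) * (p n * cmod (W n))"
      using p [of n] pos by (simp add: field_simps)
  qed
  then show False using div by simp
qed

text \<open>
  If the energy \<open>\<delta> |slope|\<^sup>2\<close> were not summable, then
  \<open>Re (cnj (u n) * slope u n)\<close> would tend to infinity by the difference equation, so
  \<open>|u n|\<close> would eventually increase; this contradicts the square summability of \<open>u\<close>, the total
  length being infinite.
\<close>

lemma energy_summable:
  assumes adm: "admissible \<alpha> u" and lower: "\<And>n. n \<ge> N \<Longrightarrow> \<alpha> (Suc n) \<ge> - C * \<delta> n" and C: "C \<ge> 0"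
  shows "summable (\<lambda>n. \<delta> n * (cmod (slope u n))\<^sup>2)"
proof (rule ccontr)
  assume div: "\<not> summable (\<lambda>n. \<delta> n * (cmod (slope u n))\<^sup>2)"
  let ?e = "defect \<alpha> u"
  define E where "E n = Re (cnj (u (Suc n)) * slope u (Suc n))" for n
  define a where "a n = \<delta> (Suc n) * (cmod (slope u (Suc n)))\<^sup>2" for n
  define r where "r n = (C + 1) * (\<delta> n * (cmod (u (Suc n)))\<^sup>2) + (cmod (?e n))\<^sup>2 / \<delta> n" for n
  have a0: "a n \<ge> 0" for n using \<delta>_pos [of "Suc n"] by (simp add: a_def)
  have r0: "r n \<ge> 0" for n using \<delta>_pos [of n] C by (simp add: r_def)
  have rs: "summable r"
    unfolding r_def using adm by (intro summable_add summable_mult) (auto simp: admissible_def)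
  have step: "E (Suc n) - E n \<ge> a n - r (Suc n)" if "n \<ge> N" for n
  proof -
    let ?u = "u (Suc (Suc n))" and ?s = "slope u (Suc n)"
    have "slope u (Suc (Suc n)) = ?s + of_real (\<alpha> (Suc (Suc n))) * ?u + ?e (Suc n)"
      by (simp add: defect_def)
    moreover have "?u = u (Suc n) + of_real (\<delta> (Suc n)) * ?s" using slope_mult [of "Suc n" u] by simp
    ultimately have "E (Suc n) - E n = Re (cnj (u (Suc n) + of_real (\<delta> (Suc n)) * ?s) * ?s) - E n
        + \<alpha> (Suc (Suc n)) * (cmod ?u)\<^sup>2 + Re (cnj ?u * ?e (Suc n))"
      unfolding E_def cmod_power2 by (simp add: algebra_simps power2_eq_square)
    also have "Re (cnj (u (Suc n) + of_real (\<delta> (Suc n)) * ?s) * ?s) - E n = a n"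
      unfolding E_def a_def cmod_power2 by (simp add: algebra_simps power2_eq_square)
    finally have eq: "E (Suc n) - E n = a n + \<alpha> (Suc (Suc n)) * (cmod ?u)\<^sup>2 + Re (cnj ?u * ?e (Suc n))" .
    have "\<alpha> (Suc (Suc n)) * (cmod ?u)\<^sup>2 \<ge> (- C * \<delta> (Suc n)) * (cmod ?u)\<^sup>2"
      by (rule mult_right_mono) (use lower [of "Suc n"] that in auto)
    moreover have "\<bar>Re (cnj ?u * ?e (Suc n))\<bar> \<le> cmod ?u * cmod (?e (Suc n))"
      using abs_Re_le_cmod [of "cnj ?u * ?e (Suc n)"] by (simp add: norm_mult)
    moreover have "cmod ?u * cmod (?e (Suc n)) \<le> \<delta> (Suc n) * (cmod ?u)\<^sup>2 + (cmod (?e (Suc n)))\<^sup>2 / \<delta> (Suc n)"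
      by (rule weighted_product_le) (auto simp: \<delta>_pos)
    ultimately show ?thesis unfolding eq r_def by (simp add: algebra_simps)
  qed
  have E_ge: "E (N + n) \<ge> E N + (\<Sum>i<n. a (N + i)) - (\<Sum>i<n. r (Suc (N + i)))" for n
  proof (induction n)
    case (Suc n)
    then show ?case using step [of "N + n"] by simp
  qed simp
  have rN: "summable (\<lambda>i. r (Suc (N + i)))"
    using summable_ignore_initial_segment [OF rs, of "Suc N"] by (simp add: add.commute)
  have r_le: "(\<Sum>i<n. r (Suc (N + i))) \<le> (\<Sum>i. r (Suc (N + i)))" for n
    by (rule sum_le_suminf [OF rN]) (auto simp: r0)
  have "\<not> summable (\<lambda>i. a (N + i))"
  proof
    assume "summable (\<lambda>i. a (N + i))"
    then have "summable (\<lambda>i. \<delta> (i + Suc N) * (cmod (slope u (i + Suc N)))\<^sup>2)"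
      by (simp only: a_def add.commute [of N] add_Suc_right)
    then show False using div summable_iff_shift [of "\<lambda>n. \<delta> n * (cmod (slope u n))\<^sup>2" "Suc N"] by blast
  qed
  then have large: "\<exists>n. (\<Sum>i<n. a (N + i)) > R" for R
  proof -
    have "\<not> (\<forall>n. (\<Sum>i<n. a (N + i)) \<le> R)"
      using bounded_imp_summable [of "\<lambda>i. a (N + i)" R] a0 \<open>\<not> summable (\<lambda>i. a (N + i))\<close>
      by (metis le_eq_less_or_eq lessThan_Suc_atMost)
    then show ?thesis by (simp add: not_le)
  qed
  obtain M0 where M0: "(\<Sum>i<M0. a (N + i)) > (\<Sum>i. r (Suc (N + i))) - E N" using large by blast
  have Epos: "E (N + n) > 0" if "n \<ge> M0" for n
  proof -
    have "(\<Sum>i<M0. a (N + i)) \<le> (\<Sum>i<n. a (N + i))"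
      by (rule sum_mono2) (use that a0 in auto)
    then show ?thesis using M0 E_ge [of n] r_le [of n] by linarith
  qed
  define M where "M = N + M0"
  have Epos': "E n > 0" if "n \<ge> M" for n
    using Epos [of "n - N"] that by (simp add: M_def)
  have inc: "(cmod (u (Suc (Suc n))))\<^sup>2 \<ge> (cmod (u (Suc n)))\<^sup>2" if "n \<ge> M" for n
  proof -
    have "u (Suc (Suc n)) = u (Suc n) + of_real (\<delta> (Suc n)) * slope u (Suc n)"
      using slope_mult [of "Suc n" u] by simp
    then have "(cmod (u (Suc (Suc n))))\<^sup>2 = (cmod (u (Suc n)))\<^sup>2 + 2 * \<delta> (Suc n) * E n + (\<delta> (Suc n) * cmod (slope u (Suc n)))\<^sup>2"
      unfolding E_def power_mult_distrib cmod_power2 by (simp add: algebra_simps power2_eq_square)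
    then show ?thesis using Epos' [OF that] \<delta>_pos [of "Suc n"] by simp
  qed
  define m where "m = (cmod (u (Suc M)))\<^sup>2"
  have "u (Suc M) \<noteq> 0" using Epos' [of M] by (auto simp: E_def)
  then have m: "m > 0" by (simp add: m_def)
  have ge: "(cmod (u (Suc n)))\<^sup>2 \<ge> m" if "n \<ge> M" for n
    using that
  proof (induction n rule: dec_induct)
    case (step n)
    then show ?case using inc [of n] by linarith
  qed (simp add: m_def)
  have "summable (\<lambda>n. (1 / m) * (\<delta> n * (cmod (u (Suc n)))\<^sup>2))"
    using adm by (intro summable_mult) (simp add: admissible_def)
  then have "summable \<delta>"
  proof (rule summable_comparison_test' [where N = M])
    fix n assume "n \<ge> M"
    then have "\<delta> n * m \<le> \<delta> n * (cmod (u (Suc n)))\<^sup>2"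
      using ge [of n] \<delta>_pos [of n] by (intro mult_left_mono) auto
    then show "norm (\<delta> n) \<le> (1 / m) * (\<delta> n * (cmod (u (Suc n)))\<^sup>2)"
      using m \<delta>_pos [of n] by (simp add: field_simps)
  qed
  then show False using \<delta>_diverges by simp
qed

lemma wronskian_limit_lower:
  assumes u: "admissible \<alpha> u" and f: "admissible \<alpha> f"
    and lower: "\<And>n. n \<ge> N \<Longrightarrow> \<alpha> (Suc n) \<ge> - C * \<delta> n" and C: "C \<ge> 0"
    and lim: "wronskian u f \<longlonglongrightarrow> c"
  shows "c = 0"
proof (rule limit_zero_if_weighted_summable [OF lim _ less_imp_le [OF \<delta>_pos] \<delta>_diverges])
  let ?b = "\<lambda>n. (\<delta> n * (cmod (u n))\<^sup>2 + \<delta> n * (cmod (slope f n))\<^sup>2) + (\<delta> n * (cmod (slope u n))\<^sup>2 + \<delta> n * (cmod (f n))\<^sup>2)"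
  show "summable (\<lambda>n. \<delta> n * cmod (wronskian u f n))"
  proof (rule summable_comparison_test' [where N = 0])
    show "summable ?b"
      by (intro summable_add admissible_summable [OF u] admissible_summable [OF f]
          energy_summable [OF u lower C] energy_summable [OF f lower C])
    fix n
    have "p * q \<le> p\<^sup>2 + q\<^sup>2" if "p \<ge> 0" "q \<ge> 0" for p q :: real
      using weighted_product_le [of 1 p q] that by simp
    then have "cmod (u n * slope f n) \<le> (cmod (u n))\<^sup>2 + (cmod (slope f n))\<^sup>2"
      "cmod (slope u n * f n) \<le> (cmod (slope u n))\<^sup>2 + (cmod (f n))\<^sup>2" by (simp_all add: norm_mult)
    then have "cmod (wronskian u f n) \<le> ((cmod (u n))\<^sup>2 + (cmod (slope f n))\<^sup>2) + ((cmod (slope u n))\<^sup>2 + (cmod (f n))\<^sup>2)"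
      unfolding wronskian_def using norm_triangle_ineq4 [of "u n * slope f n" "slope u n * f n"] by linarith
    from mult_left_mono [OF this less_imp_le [OF \<delta>_pos [of n]]]
    show "norm (\<delta> n * cmod (wronskian u f n)) \<le> ?b n"
      using \<delta>_pos [of n] by (simp add: abs_mult distrib_left)
  qed
qed

text \<open>
  The substitution \<open>u n \<mapsto> (-1)^n u n\<close> turns the upper bound on \<open>\<alpha>\<close> into a lower bound.
\<close>

lemma wronskian_limit_upper:
  assumes u: "admissible \<alpha> u" and f: "admissible \<alpha> f"
    and upper: "\<And>n. n \<ge> N \<Longrightarrow> \<alpha> (Suc n) \<le> - 2 * (1 / \<delta> n + 1 / \<delta> (Suc n)) + C * \<delta> n" and C: "C \<ge> 0"
    and lim: "wronskian u f \<longlonglongrightarrow> c"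
  shows "c = 0"
proof -
  \<comment> \<open>Only values at successors enter, so the truncated subtraction is harmless.\<close>
  define \<beta> where "\<beta> n = - \<alpha> n - 2 * (1 / \<delta> (n - 1) + 1 / \<delta> n)" for n
  define alt where "alt v n = (-1) ^ n * v n" for v :: "nat \<Rightarrow> complex" and n :: nat
  have d: "defect \<beta> (alt v) n = (-1) ^ n * defect \<alpha> v n" for v n
    using \<delta>_pos [of n] \<delta>_pos [of "Suc n"]
    by (simp add: defect_def slope_def \<beta>_def alt_def field_simps)
  have adm: "admissible \<beta> (alt v)" if "admissible \<alpha> v" for v
    using that by (simp add: admissible_def d norm_mult norm_power alt_def)
  have w: "wronskian (alt u) (alt f) n = - wronskian u f n" for n
  proof -
    have "((-1)::complex) ^ n * (-1) ^ n = 1" by (simp flip: power_mult_distrib)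
    then show ?thesis
      using \<delta>_pos [of n] by (simp add: wronskian_def slope_def alt_def field_simps)
  qed
  have "- c = 0"
  proof (rule wronskian_limit_lower [OF adm [OF u] adm [OF f] _ C])
    show "wronskian (alt u) (alt f) \<longlonglongrightarrow> - c"
      using tendsto_minus [OF lim] by (simp add: w [abs_def])
    show "- C * \<delta> n \<le> \<beta> (Suc n)" if "n \<ge> N" for n
      using upper [OF that] by (simp add: \<beta>_def)
  qed
  then show ?thesis by simp
qed

text \<open>
  The difference equation expresses $\alpha_{n+1} u_{n+1}$ by two consecutive difference quotients
  and the defect, each of which becomes square-summable after multiplication by
  $\delta_n^{3/2}$.
\<close>

lemma wronskian_limit_large:
  assumes u: "admissible \<alpha> u" and f: "admissible \<alpha> f"
    and div: "\<not> summable (\<lambda>n. \<bar>\<alpha> (Suc n)\<bar> * \<delta> n ^ 3)"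
    and lim: "wronskian u f \<longlonglongrightarrow> c"
  shows "c = 0"
proof -
  have sq: "p * q \<le> p\<^sup>2 + q\<^sup>2" if "p \<ge> 0" "q \<ge> 0" for p q :: real
    using weighted_product_le [of 1 p q] that by simp
  have s1: "summable (\<lambda>n. \<delta> n ^ 3 * (cmod (slope v n))\<^sup>2)" if v: "admissible \<alpha> v" for v
  proof (rule summable_comparison_test' [where N = 0])
    show "summable (\<lambda>n. 2 * (\<delta> n * (cmod (v (Suc n)))\<^sup>2) + 2 * (\<delta> n * (cmod (v n))\<^sup>2))"
      using v by (intro summable_add summable_mult admissible_summable [OF v]) (simp add: admissible_def)
    fix n
    have "\<delta> n ^ 3 * (cmod (slope v n))\<^sup>2 = \<delta> n * (cmod (of_real (\<delta> n) * slope v n))\<^sup>2"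
      using \<delta>_pos [of n] by (simp add: norm_mult power_mult_distrib power2_eq_square power3_eq_cube)
    also have "\<dots> \<le> \<delta> n * (2 * (cmod (v (Suc n)))\<^sup>2 + 2 * (cmod (v n))\<^sup>2)"
      unfolding slope_mult
    proof (rule mult_left_mono)
      have "(cmod (v (Suc n) - v n))\<^sup>2 \<le> (cmod (v (Suc n)) + cmod (v n))\<^sup>2"
        by (intro power_mono norm_triangle_ineq4) simp
      also have "\<dots> \<le> 2 * (cmod (v (Suc n)))\<^sup>2 + 2 * (cmod (v n))\<^sup>2"
        using zero_le_power2 [of "cmod (v (Suc n)) - cmod (v n)"] by (simp add: power2_eq_square algebra_simps)
      finally show "(cmod (v (Suc n) - v n))\<^sup>2 \<le> 2 * (cmod (v (Suc n)))\<^sup>2 + 2 * (cmod (v n))\<^sup>2" .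
    qed (use \<delta>_pos [of n] in simp)
    finally show "norm (\<delta> n ^ 3 * (cmod (slope v n))\<^sup>2) \<le> 2 * (\<delta> n * (cmod (v (Suc n)))\<^sup>2) + 2 * (\<delta> n * (cmod (v n))\<^sup>2)"
      using \<delta>_pos [of n] by (simp add: abs_mult algebra_simps)
  qed
  have s2: "summable (\<lambda>n. \<delta> n ^ 3 * (cmod (slope v (Suc n)))\<^sup>2)" if v: "admissible \<alpha> v" for v
  proof (rule summable_comparison_test' [where N = 0])
    have "summable (\<lambda>n. \<delta> (Suc n) ^ 3 * (cmod (slope v (Suc n)))\<^sup>2)"
      using s1 [OF v] by (subst summable_Suc_iff)
    then show "summable (\<lambda>n. K ^ 3 * (\<delta> (Suc n) ^ 3 * (cmod (slope v (Suc n)))\<^sup>2))"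
      by (rule summable_mult)
    fix n
    have "\<delta> n ^ 3 \<le> (K * \<delta> (Suc n)) ^ 3"
      using \<delta>_left [of n] \<delta>_pos [of n] by (intro power_mono) auto
    from mult_right_mono [OF this, of "(cmod (slope v (Suc n)))\<^sup>2"]
    show "norm (\<delta> n ^ 3 * (cmod (slope v (Suc n)))\<^sup>2) \<le> K ^ 3 * (\<delta> (Suc n) ^ 3 * (cmod (slope v (Suc n)))\<^sup>2)"
      using \<delta>_pos [of n] by (simp add: abs_mult power_mult_distrib mult.assoc)
  qed
  have s3: "summable (\<lambda>n. \<delta> n ^ 3 * (cmod (of_real (\<alpha> (Suc n)) * v (Suc n)))\<^sup>2)" if v: "admissible \<alpha> v" for v
  proof (rule summable_comparison_test' [where N = 0])
    let ?b = "\<lambda>n. 3 * (\<delta> n ^ 3 * (cmod (slope v (Suc n)))\<^sup>2) + 3 * (\<delta> n ^ 3 * (cmod (slope v n))\<^sup>2)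
        + 3 * (B ^ 4 * ((cmod (defect \<alpha> v n))\<^sup>2 / \<delta> n))"
    show "summable ?b"
      using v by (intro summable_add summable_mult s1 s2) (simp_all add: admissible_def)
    fix n
    let ?s = "slope v (Suc n)" and ?t = "slope v n" and ?e = "defect \<alpha> v n"
    have "of_real (\<alpha> (Suc n)) * v (Suc n) = ?s - ?t - ?e" by (simp add: defect_def)
    then have "cmod (of_real (\<alpha> (Suc n)) * v (Suc n)) \<le> cmod ?s + cmod ?t + cmod ?e"
      by (metis add_right_mono norm_triangle_ineq4 order_trans)
    then have "(cmod (of_real (\<alpha> (Suc n)) * v (Suc n)))\<^sup>2 \<le> (cmod ?s + cmod ?t + cmod ?e)\<^sup>2"
      by (intro power_mono) auto
    also have "\<dots> \<le> 3 * (cmod ?s)\<^sup>2 + 3 * (cmod ?t)\<^sup>2 + 3 * (cmod ?e)\<^sup>2"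
      using zero_le_power2 [of "cmod ?s - cmod ?t"] zero_le_power2 [of "cmod ?s - cmod ?e"]
        zero_le_power2 [of "cmod ?t - cmod ?e"] by (simp add: power2_eq_square algebra_simps)
    finally have "\<delta> n ^ 3 * (cmod (of_real (\<alpha> (Suc n)) * v (Suc n)))\<^sup>2
        \<le> \<delta> n ^ 3 * (3 * (cmod ?s)\<^sup>2 + 3 * (cmod ?t)\<^sup>2 + 3 * (cmod ?e)\<^sup>2)"
      using \<delta>_pos [of n] by (intro mult_left_mono) auto
    moreover have "\<delta> n ^ 3 * (cmod ?e)\<^sup>2 \<le> B ^ 4 * ((cmod ?e)\<^sup>2 / \<delta> n)"
    proof -
      have "\<delta> n ^ 3 * (cmod ?e)\<^sup>2 = \<delta> n ^ 4 * ((cmod ?e)\<^sup>2 / \<delta> n)"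
        using \<delta>_pos [of n] by (simp add: power4_eq_xxxx power3_eq_cube)
      also have "\<dots> \<le> B ^ 4 * ((cmod ?e)\<^sup>2 / \<delta> n)"
        using \<delta>_pos [of n] \<delta>_bound [of n] by (intro mult_right_mono power_mono) auto
      finally show ?thesis .
    qed
    ultimately show "norm (\<delta> n ^ 3 * (cmod (of_real (\<alpha> (Suc n)) * v (Suc n)))\<^sup>2) \<le> ?b n"
      using \<delta>_pos [of n] by (simp add: abs_mult algebra_simps)
  qed
  have "(\<lambda>n. wronskian u f (Suc n)) \<longlonglongrightarrow> c" using lim by (rule LIMSEQ_Suc)
  then show ?thesis
  proof (rule limit_zero_if_weighted_summable [OF _ _ _ div])
    let ?b = "\<lambda>n. (\<delta> n ^ 3 * (cmod (of_real (\<alpha> (Suc n)) * u (Suc n)))\<^sup>2 + \<delta> n ^ 3 * (cmod (slope f (Suc n)))\<^sup>2)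
      + (\<delta> n ^ 3 * (cmod (slope u (Suc n)))\<^sup>2 + \<delta> n ^ 3 * (cmod (of_real (\<alpha> (Suc n)) * f (Suc n)))\<^sup>2)"
    show "summable (\<lambda>n. \<bar>\<alpha> (Suc n)\<bar> * \<delta> n ^ 3 * cmod (wronskian u f (Suc n)))"
    proof (rule summable_comparison_test' [where N = 0])
      show "summable ?b" by (intro summable_add s2 s3 u f)
      fix n
      let ?a = "complex_of_real (\<alpha> (Suc n))"
      have "\<bar>\<alpha> (Suc n)\<bar> * cmod (wronskian u f (Suc n))
          = cmod ((?a * u (Suc n)) * slope f (Suc n) - slope u (Suc n) * (?a * f (Suc n)))"
      proof -
        have "(?a * u (Suc n)) * slope f (Suc n) - slope u (Suc n) * (?a * f (Suc n)) = ?a * wronskian u f (Suc n)"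
          by (simp add: wronskian_def algebra_simps)
        then show ?thesis by (simp only: norm_mult norm_of_real)
      qed
      also have "\<dots> \<le> cmod (?a * u (Suc n)) * cmod (slope f (Suc n)) + cmod (slope u (Suc n)) * cmod (?a * f (Suc n))"
        by (rule order_trans [OF norm_triangle_ineq4]) (simp add: norm_mult)
      also have "\<dots> \<le> ((cmod (?a * u (Suc n)))\<^sup>2 + (cmod (slope f (Suc n)))\<^sup>2) + ((cmod (slope u (Suc n)))\<^sup>2 + (cmod (?a * f (Suc n)))\<^sup>2)"
        by (intro add_mono sq) auto
      finally have "\<delta> n ^ 3 * (\<bar>\<alpha> (Suc n)\<bar> * cmod (wronskian u f (Suc n))) \<le> \<delta> n ^ 3 * \<dots>"
        using \<delta>_pos [of n] by (intro mult_left_mono) auto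
      then show "norm (\<bar>\<alpha> (Suc n)\<bar> * \<delta> n ^ 3 * cmod (wronskian u f (Suc n))) \<le> ?b n"
        using \<delta>_pos [of n] by (simp add: abs_mult distrib_left mult_ac)
    qed
  qed (use \<delta>_pos in \<open>simp add: less_imp_le\<close>)
qed

end

section \<open>From the differential to the difference equation\<close>

lemma integral_squared_le:
  fixes h :: "real \<Rightarrow> real"
  assumes ab: "a < b" and h: "h integrable_on {a..b}" and h2: "(\<lambda>t. (h t)\<^sup>2) integrable_on {a..b}"
  shows "(integral {a..b} h)\<^sup>2 \<le> (b - a) * integral {a..b} (\<lambda>t. (h t)\<^sup>2)"
proof -
  define m where "m = integral {a..b} h"
  define c where "c = m / (b - a)"
  have "((\<lambda>t. (h t)\<^sup>2 - 2 * c * h t + c\<^sup>2) has_integral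
      integral {a..b} (\<lambda>t. (h t)\<^sup>2) - 2 * c * m + (b - a) * c\<^sup>2) {a..b}"
    unfolding m_def
    by (intro has_integral_add has_integral_diff has_integral_mult_right integrable_integral h h2)
       (use ab has_integral_const_real [of "c\<^sup>2" a b] in simp)
  moreover have "(h t)\<^sup>2 - 2 * c * h t + c\<^sup>2 = (h t - c)\<^sup>2" for t by (simp add: power2_diff)
  ultimately have "((\<lambda>t. (h t - c)\<^sup>2) has_integral
      integral {a..b} (\<lambda>t. (h t)\<^sup>2) - 2 * c * m + (b - a) * c\<^sup>2) {a..b}"
    by (simp only:)
  then have "0 \<le> integral {a..b} (\<lambda>t. (h t)\<^sup>2) - 2 * c * m + (b - a) * c\<^sup>2"
    by (rule has_integral_nonneg) simp
  moreover have cm: "(b - a) * c = m" using ab by (simp add: c_def)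
  then have "(b - a) * c\<^sup>2 = c * m" by (simp add: power2_eq_square mult_ac flip: cm)
  ultimately have "c * m \<le> integral {a..b} (\<lambda>t. (h t)\<^sup>2)" by (simp add: mult.assoc)
  then have "(b - a) * (c * m) \<le> (b - a) * integral {a..b} (\<lambda>t. (h t)\<^sup>2)"
    using ab by (intro mult_left_mono) auto
  moreover have "(b - a) * (c * m) = m\<^sup>2" unfolding mult.assoc [symmetric] cm by (simp add: power2_eq_square)
  ultimately show ?thesis by (simp add: m_def)
qed

text \<open>
  The value of an affine function at an endpoint is controlled by its $L^2$ norm: four times the
  integral exceeds the left-hand side by $12 (b - a) |v/2 - (b - a) p/3|^2$.
\<close>

lemma integral_affine_squared_ge:
  fixes v p :: complex
  assumes ab: "a < b"
  shows "(b - a) * (cmod v)\<^sup>2 \<le> 4 * integral {a..b} (\<lambda>t. (cmod (v - of_real (b - t) * p))\<^sup>2)"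
proof -
  define R where "R = Re v * Re p + Im v * Im p"
  define G where "G t = (cmod v)\<^sup>2 * t + R * (b - t)\<^sup>2 - (cmod p)\<^sup>2 * (b - t) ^ 3 / 3" for t
  have sq: "(cmod (v - of_real s * p))\<^sup>2 = (cmod v)\<^sup>2 - 2 * R * s + (cmod p)\<^sup>2 * s\<^sup>2" for s
    unfolding cmod_power2 R_def by (simp add: power2_eq_square algebra_simps)
  have "(G has_real_derivative (cmod v)\<^sup>2 - 2 * R * (b - t) + (cmod p)\<^sup>2 * (b - t)\<^sup>2) (at t within {a..b})" for t
    unfolding G_def by (auto intro!: derivative_eq_intros simp: algebra_simps)
  then have "((\<lambda>t. (cmod v)\<^sup>2 - 2 * R * (b - t) + (cmod p)\<^sup>2 * (b - t)\<^sup>2) has_integral G b - G a) {a..b}"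
    by (intro fundamental_theorem_of_calculus less_imp_le [OF ab])
       (simp add: has_real_derivative_iff_has_vector_derivative)
  then have I: "integral {a..b} (\<lambda>t. (cmod (v - of_real (b - t) * p))\<^sup>2) = G b - G a"
    unfolding sq by (rule integral_unique)
  have "4 * (G b - G a) - (b - a) * (cmod v)\<^sup>2
      = (b - a) * (12 * (Re v / 2 - (b - a) * Re p / 3)\<^sup>2 + 12 * (Im v / 2 - (b - a) * Im p / 3)\<^sup>2)"
    unfolding G_def R_def cmod_power2 by (simp add: power2_eq_square power3_eq_cube field_simps)
  also have "\<dots> \<ge> 0" using ab by (intro mult_nonneg_nonneg add_nonneg_nonneg) auto
  finally show ?thesis unfolding I by linarith
qed

locale comparable_grid = grid x \<alpha> + step_sizes "\<lambda>n. x (Suc n) - x n" K B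
  for x \<alpha> :: "nat \<Rightarrow> real" and K B :: real
begin

abbreviation piece :: "nat \<Rightarrow> real set" where "piece n \<equiv> {x n..x (Suc n)}"

lemma l2_piece_integrable:
  assumes "f \<in> l2 {0<..}"
  shows "(\<lambda>t. (cmod (f t))\<^sup>2) integrable_on piece n"
    and "summable (\<lambda>n. integral (piece n) (\<lambda>t. (cmod (f t))\<^sup>2))"
proof -
  let ?F = "\<lambda>t. (cmod (f t))\<^sup>2"
  have "?F absolutely_integrable_on {0<..}"
    using l2_int [OF assms] by (simp add: set_integrable_def integrable_restrict_space [OF sets_P'])
  then have "?F absolutely_integrable_on {0..}"
    by (rule absolutely_integrable_spike_set) (auto intro: negligible_subset [of "{0}"])
  then have i: "?F integrable_on {0..}" by (rule set_lebesgue_integral_eq_integral)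
  have sub: "?F integrable_on {a..b}" if "0 \<le> a" for a b
    by (rule integrable_on_subinterval [OF i]) (use that in auto)
  show pi: "?F integrable_on piece n" for n by (rule sub [OF x_nonneg])
  have sum: "(\<Sum>i<N. integral (piece i) ?F) = integral {0..x N} ?F" for N
  proof (induction N)
    case 0
    then show ?case by (simp add: x0)
  next
    case (Suc N)
    then show ?case
      using Henstock_Kurzweil_Integration.integral_combine [OF x_nonneg less_imp_le [OF x_less] sub [OF order_refl], of N]
      by simp
  qed
  show "summable (\<lambda>n. integral (piece n) ?F)"
  proof (rule bounded_imp_summable)
    fix n
    show "0 \<le> integral (piece n) ?F" by (rule Henstock_Kurzweil_Integration.integral_nonneg [OF pi]) simp
    show "(\<Sum>i\<le>n. integral (piece i) ?F) \<le> integral {0..} ?F"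
      unfolding lessThan_Suc_atMost [symmetric] sum
      by (rule integral_subset_le [OF _ sub i]) auto
  qed
qed

text \<open>
  The derivative varies by at most \<open>m n\<close> inside an interval. This bounds its distance from
  the difference quotient and the error of the first-order Taylor expansion at the right endpoint.
\<close>

lemma piece_estimates:
  assumes s: "sol v u u1" and v: "v \<in> l2 {0<..}"
  defines "m \<equiv> \<lambda>n. integral (piece n) (\<lambda>t. cmod (v t))"
  shows "cmod (slope (\<lambda>n. u (x n)) n - u1 (x n)) \<le> m n"
    and "cmod (slope (\<lambda>n. u (x n)) n - (u1 (x n) - integral (piece n) v)) \<le> m n"
    and "t \<in> piece n \<Longrightarrow> cmod (u t - (u (x (Suc n)) - of_real (x (Suc n) - t) * (u1 (x n) - integral (piece n) v)))
      \<le> (x (Suc n) - x n) * m n"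
    and "(m n)\<^sup>2 \<le> (x (Suc n) - x n) * integral (piece n) (\<lambda>t. (cmod (v t))\<^sup>2)"
    and "0 \<le> m n"
proof -
  let ?a = "x n" and ?b = "x (Suc n)"
  define L where "L t = u1 ?a - integral {?a..t} v" for t
  have ab: "?a < ?b" by (rule x_less)
  have lv: "loc_int v" by (rule l2_loc_int [OF v])
  have vi: "v integrable_on {c..d}" and nvi: "(\<lambda>t. cmod (v t)) integrable_on {c..d}" if "?a \<le> c" for c d
    using abs_int_integrable [OF loc_intD [OF lv]] abs_int_norm_integrable [OF loc_intD [OF lv]]
      that x_nonneg [of n] by auto
  have Lc: "continuous_on (piece n) L" unfolding L_def by (rule slope_continuous [OF lv])
  have Li: "L integrable_on {c..d}" if "?a \<le> c" "d \<le> ?b" for c d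
    by (rule integrable_continuous_interval, rule continuous_on_subset [OF Lc]) (use that in auto)
  have Ldiff: "cmod (L d - L c) \<le> m n" if "?a \<le> c" "c \<le> d" "d \<le> ?b" for c d
  proof -
    have "L c - L d = integral {c..d} v"
      using Henstock_Kurzweil_Integration.integral_combine [OF that(1,2) vi [OF order_refl]]
      by (simp add: L_def algebra_simps)
    then have "cmod (L d - L c) = cmod (integral {c..d} v)" by (simp add: norm_minus_commute)
    also have "\<dots> \<le> integral {c..d} (\<lambda>t. cmod (v t))"
      by (rule integral_norm_bound_integral [OF vi nvi]) (use that in auto)
    also have "\<dots> \<le> m n"
      unfolding m_def by (rule integral_subset_le) (use that nvi in auto)
    finally show ?thesis .
  qed
  have udiff: "u d - u c = integral {c..d} L" if "?a \<le> c" "c \<le> d" "d \<le> ?b" for c d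
    using Henstock_Kurzweil_Integration.integral_combine [OF that(1,2) Li [OF order_refl that(3)]]
      sol_u [OF s, of c n] sol_u [OF s, of d n] that by (simp add: L_def [abs_def] algebra_simps)
  have taylor: "cmod (u d - u c - of_real (d - c) * L e) \<le> (d - c) * m n"
    if cd: "?a \<le> c" "c \<le> d" "d \<le> ?b" and e: "e \<in> piece n" for c d e
  proof -
    have "integral {c..d} (\<lambda>t. L t - L e) = integral {c..d} L - integral {c..d} (\<lambda>t. L e)"
      by (rule integral_diff [OF Li integrable_const_ivl]) (use cd in auto)
    then have "u d - u c - of_real (d - c) * L e = integral {c..d} (\<lambda>t. L t - L e)"
      using udiff [OF cd] cd by (simp add: scaleR_conv_of_real)
    also have "cmod \<dots> \<le> integral {c..d} (\<lambda>t. m n)"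
    proof (rule integral_norm_bound_integral)
      show "(\<lambda>t. L t - L e) integrable_on {c..d}"
        by (intro integrable_diff Li cd integrable_const_ivl)
      fix t assume t: "t \<in> {c..d}"
      show "cmod (L t - L e) \<le> m n"
      proof (cases "e \<le> t")
        case True
        then show ?thesis using Ldiff [of e t] t cd e by auto
      next
        case False
        then show ?thesis using Ldiff [of t e] t cd e by (auto simp: norm_minus_commute)
      qed
    qed (rule integrable_const_ivl)
    also have "\<dots> = (d - c) * m n" using cd by simp
    finally show ?thesis .
  qed
  have sl: "cmod (slope (\<lambda>n. u (x n)) n - L e) \<le> m n" if e: "e \<in> piece n" for e
  proof -
    have "of_real (?b - ?a) * (slope (\<lambda>n. u (x n)) n - L e) = u ?b - u ?a - of_real (?b - ?a) * L e"
      using slope_mult [of n "\<lambda>n. u (x n)"] by (simp add: right_diff_distrib)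
    moreover have "cmod (of_real (?b - ?a) * z) = (?b - ?a) * cmod z" for z
      using ab by (simp add: norm_mult flip: of_real_diff)
    ultimately have "(?b - ?a) * cmod (slope (\<lambda>n. u (x n)) n - L e) = cmod (u ?b - u ?a - of_real (?b - ?a) * L e)"
      by metis
    also have "\<dots> \<le> (?b - ?a) * m n" using taylor [of ?a ?b e] ab e by simp
    finally show ?thesis using ab by simp
  qed
  show "cmod (slope (\<lambda>n. u (x n)) n - u1 ?a) \<le> m n"
    using sl [of ?a] ab by (simp add: L_def)
  show "cmod (slope (\<lambda>n. u (x n)) n - (u1 ?a - integral (piece n) v)) \<le> m n"
    using sl [of ?b] ab by (simp add: L_def)
  show m0: "0 \<le> m n" unfolding m_def by (rule Henstock_Kurzweil_Integration.integral_nonneg [OF nvi]) auto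
  show "(m n)\<^sup>2 \<le> (?b - ?a) * integral (piece n) (\<lambda>t. (cmod (v t))\<^sup>2)"
    unfolding m_def by (rule integral_squared_le [OF ab nvi l2_piece_integrable(1) [OF v]]) simp
  show "cmod (u t - (u ?b - of_real (?b - t) * (u1 ?a - integral (piece n) v))) \<le> (?b - ?a) * m n"
    if t: "t \<in> piece n"
  proof -
    have "u t - (u ?b - of_real (?b - t) * L ?b) = - (u ?b - u t - of_real (?b - t) * L ?b)"
      by (simp only: minus_diff_eq diff_diff_eq2) (simp add: algebra_simps)
    then have "cmod (u t - (u ?b - of_real (?b - t) * L ?b)) = cmod (u ?b - u t - of_real (?b - t) * L ?b)"
      by (simp only: norm_minus_cancel)
    also have "\<dots> \<le> (?b - t) * m n" using taylor [of t ?b ?b] t ab by simp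
    also have "\<dots> \<le> (?b - ?a) * m n" using t m0 by (intro mult_right_mono) auto
    finally show ?thesis by (simp add: L_def)
  qed
qed

lemma node_value_estimate:
  assumes s: "sol v u u1" and v: "v \<in> l2 {0<..}" and u: "u \<in> l2 {0<..}"
  shows "(x (Suc n) - x n) * (cmod (u (x (Suc n))))\<^sup>2
    \<le> 8 * integral (piece n) (\<lambda>t. (cmod (u t))\<^sup>2) + 8 * B ^ 4 * integral (piece n) (\<lambda>t. (cmod (v t))\<^sup>2)"
proof -
  let ?d = "x (Suc n) - x n"
  let ?V = "integral (piece n) (\<lambda>t. (cmod (v t))\<^sup>2)"
  define m where "m = integral (piece n) (\<lambda>t. cmod (v t))"
  define p where "p = u1 (x n) - integral (piece n) v"
  define l where "l t = u (x (Suc n)) - of_real (x (Suc n) - t) * p" for t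
  note pe = piece_estimates [OF s v, where n = n, folded m_def p_def]
  have d: "?d > 0" using x_less [of n] by simp
  have V0: "?V \<ge> 0" by (rule Henstock_Kurzweil_Integration.integral_nonneg [OF l2_piece_integrable(1) [OF v]]) simp
  have lc: "continuous_on (piece n) l" unfolding l_def by (intro continuous_intros)
  have "integral (piece n) (\<lambda>t. (cmod (l t))\<^sup>2)
      \<le> integral (piece n) (\<lambda>t. 2 * (cmod (u t))\<^sup>2 + 2 * (?d * m)\<^sup>2)"
  proof (rule integral_le)
    show "(\<lambda>t. (cmod (l t))\<^sup>2) integrable_on piece n"
      by (intro integrable_continuous_interval continuous_intros lc)
    show "(\<lambda>t. 2 * (cmod (u t))\<^sup>2 + 2 * (?d * m)\<^sup>2) integrable_on piece n"
      by (intro integrable_add integrable_on_mult_right l2_piece_integrable(1) [OF u] integrable_const_ivl)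
    fix t assume t: "t \<in> piece n"
    have "cmod (l t - u t) \<le> ?d * m"
      using pe(3) [OF t] by (simp add: l_def norm_minus_commute)
    then have "(cmod (l t - u t))\<^sup>2 \<le> (?d * m)\<^sup>2" by (intro power_mono) auto
    then show "(cmod (l t))\<^sup>2 \<le> 2 * (cmod (u t))\<^sup>2 + 2 * (?d * m)\<^sup>2"
      using cmod_add_squared_le [of "u t" "l t - u t"] by simp
  qed
  also have "\<dots> = 2 * integral (piece n) (\<lambda>t. (cmod (u t))\<^sup>2) + 2 * (?d * m)\<^sup>2 * ?d"
    using d l2_piece_integrable(1) [OF u, of n]
    by (subst integral_add) (auto intro!: integrable_on_mult_right)
  finally have le: "integral (piece n) (\<lambda>t. (cmod (l t))\<^sup>2)
      \<le> 2 * integral (piece n) (\<lambda>t. (cmod (u t))\<^sup>2) + 2 * (?d * m)\<^sup>2 * ?d" .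
  have "(?d * m)\<^sup>2 * ?d \<le> ?d ^ 4 * ?V"
  proof -
    have "(?d * m)\<^sup>2 * ?d = ?d ^ 3 * m\<^sup>2" by (simp add: power2_eq_square power3_eq_cube)
    also have "\<dots> \<le> ?d ^ 3 * (?d * ?V)" using pe(4) d by (intro mult_left_mono) auto
    finally show ?thesis by (simp add: power3_eq_cube power4_eq_xxxx mult.assoc)
  qed
  also have "?d ^ 4 * ?V \<le> B ^ 4 * ?V"
    using d \<delta>_bound [of n] V0 by (intro mult_right_mono power_mono) auto
  finally have "(?d * m)\<^sup>2 * ?d \<le> B ^ 4 * ?V" .
  with le have "integral (piece n) (\<lambda>t. (cmod (l t))\<^sup>2) \<le> 2 * integral (piece n) (\<lambda>t. (cmod (u t))\<^sup>2) + 2 * (B ^ 4 * ?V)"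
    by simp
  with integral_affine_squared_ge [OF x_less, of n "u (x (Suc n))" p]
  show ?thesis unfolding l_def by simp
qed

lemma sol_admissible:
  assumes s: "sol v u u1" and v: "v \<in> l2 {0<..}" and u: "u \<in> l2 {0<..}"
  shows "admissible \<alpha> (\<lambda>n. u (x n))"
  unfolding admissible_def
proof
  let ?U = "\<lambda>n. integral (piece n) (\<lambda>t. (cmod (u t))\<^sup>2)" and ?V = "\<lambda>n. integral (piece n) (\<lambda>t. (cmod (v t))\<^sup>2)"
  note sU = l2_piece_integrable(2) [OF u] and sV = l2_piece_integrable(2) [OF v]
  show "summable (\<lambda>n. (x (Suc n) - x n) * (cmod (u (x (Suc n))))\<^sup>2)"
  proof (rule summable_comparison_test' [where N = 0])
    show "summable (\<lambda>n. 8 * ?U n + 8 * B ^ 4 * ?V n)" by (intro summable_add summable_mult sU sV)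
    show "norm ((x (Suc n) - x n) * (cmod (u (x (Suc n))))\<^sup>2) \<le> 8 * ?U n + 8 * B ^ 4 * ?V n" for n
      using node_value_estimate [OF assms, of n] x_less [of n] by (simp add: abs_mult)
  qed
  show "summable (\<lambda>n. (cmod (defect \<alpha> (\<lambda>n. u (x n)) n))\<^sup>2 / (x (Suc n) - x n))"
  proof (rule summable_comparison_test' [where N = 0])
    have "summable (\<lambda>n. ?V (Suc n))" using sV by (rule summable_Suc_iff [THEN iffD2])
    then show "summable (\<lambda>n. 2 * K * ?V (Suc n) + 2 * ?V n)" by (intro summable_add summable_mult sV)
    fix n
    let ?d = "x (Suc n) - x n" and ?d' = "x (Suc (Suc n)) - x (Suc n)" and ?e = "defect \<alpha> (\<lambda>n. u (x n)) n"
    define m where "m n = integral (piece n) (\<lambda>t. cmod (v t))" for n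
    note pe = piece_estimates [OF s v, folded m_def]
    have d: "?d > 0" "?d' > 0" using x_less [of n] x_less [of "Suc n"] by simp_all
    have V0: "?V (Suc n) \<ge> 0"
      by (rule Henstock_Kurzweil_Integration.integral_nonneg [OF l2_piece_integrable(1) [OF v]]) simp
    have "?e = (slope (\<lambda>n. u (x n)) (Suc n) - u1 (x (Suc n))) - (slope (\<lambda>n. u (x n)) n - (u1 (x n) - integral (piece n) v))"
      using sol_jump [OF s, of n] by (simp add: defect_def)
    then have "cmod ?e \<le> m (Suc n) + m n"
      using norm_triangle_le_diff [OF add_mono [OF pe(1) [of "Suc n"] pe(2) [of n]]] by simp
    then have "(cmod ?e)\<^sup>2 \<le> (m (Suc n) + m n)\<^sup>2" by (intro power_mono) auto
    also have "\<dots> \<le> 2 * (m (Suc n))\<^sup>2 + 2 * (m n)\<^sup>2"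
      using zero_le_power2 [of "m (Suc n) - m n"] by (simp add: power2_eq_square algebra_simps)
    also have "\<dots> \<le> 2 * (?d' * ?V (Suc n)) + 2 * (?d * ?V n)"
      using pe(4) [of "Suc n"] pe(4) [of n] by simp
    also have "\<dots> \<le> 2 * ((K * ?d) * ?V (Suc n)) + 2 * (?d * ?V n)"
      using mult_right_mono [OF \<delta>_right [of n] V0] by simp
    finally have "(cmod ?e)\<^sup>2 \<le> (2 * K * ?V (Suc n) + 2 * ?V n) * ?d" by (simp add: algebra_simps)
    then show "norm ((cmod ?e)\<^sup>2 / ?d) \<le> 2 * K * ?V (Suc n) + 2 * ?V n"
      using d(1) by (simp add: pos_divide_le_eq)
  qed
qed

lemma wronskian_approximates_bracket:
  assumes s: "sol g u u1" "sol h w w1" and l2: "g \<in> l2 {0<..}" "h \<in> l2 {0<..}" "u \<in> l2 {0<..}" "w \<in> l2 {0<..}"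
  shows "(\<lambda>n. wronskian (\<lambda>n. u (x n)) (\<lambda>n. w (x n)) n - (u (x n) * w1 (x n) - u1 (x n) * w (x n))) \<longlonglongrightarrow> 0"
proof (rule Lim_null_comparison)
  let ?d = "\<lambda>n. x (Suc n) - x n"
  let ?G = "\<lambda>n. integral (piece n) (\<lambda>t. (cmod (g t))\<^sup>2)" and ?H = "\<lambda>n. integral (piece n) (\<lambda>t. (cmod (h t))\<^sup>2)"
  let ?b = "\<lambda>n. (?d n * (cmod (u (x n)))\<^sup>2 + ?H n) + (?d n * (cmod (w (x n)))\<^sup>2 + ?G n)"
  have "summable ?b"
    using admissible_summable [OF sol_admissible [OF s(1) l2(1,3)]]
      admissible_summable [OF sol_admissible [OF s(2) l2(2,4)]]
    by (intro summable_add l2_piece_integrable(2) l2)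
  then show "?b \<longlonglongrightarrow> 0" by (rule summable_LIMSEQ_zero)
  have est: "cmod a * cmod b \<le> ?d n * (cmod a)\<^sup>2 + V" if "cmod b \<le> m" "m\<^sup>2 \<le> ?d n * V" for a b :: complex and m V n
  proof -
    have d: "?d n > 0" using x_less [of n] by simp
    have "cmod a * cmod b \<le> ?d n * (cmod a)\<^sup>2 + (cmod b)\<^sup>2 / ?d n" by (rule weighted_product_le [OF d]) auto
    moreover have "(cmod b)\<^sup>2 \<le> m\<^sup>2" using that(1) by (intro power_mono) auto
    then have "(cmod b)\<^sup>2 / ?d n \<le> V" using that(2) d by (simp add: pos_divide_le_eq mult.commute)
    ultimately show ?thesis by linarith
  qed
  show "\<forall>\<^sub>F n in sequentially. norm (wronskian (\<lambda>n. u (x n)) (\<lambda>n. w (x n)) n - (u (x n) * w1 (x n) - u1 (x n) * w (x n))) \<le> ?b n"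
  proof (rule always_eventually, rule allI)
    fix n
    let ?su = "slope (\<lambda>n. u (x n)) n" and ?sw = "slope (\<lambda>n. w (x n)) n"
    have "wronskian (\<lambda>n. u (x n)) (\<lambda>n. w (x n)) n - (u (x n) * w1 (x n) - u1 (x n) * w (x n))
        = u (x n) * (?sw - w1 (x n)) - w (x n) * (?su - u1 (x n))"
      by (simp add: wronskian_def algebra_simps)
    also have "norm \<dots> \<le> cmod (u (x n)) * cmod (?sw - w1 (x n)) + cmod (w (x n)) * cmod (?su - u1 (x n))"
      by (rule order_trans [OF norm_triangle_ineq4]) (simp add: norm_mult)
    also have "\<dots> \<le> ?b n"
      by (intro add_mono est [OF piece_estimates(1) [OF s(2) l2(2)] piece_estimates(4) [OF s(2) l2(2)]]
          est [OF piece_estimates(1) [OF s(1) l2(1)] piece_estimates(4) [OF s(1) l2(1)]])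
    finally show "norm (wronskian (\<lambda>n. u (x n)) (\<lambda>n. w (x n)) n - (u (x n) * w1 (x n) - u1 (x n) * w (x n))) \<le> ?b n" .
  qed
qed

theorem self_adjoint_if:
  assumes "\<not> summable (\<lambda>n. \<bar>\<alpha> (Suc n)\<bar> * (x (Suc n) - x n) ^ 3) \<or>
    (\<exists>C\<ge>0. \<exists>N. \<forall>n\<ge>N. \<alpha> (Suc n) \<le> - 2 * (1 / (x (Suc n) - x n) + 1 / (x (Suc (Suc n)) - x (Suc n))) + C * (x (Suc n) - x n)) \<or>
    (\<exists>C\<ge>0. \<exists>N. \<forall>n\<ge>N. \<alpha> (Suc n) \<ge> - C * (x (Suc n) - x n))"
  shows "self_adjoint {0<..} (hamiltonian x \<alpha>)"
proof (rule self_adjoint_if_brackets_vanish)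
  fix g u u1 h w w1 c
  assume s: "sol g u u1" "sol h w w1" and l2: "g \<in> l2 {0<..}" "h \<in> l2 {0<..}" "u \<in> l2 {0<..}" "w \<in> l2 {0<..}"
    and lim: "(\<lambda>n. u (x n) * w1 (x n) - u1 (x n) * w (x n)) \<longlonglongrightarrow> c"
  have W: "wronskian (\<lambda>n. u (x n)) (\<lambda>n. w (x n)) \<longlonglongrightarrow> c"
    using tendsto_add [OF wronskian_approximates_bracket [OF s l2] lim] by simp
  note ad = sol_admissible [OF s(1) l2(1,3)] sol_admissible [OF s(2) l2(2,4)]
  from assms show "c = 0"
  proof (elim disjE exE conjE)
    assume "\<not> summable (\<lambda>n. \<bar>\<alpha> (Suc n)\<bar> * (x (Suc n) - x n) ^ 3)"
    then show ?thesis by (rule wronskian_limit_large [OF ad _ W])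
  next
    fix C N assume "0 \<le> C" "\<forall>n\<ge>N. \<alpha> (Suc n) \<le> - 2 * (1 / (x (Suc n) - x n) + 1 / (x (Suc (Suc n)) - x (Suc n))) + C * (x (Suc n) - x n)"
    then show ?thesis using wronskian_limit_upper [OF ad, of N C c] W by blast
  next
    fix C N assume "0 \<le> C" "\<forall>n\<ge>N. \<alpha> (Suc n) \<ge> - C * (x (Suc n) - x n)"
    then show ?thesis using wronskian_limit_lower [OF ad, of N C c] W by blast
  qed
qed

end

section \<open>The step sizes of the theorem\<close>

lemma powr_between:
  fixes r e :: real
  assumes "1 \<le> r" "r \<le> 2"
  shows "2 powr (- \<bar>e\<bar>) \<le> r powr e" "r powr e \<le> 2 powr \<bar>e\<bar>"
proof -
  have "ln r \<le> ln 2" "0 \<le> ln r" using assms by auto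
  then have "\<bar>e * ln r\<bar> \<le> \<bar>e\<bar> * ln 2" by (simp add: abs_mult mult_left_mono)
  then have "- (\<bar>e\<bar> * ln 2) \<le> e * ln r" "e * ln r \<le> \<bar>e\<bar> * ln 2" by linarith+
  then show "2 powr (- \<bar>e\<bar>) \<le> r powr e" "r powr e \<le> 2 powr \<bar>e\<bar>"
    using assms by (auto simp: powr_def)
qed

lemma ln_ratio_bounds:
  assumes "n \<ge> (2::nat)"
  shows "1 \<le> ln (real n + 1) / ln (real n)" "ln (real n + 1) / ln (real n) \<le> 2"
proof -
  have ln0: "ln (real n) > 0" using assms by simp
  have "ln (real n) \<le> ln (real n + 1)" using assms by simp
  then show "1 \<le> ln (real n + 1) / ln (real n)" using ln0 by simp
  have "real n + 1 \<le> real n * 2" using assms by simp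
  also have "\<dots> \<le> real n * real n" using assms by (intro mult_left_mono) auto
  finally have "ln (real n + 1) \<le> ln (real n * real n)" using assms by (subst ln_le_cancel_iff) auto
  also have "\<dots> = 2 * ln (real n)" using assms by (simp add: ln_mult)
  finally show "ln (real n + 1) / ln (real n) \<le> 2" using ln0 by (simp add: divide_le_eq)
qed

text \<open>
  The quotients $(n+1)/n$ and $\ln(n+1)/\ln n$ lie between 1 and 2, so their powers are bounded
  from both sides whatever the signs of the exponents are.
\<close>

lemma power_log_ratio:
  fixes \<gamma> \<eta> :: real
  defines "f \<equiv> \<lambda>n. real n powr \<gamma> * ln (real n) powr \<eta>"
  assumes n: "n \<ge> 2"
  shows "f n \<le> 2 powr (\<bar>\<gamma>\<bar> + \<bar>\<eta>\<bar>) * f (Suc n)" "f (Suc n) \<le> 2 powr (\<bar>\<gamma>\<bar> + \<bar>\<eta>\<bar>) * f n"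
proof -
  define q where "q = ((real n + 1) / real n) powr \<gamma> * (ln (real n + 1) / ln (real n)) powr \<eta>"
  have n0: "real n > 0" "ln (real n) > 0" "ln (real n + 1) > 0" using n by auto
  have f0: "f n > 0" using n0 by (simp add: f_def)
  have fS: "f (Suc n) = q * f n"
    using n0 by (simp add: f_def q_def powr_divide add.commute [of 1])
  have r: "1 \<le> (real n + 1) / real n" "(real n + 1) / real n \<le> 2" using n by (simp_all add: field_simps)
  note b = powr_between [OF r, of \<gamma>] powr_between [OF ln_ratio_bounds [OF n], of \<eta>]
  have "q \<le> 2 powr \<bar>\<gamma>\<bar> * 2 powr \<bar>\<eta>\<bar>" unfolding q_def by (intro mult_mono b) auto
  then have q1: "q \<le> 2 powr (\<bar>\<gamma>\<bar> + \<bar>\<eta>\<bar>)" by (simp add: powr_add)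
  have "2 powr (- \<bar>\<gamma>\<bar>) * 2 powr (- \<bar>\<eta>\<bar>) \<le> q" unfolding q_def by (intro mult_mono b) auto
  then have "2 powr (- (\<bar>\<gamma>\<bar> + \<bar>\<eta>\<bar>)) \<le> q" by (simp add: powr_add [symmetric])
  then have "2 powr (\<bar>\<gamma>\<bar> + \<bar>\<eta>\<bar>) * 2 powr (- (\<bar>\<gamma>\<bar> + \<bar>\<eta>\<bar>)) \<le> 2 powr (\<bar>\<gamma>\<bar> + \<bar>\<eta>\<bar>) * q"
    by (intro mult_left_mono) auto
  then have q2: "1 \<le> 2 powr (\<bar>\<gamma>\<bar> + \<bar>\<eta>\<bar>) * q"
    by (simp flip: powr_add)
  show "f (Suc n) \<le> 2 powr (\<bar>\<gamma>\<bar> + \<bar>\<eta>\<bar>) * f n"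
    unfolding fS using q1 f0 by (intro mult_right_mono) auto
  show "f n \<le> 2 powr (\<bar>\<gamma>\<bar> + \<bar>\<eta>\<bar>) * f (Suc n)"
    unfolding fS using mult_right_mono [OF q2 less_imp_le [OF f0]] by (simp add: mult.assoc)
qed

text \<open>
  For negative \<open>\<eta>\<close> the logarithm is estimated by a power of \<open>n\<close> whose exponent is
  chosen so that the two powers of \<open>n\<close> cancel.
\<close>

lemma power_log_ge:
  fixes \<gamma> \<eta> :: real
  assumes "\<gamma> > 0"
  shows "\<exists>c>0. \<forall>n\<ge>2. c \<le> real n powr \<gamma> * ln (real n) powr \<eta>"
proof (cases "\<eta> \<ge> 0")
  case True
  show ?thesis
  proof (intro exI [of _ "ln 2 powr \<eta>"] conjI allI impI)
    fix n :: nat assume n: "n \<ge> 2"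
    have "1 * ln 2 powr \<eta> \<le> real n powr \<gamma> * ln (real n) powr \<eta>"
    proof (rule mult_mono)
      show "1 \<le> real n powr \<gamma>" using n assms by (simp add: ge_one_powr_ge_zero)
      show "ln 2 powr \<eta> \<le> ln (real n) powr \<eta>" using n True by (intro powr_mono2) auto
    qed auto
    then show "ln 2 powr \<eta> \<le> real n powr \<gamma> * ln (real n) powr \<eta>" by simp
  qed simp
next
  case False
  define s where "s = \<gamma> / (- \<eta>)"
  have s: "s > 0" unfolding s_def using assms False by (intro divide_pos_pos) auto
  have s\<eta>: "s * \<eta> = - \<gamma>" using False by (simp add: s_def)
  show ?thesis
  proof (intro exI [of _ "s powr (- \<eta>)"] conjI allI impI)
    fix n :: nat assume n: "n \<ge> 2"
    have "ln (real n) \<le> real n powr s / s" using n s by (intro ln_powr_bound) auto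
    then have "(real n powr s / s) powr \<eta> \<le> ln (real n) powr \<eta>"
      using n False by (intro powr_mono2') auto
    moreover have "(real n powr s / s) powr \<eta> = real n powr (- \<gamma>) * s powr (- \<eta>)"
      using s n by (simp add: powr_divide powr_powr s\<eta> powr_minus_divide)
    ultimately have "real n powr \<gamma> * (real n powr (- \<gamma>) * s powr (- \<eta>)) \<le> real n powr \<gamma> * ln (real n) powr \<eta>"
      by (intro mult_left_mono) auto
    moreover have "real n powr \<gamma> * (real n powr (- \<gamma>) * s powr (- \<eta>)) = s powr (- \<eta>)"
      using n by (simp add: powr_minus)
    ultimately show "s powr (- \<eta>) \<le> real n powr \<gamma> * ln (real n) powr \<eta>" by simp
  qed (use s in simp)
qed

lemma power_log_le:
  fixes \<gamma> \<eta> :: real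
  assumes "\<gamma> < 1 \<or> \<gamma> = 1 \<and> \<eta> \<le> 0"
  shows "\<exists>c>0. \<forall>n\<ge>2. real n powr \<gamma> * ln (real n) powr \<eta> \<le> c * real n"
proof (cases "\<eta> \<le> 0")
  case True
  show ?thesis
  proof (intro exI [of _ "ln 2 powr \<eta>"] conjI allI impI)
    fix n :: nat assume n: "n \<ge> 2"
    have "real n powr \<gamma> * ln (real n) powr \<eta> \<le> real n powr 1 * ln 2 powr \<eta>"
    proof (rule mult_mono)
      show "real n powr \<gamma> \<le> real n powr 1" using n assms by (intro powr_mono) auto
      show "ln (real n) powr \<eta> \<le> ln 2 powr \<eta>" using n True by (intro powr_mono2') auto
    qed auto
    then show "real n powr \<gamma> * ln (real n) powr \<eta> \<le> ln 2 powr \<eta> * real n" using n by (simp add: mult.commute)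
  qed simp
next
  case False
  define s where "s = (1 - \<gamma>) / \<eta>"
  have s: "s > 0" using assms False by (simp add: s_def)
  have s\<eta>: "s * \<eta> = 1 - \<gamma>" using False by (simp add: s_def)
  show ?thesis
  proof (intro exI [of _ "s powr (- \<eta>)"] conjI allI impI)
    fix n :: nat assume n: "n \<ge> 2"
    have "ln (real n) \<le> real n powr s / s" using n s by (intro ln_powr_bound) auto
    then have "ln (real n) powr \<eta> \<le> (real n powr s / s) powr \<eta>"
      using n False by (intro powr_mono2) auto
    moreover have "(real n powr s / s) powr \<eta> = real n powr (1 - \<gamma>) * s powr (- \<eta>)"
      using s n by (simp add: powr_divide powr_powr s\<eta> powr_minus_divide)
    ultimately have "real n powr \<gamma> * ln (real n) powr \<eta> \<le> real n powr \<gamma> * (real n powr (1 - \<gamma>) * s powr (- \<eta>))"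
      by (intro mult_left_mono) auto
    also have "\<dots> = s powr (- \<eta>) * real n"
      using n by (simp add: mult.assoc [symmetric] powr_add [symmetric])
    finally show "real n powr \<gamma> * ln (real n) powr \<eta> \<le> s powr (- \<eta>) * real n" .
  qed (use s in simp)
qed

theorem mainTheorem5:
  fixes \<gamma> \<eta> :: real and d x \<alpha> :: "nat \<Rightarrow> real"
  assumes exponents: "1 / 2 < \<gamma> \<and> \<gamma> < 1 \<or> \<gamma> = 1 \<and> \<eta> \<le> 0"
    and d_1: "d 1 > 0"
    and d_n: "\<And>n. n \<ge> 2 \<Longrightarrow> d n = 1 / (real n powr \<gamma> * ln (real n) powr \<eta>)"
    and x_0: "x 0 = 0"
    and x_n: "\<And>n. n \<ge> 1 \<Longrightarrow> x n = x (n - 1) + d n"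
    and conditions:
      "filterlim (\<lambda>N. \<Sum>n=2..N. \<bar>\<alpha> n\<bar> * real n powr (- 3 * \<gamma>) * ln (real n) powr (- 3 * \<eta>))
         at_top sequentially \<or>
       (\<exists>C1>0. \<forall>n\<ge>2. \<alpha> n \<le>
          - 2 * (real n powr \<gamma> * ln (real n) powr \<eta> +
                 real (n + 1) powr \<gamma> * ln (real (n + 1)) powr \<eta>) +
          C1 / (real n powr \<gamma> * ln (real n) powr \<eta>)) \<or>
       (\<exists>C2>0. \<forall>n\<ge>2. \<alpha> n \<ge> - (C2 / (real n powr \<gamma> * ln (real n) powr \<eta>)))"
  shows "self_adjoint {0<..} (hamiltonian x \<alpha>)"
proof -
  define f where "f n = real n powr \<gamma> * ln (real n) powr \<eta>" for n :: nat
  define \<delta> where "\<delta> n = x (Suc n) - x n" for n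
  have \<delta>d: "\<delta> n = d (Suc n)" for n using x_n [of "Suc n"] by (simp add: \<delta>_def)
  have f_pos: "f n > 0" if "n \<ge> 2" for n using that by (simp add: f_def)
  have df: "d n = 1 / f n" if "n \<ge> 2" for n using d_n [OF that] by (simp add: f_def)
  have d_pos: "d n > 0" if "n \<ge> 1" for n
  proof (cases "n = 1")
    case False
    then show ?thesis using that df [of n] f_pos [of n] by simp
  qed (use d_1 in simp)
  have \<delta>_pos: "\<delta> n > 0" for n using d_pos [of "Suc n"] by (simp add: \<delta>d)
  have \<delta>_diverges: "\<not> summable \<delta>"
  proof
    assume s: "summable \<delta>"
    obtain c where c: "c > 0" "\<And>n. n \<ge> 2 \<Longrightarrow> f n \<le> c * real n"
      using power_log_le [of \<gamma> \<eta>] exponents unfolding f_def by blast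
    have "summable (\<lambda>n. inverse (real (Suc n)))"
    proof (rule summable_comparison_test' [where N = 1])
      show "summable (\<lambda>n. c * \<delta> n)" using s by (rule summable_mult)
      fix n :: nat assume "n \<ge> 1"
      then have n: "Suc n \<ge> 2" by simp
      have "1 / real (Suc n) \<le> c / f (Suc n)"
        using c(2) [OF n] f_pos [OF n] by (simp add: field_simps)
      then show "norm (inverse (real (Suc n))) \<le> c * \<delta> n"
        by (simp add: \<delta>d df [OF n] inverse_eq_divide)
    qed
    then have "summable (\<lambda>n. inverse (real n))" by (rule summable_Suc_iff [THEN iffD1])
    then show False using not_summable_harmonic by blast
  qed
  have x_mono: "strict_mono x"
    by (rule strict_monoI_Suc) (use \<delta>_pos in \<open>simp add: \<delta>_def\<close>)
  have x_sum: "x n = (\<Sum>i<n. \<delta> i)" for n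
    unfolding \<delta>_def sum_lessThan_telescope using x_0 by simp
  have x_unbounded: "filterlim x at_top sequentially"
    unfolding filterlim_at_top
  proof
    fix Z
    have "\<exists>N. x N > Z"
    proof (rule ccontr)
      assume "\<not> (\<exists>N. x N > Z)"
      then have le: "(\<Sum>i<n. \<delta> i) \<le> Z" for n by (simp add: x_sum not_less)
      have "summable \<delta>"
        by (rule bounded_imp_summable [of _ Z]) (use \<delta>_pos le in \<open>auto simp only: less_imp_le lessThan_Suc_atMost [symmetric]\<close>)
      then show False using \<delta>_diverges by simp
    qed
    then obtain N where N: "x N > Z" by blast
    have "x n \<ge> Z" if "n \<ge> N" for n
    proof -
      have "x N \<le> x n" using that x_mono by (simp add: strict_mono_less_eq)
      then show ?thesis using N by simp
    qed
    then show "\<forall>\<^sub>F n in sequentially. Z \<le> x n" by (auto simp: eventually_sequentially)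
  qed
  define R where "R = 2 powr (\<bar>\<gamma>\<bar> + \<bar>\<eta>\<bar>)"
  define K where "K = max R (max (\<delta> 0 / \<delta> 1) (\<delta> 1 / \<delta> 0))"
  have K: "\<delta> n \<le> K * \<delta> (Suc n) \<and> \<delta> (Suc n) \<le> K * \<delta> n" for n
  proof (cases "n = 0")
    case True
    have "\<delta> 0 / \<delta> 1 \<le> K" "\<delta> 1 / \<delta> 0 \<le> K" by (simp_all add: K_def)
    then show ?thesis using True \<delta>_pos [of 0] \<delta>_pos [of 1] by (simp add: pos_divide_le_eq)
  next
    case False
    then have n: "Suc n \<ge> 2" "Suc (Suc n) \<ge> 2" by simp_all
    have "f (Suc (Suc n)) \<le> R * f (Suc n)" "f (Suc n) \<le> R * f (Suc (Suc n))"
      using power_log_ratio [OF n(1), of \<gamma> \<eta>] by (simp_all only: f_def R_def)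
    then have "\<delta> n \<le> R * \<delta> (Suc n)" "\<delta> (Suc n) \<le> R * \<delta> n"
      using f_pos [OF n(1)] f_pos [OF n(2)] unfolding \<delta>d df [OF n(1)] df [OF n(2)] by (simp_all add: field_simps)
    moreover have "R * \<delta> m \<le> K * \<delta> m" for m
      using \<delta>_pos [of m] by (intro mult_right_mono) (simp_all add: K_def)
    ultimately show ?thesis using order_trans by blast
  qed
  obtain c where c: "c > 0" "\<And>n. n \<ge> 2 \<Longrightarrow> c \<le> f n"
    using power_log_ge [of \<gamma> \<eta>] exponents unfolding f_def by (metis less_divide_eq_numeral1(1) less_trans mult_zero_left zero_less_one)
  define B where "B = max (d 1) (1 / c)"
  have B: "\<delta> n \<le> B" for n
  proof (cases "n = 0")
    case False
    then have n: "Suc n \<ge> 2" by simp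
    have "d (Suc n) \<le> 1 / c"
      unfolding df [OF n] using c(1) c(2) [OF n] by (intro divide_left_mono) auto
    then show ?thesis by (simp add: \<delta>d B_def)
  qed (simp add: \<delta>d B_def)
  interpret comparable_grid x \<alpha> K B
    by unfold_locales
       (use x_0 x_mono x_unbounded \<delta>_pos B K \<delta>_diverges in \<open>simp_all add: \<delta>_def [abs_def]\<close>)
  from conditions [folded f_def]
  have "\<not> summable (\<lambda>n. \<bar>\<alpha> (Suc n)\<bar> * \<delta> n ^ 3) \<or>
    (\<exists>C\<ge>0. \<exists>N. \<forall>n\<ge>N. \<alpha> (Suc n) \<le> - 2 * (1 / \<delta> n + 1 / \<delta> (Suc n)) + C * \<delta> n) \<or>
    (\<exists>C\<ge>0. \<exists>N. \<forall>n\<ge>N. \<alpha> (Suc n) \<ge> - C * \<delta> n)"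
  proof (elim disjE exE conjE)
    assume lim: "filterlim (\<lambda>N. \<Sum>n=2..N. \<bar>\<alpha> n\<bar> * real n powr (- 3 * \<gamma>) * ln (real n) powr (- 3 * \<eta>)) at_top sequentially"
    have cube: "\<bar>\<alpha> n\<bar> * real n powr (- 3 * \<gamma>) * ln (real n) powr (- 3 * \<eta>) = \<bar>\<alpha> n\<bar> * d n ^ 3" if "n \<ge> 2" for n
    proof -
      have "(a powr b) ^ 3 = a powr (3 * b)" if "a > 0" for a b :: real
        using powr_powr [of a b 3] that by (simp add: mult.commute flip: powr_numeral)
      then show ?thesis
        using that by (simp add: d_n [OF that] power_divide power_mult_distrib powr_minus divide_inverse power_inverse)
    qed
    have "\<not> summable (\<lambda>n. \<bar>\<alpha> (Suc n)\<bar> * \<delta> n ^ 3)"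
    proof
      assume "summable (\<lambda>n. \<bar>\<alpha> (Suc n)\<bar> * \<delta> n ^ 3)"
      then have "summable (\<lambda>n. \<bar>\<alpha> (Suc n)\<bar> * d (Suc n) ^ 3)" by (simp only: \<delta>d)
      moreover have "\<bar>d (Suc n)\<bar> = d (Suc n)" for n using d_pos [of "Suc n"] by simp
      ultimately have "summable (\<lambda>n. \<bar>\<alpha> (Suc n)\<bar> * \<bar>d (Suc n)\<bar> ^ 3)" by (simp only:)
      then have s: "summable (\<lambda>n. \<bar>\<alpha> n\<bar> * \<bar>d n\<bar> ^ 3)"
        using summable_Suc_iff [of "\<lambda>n. \<bar>\<alpha> n\<bar> * \<bar>d n\<bar> ^ 3"] by blast
      define T where "T = (\<Sum>n. \<bar>\<alpha> n\<bar> * \<bar>d n\<bar> ^ 3)"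
      have "(\<Sum>n=2..N. \<bar>\<alpha> n\<bar> * real n powr (- 3 * \<gamma>) * ln (real n) powr (- 3 * \<eta>)) \<le> T" for N
      proof -
        have "(\<Sum>n=2..N. \<bar>\<alpha> n\<bar> * real n powr (- 3 * \<gamma>) * ln (real n) powr (- 3 * \<eta>)) = (\<Sum>n=2..N. \<bar>\<alpha> n\<bar> * \<bar>d n\<bar> ^ 3)"
          by (rule sum.cong) (use cube d_pos in \<open>auto simp: abs_of_pos\<close>)
        also have "\<dots> \<le> T" unfolding T_def by (rule sum_le_suminf [OF s]) auto
        finally show ?thesis .
      qed
      moreover have "\<forall>\<^sub>F N in sequentially. (\<Sum>n=2..N. \<bar>\<alpha> n\<bar> * real n powr (- 3 * \<gamma>) * ln (real n) powr (- 3 * \<eta>)) > T"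
        using lim by (simp add: filterlim_at_top_dense)
      ultimately show False by (auto simp: eventually_sequentially not_less [symmetric])
    qed
    then show ?thesis by (rule disjI1)
  next
    fix C1 :: real assume C: "C1 > 0" "\<forall>n\<ge>2. \<alpha> n \<le> - 2 * (f n + f (n + 1)) + C1 / f n"
    have "\<alpha> (Suc n) \<le> - 2 * (1 / \<delta> n + 1 / \<delta> (Suc n)) + C1 * \<delta> n" if "n \<ge> 1" for n
      using C(2) [rule_format, of "Suc n"] that df [of "Suc n"] df [of "Suc (Suc n)"] by (simp add: \<delta>d)
    then show ?thesis
      using C(1) by (intro disjI2 [OF disjI1] exI [of _ C1] conjI exI [of _ 1] allI impI) auto
  next
    fix C2 :: real assume C: "C2 > 0" "\<forall>n\<ge>2. \<alpha> n \<ge> - (C2 / f n)"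
    have "\<alpha> (Suc n) \<ge> - C2 * \<delta> n" if "n \<ge> 1" for n
      using C(2) [rule_format, of "Suc n"] that df [of "Suc n"] by (simp add: \<delta>d)
    then show ?thesis
      using C(1) by (intro disjI2 [OF disjI2] exI [of _ C2] conjI exI [of _ 1] allI impI) auto
  qed
  then show ?thesis unfolding \<delta>_def by (rule self_adjoint_if)
qed

end
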